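(* Let $U$ be a theory of finite signature $\Sigma_U$ that is not finitely axiomatizable, and let $\Theta$ be a finite signature disjoint from $\Sigma_U$ containing at least one predicate symbol of arity $\geq 2$. Then for every sentence $\alpha$ of signature $\Sigma_U+\Theta$ that is a conservative extension of $U$, there is a sentence $\beta$ of signature $\Sigma_U+\Theta$ that is a conservative extension of $U$ and satisfies $\alpha\vdash\beta$ and $\beta\nvdash\alpha$.
   Context: All signatures are purely relational (predicate symbols only); first-order logic with identity as a logical symbol. $\Sigma_U+\Theta$ is the union of the two disjoint signatures. A sentence is identified with the theory it axiomatizes. "$U$ is not finitely axiomatizable" means no single $\Sigma_U$-sentence axiomatizes $U$. A sentence $\alpha$ of signature $\Sigma_U+\Theta$ is a conservative extension of $U$ if $\alpha\vdash U$ (i.e. $\alpha$ proves every theorem of $U$) and, for all $\Sigma_U$-sentences $A$, if $\alpha\vdash A$ then $U\vdash A$. *)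

theory Defs
  imports Main
begin

text \<open>
  A relational signature assigns an arity to each of its predicate symbols; its symbols are the
  elements of its domain. Signatures with disjoint domains are joined with \<^term>\<open>(++)\<close>.
\<close>

type_synonym 'p signature = "'p \<rightharpoonup> nat"

text \<open>
  Formulas use de Bruijn indices: in \<open>Forall \<phi>\<close> the index 0 of \<open>\<phi>\<close> is bound and the index \<open>Suc n\<close>
  stands for the outer index \<open>n\<close>. There are no function symbols, so terms are just variables.
  The remaining connectives and the existential quantifier are classically definable.
\<close>

datatype 'p fm =
    Pred 'p "nat list"
  | Eq nat nat
  | Bot
  | Imp "'p fm" "'p fm"
  | Forall "'p fm"

abbreviation Neg :: "'p fm \<Rightarrow> 'p fm" where
  "Neg \<phi> \<equiv> Imp \<phi> Bot"

primrec fm_over :: "'p signature \<Rightarrow> 'p fm \<Rightarrow> bool" where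
  "fm_over S (Pred p xs) \<longleftrightarrow> S p = Some (length xs)"
| "fm_over S (Eq x y) \<longleftrightarrow> True"
| "fm_over S Bot \<longleftrightarrow> True"
| "fm_over S (Imp \<phi> \<psi>) \<longleftrightarrow> fm_over S \<phi> \<and> fm_over S \<psi>"
| "fm_over S (Forall \<phi>) \<longleftrightarrow> fm_over S \<phi>"

primrec free_vars :: "'p fm \<Rightarrow> nat set" where
  "free_vars (Pred p xs) = set xs"
| "free_vars (Eq x y) = {x, y}"
| "free_vars Bot = {}"
| "free_vars (Imp \<phi> \<psi>) = free_vars \<phi> \<union> free_vars \<psi>"
| "free_vars (Forall \<phi>) = {n. Suc n \<in> free_vars \<phi>}"

definition sentence :: "'p signature \<Rightarrow> 'p fm \<Rightarrow> bool" where
  "sentence S \<phi> \<longleftrightarrow> fm_over S \<phi> \<and> free_vars \<phi> = {}"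

primrec rename :: "(nat \<Rightarrow> nat) \<Rightarrow> 'p fm \<Rightarrow> 'p fm" where
  "rename f (Pred p xs) = Pred p (map f xs)"
| "rename f (Eq x y) = Eq (f x) (f y)"
| "rename f Bot = Bot"
| "rename f (Imp \<phi> \<psi>) = Imp (rename f \<phi>) (rename f \<psi>)"
| "rename f (Forall \<phi>) = Forall (rename (case_nat 0 (\<lambda>n. Suc (f n))) \<phi>)"

text \<open>\<open>inst x \<phi>\<close> is the instance of \<open>Forall \<phi>\<close> at the variable \<open>x\<close>.\<close>

definition inst :: "nat \<Rightarrow> 'p fm \<Rightarrow> 'p fm" where
  "inst x \<phi> = rename (case_nat x (\<lambda>n. n)) \<phi>"

text \<open>
  Classical natural deduction with identity. In \<open>ForallI\<close>, shifting every assumption by \<open>Suc\<close>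
  makes the index 0 fresh, which is the eigenvariable condition. The relation is not indexed by a
  signature: a derivation may pass through formulas with further symbols, which in pure first-order
  logic does not affect what is derivable between formulas over a given signature.
\<close>

inductive proves :: "'p fm set \<Rightarrow> 'p fm \<Rightarrow> bool" (infix "\<turnstile>" 50) where
  Assm: "\<phi> \<in> \<Gamma> \<Longrightarrow> \<Gamma> \<turnstile> \<phi>"
| ImpI: "insert \<phi> \<Gamma> \<turnstile> \<psi> \<Longrightarrow> \<Gamma> \<turnstile> Imp \<phi> \<psi>"
| ImpE: "\<Gamma> \<turnstile> Imp \<phi> \<psi> \<Longrightarrow> \<Gamma> \<turnstile> \<phi> \<Longrightarrow> \<Gamma> \<turnstile> \<psi>"
| Contr: "insert (Neg \<phi>) \<Gamma> \<turnstile> Bot \<Longrightarrow> \<Gamma> \<turnstile> \<phi>"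
| ForallI: "rename Suc ` \<Gamma> \<turnstile> \<phi> \<Longrightarrow> \<Gamma> \<turnstile> Forall \<phi>"
| ForallE: "\<Gamma> \<turnstile> Forall \<phi> \<Longrightarrow> \<Gamma> \<turnstile> inst x \<phi>"
| EqRefl: "\<Gamma> \<turnstile> Eq x x"
| EqSubst: "\<Gamma> \<turnstile> Eq x y \<Longrightarrow> \<Gamma> \<turnstile> inst x \<phi> \<Longrightarrow> \<Gamma> \<turnstile> inst y \<phi>"

text \<open>
  A theory is given by an arbitrary set of axioms, not assumed to be deductively closed or
  enumerable; its theorems are the sentences of its signature derivable from the axioms.
\<close>

definition theory_over :: "'p signature \<Rightarrow> 'p fm set \<Rightarrow> bool" where
  "theory_over S U \<longleftrightarrow> (\<forall>A\<in>U. sentence S A)"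

definition axiomatizes :: "'p signature \<Rightarrow> 'p fm \<Rightarrow> 'p fm set \<Rightarrow> bool" where
  "axiomatizes S \<sigma> U \<longleftrightarrow> (\<forall>A. sentence S A \<longrightarrow> ({\<sigma>} \<turnstile> A \<longleftrightarrow> U \<turnstile> A))"

definition finitely_axiomatizable :: "'p signature \<Rightarrow> 'p fm set \<Rightarrow> bool" where
  "finitely_axiomatizable S U \<longleftrightarrow> (\<exists>\<sigma>. sentence S \<sigma> \<and> axiomatizes S \<sigma> U)"

text \<open>The signature \<open>S\<close> is that of the theory \<open>U\<close>; \<open>\<alpha>\<close> may use further symbols.\<close>

definition conservative_extension :: "'p signature \<Rightarrow> 'p fm \<Rightarrow> 'p fm set \<Rightarrow> bool" where
  "conservative_extension S \<alpha> U \<longleftrightarrow>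
     (\<forall>A. sentence S A \<longrightarrow> U \<turnstile> A \<longrightarrow> {\<alpha>} \<turnstile> A) \<and>
     (\<forall>A. sentence S A \<longrightarrow> {\<alpha>} \<turnstile> A \<longrightarrow> U \<turnstile> A)"

end

theory Submission
  imports Defs "HOL-Library.Countable" "HOL-Library.Nat_Bijection" "HOL-Library.Infinite_Set"
begin

text \<open>
  It suffices to find a sentence \<open>\<gamma>\<close> that proves \<open>U\<close> but not \<open>\<alpha>\<close>: then \<open>\<beta>\<close> is \<open>\<alpha> \<or> \<gamma>\<close>. By
  self-reference, \<open>\<gamma>\<close> says that the binary relation codes a linearly ordered derivation of \<open>\<alpha>\<close> from
  \<open>\<gamma>\<close>. Derivations are those of a Horn program over binary trees, so that a coded derivation whose
  order is finite is a real one. If \<open>\<gamma>\<close> did prove \<open>\<alpha>\<close>, a real derivation could be coded in any large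
  model, in particular in one violating \<open>U\<close>, a contradiction. Hence \<open>\<gamma>\<close> does not prove \<open>\<alpha>\<close>, and in
  each of its models the order is infinite.

  It remains to make infinity of the order entail \<open>U\<close>. If all infinite models of some consequence
  of \<open>U\<close> are models of \<open>U\<close>, then \<open>\<gamma>\<close> includes this consequence. Otherwise \<open>U\<close> fails in infinite
  models of any given finite part of it, and \<open>\<gamma>\<close> also says that the relation codes a model of \<open>\<alpha>\<close> and
  a back-and-forth system between it and the ambient structure, with levels from the order. A finite
  number of levels is available in suitable models violating \<open>U\<close>, by the finiteness of the set of
  Hintikka sentences of given rank, whereas an infinite order makes both structures elementarily
  equivalent for the language of \<open>U\<close>.
\<close>

section \<open>Semantics and completeness\<close>

text \<open>A single sentence cannot mention the arbitrary theory \<open>U\<close>. It can only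
  enforce \<open>U\<close> through its infinite models or through a coded model of
  \<open>\<alpha>\<close>, and self-reference is what forces the order to be infinite. That \<gamma>
  does not prove \<open>\<alpha>\<close> needs models of \<gamma> in which a theorem of
  \<open>U\<close> fails, and these may all be finite. So nothing like arithmetic can be demanded of
  the coding. Its requirements must be satisfiable in finite structures: they ask for a
  justification of each coded fact, never for the existence of further trees. The case distinction
  is a matter of room. A derivation occupies a bounded part of a large finite domain, while a model
  of \<open>\<alpha>\<close> together with all positions of a game needs an infinite one. Derivation
  and game share one order, so that a real derivation calls for only finitely many levels, while the
  absence of one guarantees arbitrarily many moves. That \<open>U\<close> is not finitely
  axiomatizable enters in one form only: no consequence of \<open>\<alpha>\<close> in the signature
  of \<open>U\<close> entails all the others.\<close>

primrec sat :: "'d set \<Rightarrow> ('p \<Rightarrow> 'd list \<Rightarrow> bool) \<Rightarrow> (nat \<Rightarrow> 'd) \<Rightarrow> 'p fm \<Rightarrow> bool" where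
  "sat D I e (Pred p xs) \<longleftrightarrow> I p (map e xs)"
| "sat D I e (Eq x y) \<longleftrightarrow> e x = e y"
| "sat D I e Bot \<longleftrightarrow> False"
| "sat D I e (Imp \<phi> \<psi>) \<longleftrightarrow> (sat D I e \<phi> \<longrightarrow> sat D I e \<psi>)"
| "sat D I e (Forall \<phi>) \<longleftrightarrow> (\<forall>d\<in>D. sat D I (case_nat d e) \<phi>)"

lemma sat_cong:
  assumes "\<And>x. x \<in> free_vars \<phi> \<Longrightarrow> e x = e' x"
  shows "sat D I e \<phi> \<longleftrightarrow> sat D I e' \<phi>"
  using assms
proof (induction \<phi> arbitrary: e e')
  case (Pred p xs)
  then have "map e xs = map e' xs" by auto
  then show ?case by (metis sat.simps(1))
next
  case (Imp \<phi> \<psi>)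
  have "sat D I e \<phi> = sat D I e' \<phi>" "sat D I e \<psi> = sat D I e' \<psi>"
    by (rule Imp.IH; use Imp.prems in auto)+
  then show ?case by simp
next
  case (Forall \<phi>)
  have "sat D I (case_nat d e) \<phi> = sat D I (case_nat d e') \<phi>" for d
    by (rule Forall.IH) (use Forall.prems in \<open>auto split: nat.split\<close>)
  then show ?case by simp
qed auto

lemma sat_rename: "sat D I e (rename f \<phi>) \<longleftrightarrow> sat D I (e \<circ> f) \<phi>"
proof (induction \<phi> arbitrary: e f)
  case (Forall \<phi>)
  have "case_nat d e \<circ> case_nat 0 (\<lambda>n. Suc (f n)) = case_nat d (e \<circ> f)" for d
    by (auto split: nat.split)
  then show ?case by (simp only: rename.simps sat.simps Forall)
qed auto

lemma sat_inst: "sat D I e (inst x \<phi>) \<longleftrightarrow> sat D I (case_nat (e x) e) \<phi>"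
proof -
  have "e \<circ> case_nat x (\<lambda>n. n) = case_nat (e x) e"
    by (auto split: nat.split)
  then show ?thesis by (simp add: inst_def sat_rename)
qed

text \<open>\<open>ForallE\<close> instantiates at arbitrary variables, hence the condition
  \<open>range e \<subseteq> D\<close>, which also keeps \<open>D\<close> nonempty. Domains are sets
  rather than types so that a structure coded on a subset of another one falls under the same
  definition.\<close>

lemma soundness:
  assumes "\<Gamma> \<turnstile> \<phi>" and "range e \<subseteq> D" and "\<And>\<psi>. \<psi> \<in> \<Gamma> \<Longrightarrow> sat D I e \<psi>"
  shows "sat D I e \<phi>"
  using assms
proof (induction arbitrary: e rule: proves.induct)
  case (ForallI \<Gamma> \<phi>)
  have "sat D I (case_nat d e) \<phi>" if "d \<in> D" for d
  proof (rule ForallI.IH)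
    show "range (case_nat d e) \<subseteq> D" using that ForallI.prems(1) by (auto split: nat.split simp: range_subsetD)
    have "case_nat d e \<circ> Suc = e" by auto
    then show "sat D I (case_nat d e) \<psi>" if "\<psi> \<in> rename Suc ` \<Gamma>" for \<psi>
      using that ForallI.prems by (auto simp: sat_rename)
  qed
  then show ?case by simp
next
  case (ForallE \<Gamma> \<phi> x)
  then show ?case by (auto simp: sat_inst range_subsetD)
next
  case (EqSubst \<Gamma> x y \<phi>)
  then have "e x = e y" by simp
  moreover have "sat D I e (inst x \<phi>)" by (rule EqSubst.IH(2)) (use EqSubst.prems in auto)
  ultimately show ?case by (simp add: sat_inst)
next
  case (ImpI \<phi> \<Gamma> \<psi>)
  show ?case unfolding sat.simps
  proof
    assume "sat D I e \<phi>"
    then show "sat D I e \<psi>" using ImpI.IH[of e] ImpI.prems by auto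
  qed
next
  case (Contr \<phi> \<Gamma>)
  show ?case
  proof (rule ccontr)
    assume "\<not> sat D I e \<phi>"
    then have "sat D I e Bot" using Contr.prems by (intro Contr.IH) auto
    then show False by simp
  qed
qed simp_all

section \<open>Renaming, weakening and finite support of derivations\<close>

lemma rename_comp: "rename f (rename g \<phi>) = rename (f \<circ> g) \<phi>"
proof (induction \<phi> arbitrary: f g)
  case (Forall \<phi>)
  have "case_nat 0 (\<lambda>n. Suc (f n)) \<circ> case_nat 0 (\<lambda>n. Suc (g n)) = case_nat 0 (\<lambda>n. Suc ((f \<circ> g) n))"
    by (auto split: nat.split)
  then show ?case by (simp only: rename.simps Forall)
qed auto

lemma rename_cong: "(\<And>x. x \<in> free_vars \<phi> \<Longrightarrow> f x = g x) \<Longrightarrow> rename f \<phi> = rename g \<phi>"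
proof (induction \<phi> arbitrary: f g)
  case (Forall \<phi>)
  have "rename (case_nat 0 (\<lambda>n. Suc (f n))) \<phi> = rename (case_nat 0 (\<lambda>n. Suc (g n))) \<phi>"
    by (rule Forall.IH) (use Forall.prems in \<open>auto split: nat.split\<close>)
  then show ?case by simp
next
  case (Imp \<phi> \<psi>)
  have "rename f \<phi> = rename g \<phi>" "rename f \<psi> = rename g \<psi>"
    by (rule Imp.IH; use Imp.prems in auto)+
  then show ?case by simp
qed auto

lemma rename_ident: "rename (\<lambda>x. x) \<phi> = \<phi>"
proof (induction \<phi>)
  case (Forall \<phi>)
  have "case_nat 0 (\<lambda>n. Suc n) = (\<lambda>x. x)" by (auto split: nat.split)
  then show ?case using Forall by simp
qed auto

lemma rename_sentence: "free_vars \<phi> = {} \<Longrightarrow> rename f \<phi> = \<phi>"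
  using rename_cong[of \<phi> f "\<lambda>x. x"] rename_ident[of \<phi>] by simp

lemma rename_inst: "rename f (inst x \<phi>) = inst (f x) (rename (case_nat 0 (\<lambda>n. Suc (f n))) \<phi>)"
proof -
  have "f \<circ> case_nat x (\<lambda>n. n) = case_nat (f x) (\<lambda>n. n) \<circ> case_nat 0 (\<lambda>n. Suc (f n))"
    by (auto split: nat.split)
  then show ?thesis by (simp add: inst_def rename_comp)
qed

lemma proves_rename: "\<Gamma> \<turnstile> \<phi> \<Longrightarrow> rename f ` \<Gamma> \<turnstile> rename f \<phi>"
proof (induction arbitrary: f rule: proves.induct)
  case (ForallI \<Gamma> \<phi>)
  have "case_nat 0 (\<lambda>n. Suc (f n)) \<circ> Suc = Suc \<circ> f" by auto
  then have "rename (case_nat 0 (\<lambda>n. Suc (f n))) ` rename Suc ` \<Gamma> = rename Suc ` rename f ` \<Gamma>"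
    by (simp add: image_image rename_comp)
  then show ?case using ForallI.IH[of "case_nat 0 (\<lambda>n. Suc (f n))"]
    by (auto intro: proves.ForallI)
next
  case (ForallE \<Gamma> \<phi> x)
  then show ?case by (simp add: rename_inst proves.ForallE)
next
  case (EqSubst \<Gamma> x y \<phi>)
  then show ?case by (auto simp: rename_inst intro: proves.EqSubst)
next
  case (ImpE \<Gamma> \<phi> \<psi>)
  then show ?case by (auto intro: proves.ImpE)
qed (auto intro: proves.intros)

lemma weakening: "\<Gamma> \<turnstile> \<phi> \<Longrightarrow> \<Gamma> \<subseteq> \<Delta> \<Longrightarrow> \<Delta> \<turnstile> \<phi>"
proof (induction arbitrary: \<Delta> rule: proves.induct)
  case (ImpI \<phi> \<Gamma> \<psi>)
  then show ?case by (meson insert_mono proves.ImpI)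
next
  case (Contr \<phi> \<Gamma>)
  then show ?case by (meson insert_mono proves.Contr)
next
  case (ForallI \<Gamma> \<phi>)
  then show ?case by (meson image_mono proves.ForallI)
qed (meson proves.Assm proves.ImpE proves.ForallE proves.EqRefl proves.EqSubst subsetD)+

lemma proves_finite: "\<Gamma> \<turnstile> \<phi> \<Longrightarrow> \<exists>\<Delta>. finite \<Delta> \<and> \<Delta> \<subseteq> \<Gamma> \<and> \<Delta> \<turnstile> \<phi>"
proof (induction rule: proves.induct)
  case (Assm \<phi> \<Gamma>)
  then show ?case by (intro exI[of _ "{\<phi>}"]) (simp add: proves.Assm)
next
  case (ImpI \<phi> \<Gamma> \<psi>)
  then obtain \<Delta> where \<Delta>: "finite \<Delta>" "\<Delta> \<subseteq> insert \<phi> \<Gamma>" "\<Delta> \<turnstile> \<psi>" by blast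
  have "\<Delta> - {\<phi>} \<turnstile> Imp \<phi> \<psi>"
    by (rule proves.ImpI, rule weakening[OF \<Delta>(3)]) blast
  then show ?case using \<Delta> by (intro exI[of _ "\<Delta> - {\<phi>}"]) auto
next
  case (ImpE \<Gamma> \<phi> \<psi>)
  obtain \<Delta> where \<Delta>: "finite \<Delta>" "\<Delta> \<subseteq> \<Gamma>" "\<Delta> \<turnstile> Imp \<phi> \<psi>" using ImpE.IH(1) by blast
  obtain \<Delta>' where \<Delta>': "finite \<Delta>'" "\<Delta>' \<subseteq> \<Gamma>" "\<Delta>' \<turnstile> \<phi>" using ImpE.IH(2) by blast
  have "\<Delta> \<union> \<Delta>' \<turnstile> \<psi>"
    by (rule proves.ImpE[OF weakening[OF \<Delta>(3)] weakening[OF \<Delta>'(3)]]) blast+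
  then show ?case using \<Delta> \<Delta>' by (intro exI[of _ "\<Delta> \<union> \<Delta>'"]) simp
next
  case (Contr \<phi> \<Gamma>)
  then obtain \<Delta> where \<Delta>: "finite \<Delta>" "\<Delta> \<subseteq> insert (Neg \<phi>) \<Gamma>" "\<Delta> \<turnstile> Bot" by blast
  have "\<Delta> - {Neg \<phi>} \<turnstile> \<phi>"
    by (rule proves.Contr, rule weakening[OF \<Delta>(3)]) blast
  then show ?case using \<Delta> by (intro exI[of _ "\<Delta> - {Neg \<phi>}"]) auto
next
  case (ForallI \<Gamma> \<phi>)
  then obtain \<Delta> where "finite \<Delta>" "\<Delta> \<subseteq> rename Suc ` \<Gamma>" "\<Delta> \<turnstile> \<phi>" by blast
  then show ?case by (metis finite_subset_image proves.ForallI)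
next
  case (EqSubst \<Gamma> x y \<phi>)
  obtain \<Delta> where \<Delta>: "finite \<Delta>" "\<Delta> \<subseteq> \<Gamma>" "\<Delta> \<turnstile> Eq x y" using EqSubst.IH(1) by blast
  obtain \<Delta>' where \<Delta>': "finite \<Delta>'" "\<Delta>' \<subseteq> \<Gamma>" "\<Delta>' \<turnstile> inst x \<phi>" using EqSubst.IH(2) by blast
  have "\<Delta> \<union> \<Delta>' \<turnstile> inst y \<phi>"
    by (rule proves.EqSubst[OF weakening[OF \<Delta>(3)] weakening[OF \<Delta>'(3)]]) blast+
  then show ?case using \<Delta> \<Delta>' by (intro exI[of _ "\<Delta> \<union> \<Delta>'"]) simp
next
  case (ForallE \<Gamma> \<phi> x)
  then show ?case using proves.ForallE by blast
next
  case (EqRefl \<Gamma> x)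
  have "{} \<turnstile> Eq x x" by (rule proves.EqRefl)
  then show ?case by blast
qed

lemma cut: "\<Gamma> \<turnstile> \<phi> \<Longrightarrow> insert \<phi> \<Gamma> \<turnstile> \<psi> \<Longrightarrow> \<Gamma> \<turnstile> \<psi>"
  by (meson proves.ImpE proves.ImpI)

section \<open>The Henkin construction\<close>

lemma finite_free_vars: "finite (free_vars \<phi>)"
proof (induction \<phi>)
  case (Forall \<phi>)
  then show ?case by (auto intro: finite_vimageI[of _ Suc, unfolded vimage_def])
qed auto

abbreviation consistent :: "'p fm set \<Rightarrow> bool" where
  "consistent \<Gamma> \<equiv> \<not> \<Gamma> \<turnstile> Bot"

lemma henkin_witness:
  assumes cons: "consistent \<Gamma>" and mem: "Neg (Forall \<psi>) \<in> \<Gamma>"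
    and fresh: "x \<notin> \<Union> (free_vars ` \<Gamma>)"
  shows "consistent (insert (Neg (inst x \<psi>)) \<Gamma>)"
proof
  assume "insert (Neg (inst x \<psi>)) \<Gamma> \<turnstile> Bot"
  then have 1: "\<Gamma> \<turnstile> inst x \<psi>" by (rule proves.Contr)
  \<comment> \<open>\<open>f\<close> moves the fresh variable to index 0 and shifts all others. On
    \<Gamma> it acts like \<open>Suc\<close>, and on \<open>inst x \<psi>\<close> it undoes the
    instantiation, which yields the premise of \<open>ForallI\<close>.\<close>
  define f where "f = (\<lambda>y. if y = x then 0 else Suc y)"
  have "rename f \<chi> = rename Suc \<chi>" if "\<chi> \<in> \<Gamma>" for \<chi>
    by (rule rename_cong) (use fresh that in \<open>auto simp: f_def\<close>)
  then have 2: "rename f ` \<Gamma> = rename Suc ` \<Gamma>" by (rule image_cong[OF refl])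
  have fx: "Suc x \<notin> free_vars \<psi>" using fresh mem by auto
  have "rename f (inst x \<psi>) = rename (\<lambda>x. x) \<psi>"
    unfolding inst_def rename_comp
    by (rule rename_cong) (use fx in \<open>auto simp: f_def split: nat.split\<close>)
  then have "rename Suc ` \<Gamma> \<turnstile> \<psi>"
    using proves_rename[OF 1, of f] by (simp add: 2 rename_ident)
  then have "\<Gamma> \<turnstile> Forall \<psi>" by (rule proves.ForallI)
  then show False using cons mem by (meson proves.Assm proves.ImpE)
qed

definition henkin_step :: "'p fm \<Rightarrow> 'p fm set \<Rightarrow> 'p fm set" where
  "henkin_step \<phi> \<Gamma> = (if consistent (insert \<phi> \<Gamma>) then
     insert \<phi> \<Gamma> \<union> (\<lambda>\<psi>. Neg (inst (LEAST x. x \<notin> \<Union> (free_vars ` insert \<phi> \<Gamma>)) \<psi>)) ` {\<psi>. \<phi> = Neg (Forall \<psi>)}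
   else \<Gamma>)"

lemma henkin_step:
  assumes "finite \<Gamma>" "consistent \<Gamma>"
  shows "finite (henkin_step \<phi> \<Gamma>)" "consistent (henkin_step \<phi> \<Gamma>)"
proof -
  have "finite {\<psi>. \<phi> = Neg (Forall \<psi>)}"
    by (rule finite_subset[of _ "{THE \<psi>. \<phi> = Neg (Forall \<psi>)}"]) auto
  then show "finite (henkin_step \<phi> \<Gamma>)"
    using assms(1) by (simp add: henkin_step_def)
  let ?x = "LEAST x. x \<notin> \<Union> (free_vars ` insert \<phi> \<Gamma>)"
  have "finite (\<Union> (free_vars ` insert \<phi> \<Gamma>))" using assms(1) by (auto simp: finite_free_vars)
  then have "\<exists>x. x \<notin> \<Union> (free_vars ` insert \<phi> \<Gamma>)" by (meson ex_new_if_finite infinite_UNIV_nat)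
  then have fresh: "?x \<notin> \<Union> (free_vars ` insert \<phi> \<Gamma>)" by (rule LeastI_ex)
  show "consistent (henkin_step \<phi> \<Gamma>)"
  proof (cases "consistent (insert \<phi> \<Gamma>)")
    case True
    show ?thesis
    proof (cases "\<exists>\<psi>. \<phi> = Neg (Forall \<psi>)")
      case True': True
      then obtain \<psi> where \<psi>: "\<phi> = Neg (Forall \<psi>)" by blast
      have eq: "henkin_step \<phi> \<Gamma> = insert (Neg (inst ?x \<psi>)) (insert \<phi> \<Gamma>)"
        using True \<psi> by (auto simp: henkin_step_def)
      show ?thesis unfolding eq
        by (rule henkin_witness[OF True _ fresh]) (simp add: \<psi>)
    next
      case False
      then have "henkin_step \<phi> \<Gamma> = insert \<phi> \<Gamma>" using True by (auto simp: henkin_step_def)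
      then show ?thesis using True by simp
    qed
  qed (use assms in \<open>auto simp: henkin_step_def\<close>)
qed

instance fm :: (countable) countable by countable_datatype

primrec henkin_seq :: "('p::countable) fm set \<Rightarrow> nat \<Rightarrow> 'p fm set" where
  "henkin_seq \<Gamma> 0 = \<Gamma>"
| "henkin_seq \<Gamma> (Suc n) = henkin_step (from_nat n) (henkin_seq \<Gamma> n)"

context
  fixes \<Gamma> :: "('p::countable) fm set"
  assumes fin: "finite \<Gamma>" and cons: "consistent \<Gamma>"
begin

definition henkin_set :: "'p fm set" where
  "henkin_set = (\<Union>n. henkin_seq \<Gamma> n)"

lemma henkin_seq: "finite (henkin_seq \<Gamma> n) \<and> consistent (henkin_seq \<Gamma> n)"
  by (induction n) (simp_all add: fin cons henkin_step)

lemma henkin_seq_mono: "m \<le> n \<Longrightarrow> henkin_seq \<Gamma> m \<subseteq> henkin_seq \<Gamma> n"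
  by (rule lift_Suc_mono_le[of "henkin_seq \<Gamma>"]) (auto simp: henkin_step_def)

lemma henkin_set_consistent: "consistent henkin_set"
proof
  assume "henkin_set \<turnstile> Bot"
  then obtain \<Delta> where \<Delta>: "finite \<Delta>" "\<Delta> \<subseteq> henkin_set" "\<Delta> \<turnstile> Bot"
    using proves_finite by blast
  have "\<exists>n. \<Delta> \<subseteq> henkin_seq \<Gamma> n"
    using \<Delta>(1,2)
  proof induction
    case (insert \<phi> \<Delta>)
    then obtain n m where "\<Delta> \<subseteq> henkin_seq \<Gamma> n" "\<phi> \<in> henkin_seq \<Gamma> m"
      by (auto simp: henkin_set_def)
    then have "insert \<phi> \<Delta> \<subseteq> henkin_seq \<Gamma> (max m n)"
      using henkin_seq_mono[of m "max m n"] henkin_seq_mono[of n "max m n"] by auto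
    then show ?case by blast
  qed simp
  then show False using \<Delta>(3) weakening henkin_seq by blast
qed

lemma henkin_set_closed:
  assumes "henkin_set \<turnstile> \<phi>"
  shows "\<phi> \<in> henkin_set"
proof -
  obtain n where n: "\<phi> = from_nat n" by (metis from_nat_to_nat)
  have "consistent (insert \<phi> henkin_set)"
    using assms cut henkin_set_consistent by blast
  then have "consistent (insert \<phi> (henkin_seq \<Gamma> n))"
    using weakening[of "insert \<phi> (henkin_seq \<Gamma> n)" Bot "insert \<phi> henkin_set"]
    by (auto simp: henkin_set_def)
  then have "\<phi> \<in> henkin_seq \<Gamma> (Suc n)" by (simp add: n henkin_step_def)
  then show ?thesis by (auto simp: henkin_set_def simp del: henkin_seq.simps)
qed

lemma henkin_set_iff: "\<phi> \<in> henkin_set \<longleftrightarrow> henkin_set \<turnstile> \<phi>"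
  using henkin_set_closed proves.Assm by blast

lemma henkin_set_Bot: "Bot \<notin> henkin_set"
  using henkin_set_consistent by (simp add: henkin_set_iff)

text \<open>This is maximality: a formula that is not added at its turn is inconsistent with that
  stage, which therefore proves its negation.\<close>

lemma henkin_set_Neg: "Neg \<phi> \<in> henkin_set \<longleftrightarrow> \<phi> \<notin> henkin_set"
proof
  assume "Neg \<phi> \<in> henkin_set"
  then show "\<phi> \<notin> henkin_set" using henkin_set_consistent
    by (meson henkin_set_iff proves.ImpE)
next
  assume *: "\<phi> \<notin> henkin_set"
  obtain n where n: "\<phi> = from_nat n" by (metis from_nat_to_nat)
  have "\<not> consistent (insert \<phi> (henkin_seq \<Gamma> n))"
  proof
    assume "consistent (insert \<phi> (henkin_seq \<Gamma> n))"
    then have "\<phi> \<in> henkin_seq \<Gamma> (Suc n)" by (simp add: n henkin_step_def)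
    then show False using * by (auto simp: henkin_set_def simp del: henkin_seq.simps)
  qed
  then have "henkin_seq \<Gamma> n \<turnstile> Neg \<phi>" by (auto intro: proves.ImpI)
  then have "henkin_set \<turnstile> Neg \<phi>" by (rule weakening) (auto simp: henkin_set_def)
  then show "Neg \<phi> \<in> henkin_set" by (simp add: henkin_set_iff)
qed

lemma henkin_set_Imp: "Imp \<phi> \<psi> \<in> henkin_set \<longleftrightarrow> (\<phi> \<in> henkin_set \<longrightarrow> \<psi> \<in> henkin_set)"
proof
  assume "Imp \<phi> \<psi> \<in> henkin_set"
  then show "\<phi> \<in> henkin_set \<longrightarrow> \<psi> \<in> henkin_set"
    unfolding henkin_set_iff by (intro impI) (rule proves.ImpE)
next
  assume "\<phi> \<in> henkin_set \<longrightarrow> \<psi> \<in> henkin_set"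
  then consider "Neg \<phi> \<in> henkin_set" | "\<psi> \<in> henkin_set" unfolding henkin_set_Neg by argo
  then show "Imp \<phi> \<psi> \<in> henkin_set"
  proof cases
    case 1
    then have "insert (Neg \<psi>) (insert \<phi> henkin_set) \<turnstile> Bot"
      by (intro proves.ImpE[of _ \<phi> Bot] proves.Assm) simp_all
    then show ?thesis unfolding henkin_set_iff by (rule proves.ImpI[OF proves.Contr])
  next
    case 2
    then have "insert \<phi> henkin_set \<turnstile> \<psi>" by (intro proves.Assm) simp
    then show ?thesis unfolding henkin_set_iff by (rule proves.ImpI)
  qed
qed

lemma henkin_set_witness:
  assumes "Neg (Forall \<psi>) \<in> henkin_set"
  shows "\<exists>x. Neg (inst x \<psi>) \<in> henkin_set"
proof -
  obtain n where n: "Neg (Forall \<psi>) = (from_nat n :: 'p fm)" by (metis from_nat_to_nat)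
  let ?\<Delta> = "insert (Neg (Forall \<psi>)) (henkin_seq \<Gamma> n)"
  have "?\<Delta> \<subseteq> henkin_set" using assms by (auto simp: henkin_set_def)
  then have "consistent ?\<Delta>" using henkin_set_consistent weakening by blast
  then have "Neg (inst (LEAST x. x \<notin> \<Union> (free_vars ` ?\<Delta>)) \<psi>) \<in> henkin_seq \<Gamma> (Suc n)"
    by (simp add: henkin_step_def flip: n)
  then show ?thesis by (force simp: henkin_set_def simp del: henkin_seq.simps)
qed

lemma henkin_set_Forall: "Forall \<psi> \<in> henkin_set \<longleftrightarrow> (\<forall>x. inst x \<psi> \<in> henkin_set)"
proof
  assume "Forall \<psi> \<in> henkin_set"
  then show "\<forall>x. inst x \<psi> \<in> henkin_set"
    unfolding henkin_set_iff by (auto intro: proves.ForallE)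
next
  assume "\<forall>x. inst x \<psi> \<in> henkin_set"
  then show "Forall \<psi> \<in> henkin_set"
    using henkin_set_witness[of \<psi>] henkin_set_Neg by auto
qed

lemma henkin_set_EqSubst: "Eq x y \<in> henkin_set \<Longrightarrow> inst x \<psi> \<in> henkin_set \<Longrightarrow> inst y \<psi> \<in> henkin_set"
  unfolding henkin_set_iff by (rule proves.EqSubst[of _ x y \<psi>])

definition heq :: "nat \<Rightarrow> nat \<Rightarrow> bool" where
  "heq x y \<longleftrightarrow> Eq x y \<in> henkin_set"

lemma heq_refl: "heq x x"
  by (simp add: heq_def henkin_set_iff proves.EqRefl)

text \<open>Leibniz's law for \<open>Eq 0 (Suc x)\<close>, whose instances at \<open>x\<close> and
  \<open>y\<close> are \<open>Eq x x\<close> and \<open>Eq y x\<close>.\<close>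

lemma heq_sym: "heq x y \<Longrightarrow> heq y x"
  using henkin_set_EqSubst[of x y "Eq 0 (Suc x)"] heq_refl[of x]
  by (simp add: heq_def inst_def)

lemma heq_trans: "heq x y \<Longrightarrow> heq y z \<Longrightarrow> heq x z"
  using henkin_set_EqSubst[of y z "Eq (Suc x) 0"]
  by (simp add: heq_def inst_def)

text \<open>Least representatives replace equivalence classes, so that the term model lives on a set
  of naturals.\<close>

definition hrep :: "nat \<Rightarrow> nat" where
  "hrep x = (LEAST y. heq x y)"

lemma heq_hrep: "heq x (hrep x)"
  unfolding hrep_def by (rule LeastI[of "heq x", OF heq_refl])

lemma hrep_eq: "heq x y \<Longrightarrow> hrep x = hrep y"
proof -
  assume "heq x y"
  then have "heq x z \<longleftrightarrow> heq y z" for z using heq_sym heq_trans by blast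
  then show ?thesis by (simp add: hrep_def)
qed

text \<open>The elements of the term model are variables, so an assignment is itself a
  renaming.\<close>

lemma henkin_truth:
  assumes "range e \<subseteq> range hrep"
  shows "sat (range hrep) (\<lambda>p xs. Pred p xs \<in> henkin_set) e \<phi> \<longleftrightarrow> rename e \<phi> \<in> henkin_set"
  using assms
proof (induction \<phi> arbitrary: e)
  case (Eq x y)
  obtain x' y' where "e x = hrep x'" "e y = hrep y'" using Eq by (meson rangeE range_subsetD)
  moreover have "heq (hrep x') (hrep y') \<Longrightarrow> hrep x' = hrep y'"
    by (rule hrep_eq) (meson heq_hrep heq_sym heq_trans)
  ultimately show ?case using heq_refl by (auto simp flip: heq_def)
next
  case (Forall \<phi>)
  have *: "inst d (rename (case_nat 0 (\<lambda>n. Suc (e n))) \<phi>) = rename (case_nat d e) \<phi>" for d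
  proof -
    have "case_nat d (\<lambda>n. n) \<circ> case_nat 0 (\<lambda>n. Suc (e n)) = case_nat d e"
      by (auto split: nat.split)
    then show ?thesis by (simp only: inst_def rename_comp)
  qed
  have "sat (range hrep) (\<lambda>p xs. Pred p xs \<in> henkin_set) e (Forall \<phi>) \<longleftrightarrow>
      (\<forall>d\<in>range hrep. rename (case_nat d e) \<phi> \<in> henkin_set)"
    unfolding sat.simps
    by (rule ball_cong[OF refl], rule Forall.IH)
      (use Forall.prems in \<open>auto split: nat.split simp: range_subsetD\<close>)
  \<comment> \<open>Every variable is equal to its representative according to
    \<open>henkin_set\<close>, so \<open>EqSubst\<close> extends the statement from representatives
    to all variables.\<close>
  also have "\<dots> \<longleftrightarrow> (\<forall>d. rename (case_nat d e) \<phi> \<in> henkin_set)"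
  proof safe
    fix d assume all: "\<forall>d\<in>range hrep. rename (case_nat d e) \<phi> \<in> henkin_set"
    have "Eq (hrep d) d \<in> henkin_set" using heq_sym[OF heq_hrep] by (simp add: heq_def)
    then have "inst d (rename (case_nat 0 (\<lambda>n. Suc (e n))) \<phi>) \<in> henkin_set"
      by (rule henkin_set_EqSubst) (simp add: * all)
    then show "rename (case_nat d e) \<phi> \<in> henkin_set" by (simp only: *)
  qed blast
  finally show ?case by (simp add: henkin_set_Forall *)
qed (auto simp: henkin_set_Bot henkin_set_Imp)

end

theorem model_existence:
  fixes \<Gamma> :: "('p::countable) fm set"
  assumes "finite \<Gamma>" "consistent \<Gamma>" "\<And>\<phi>. \<phi> \<in> \<Gamma> \<Longrightarrow> free_vars \<phi> = {}"
  shows "\<exists>(D :: nat set) I e. range e \<subseteq> D \<and> (\<forall>\<phi>\<in>\<Gamma>. sat D I e \<phi>)"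
proof -
  define e where "e = (\<lambda>_::nat. hrep \<Gamma> 0)"
  have e: "range e \<subseteq> range (hrep \<Gamma>)" by (auto simp: e_def)
  have "sat (range (hrep \<Gamma>)) (\<lambda>p xs. Pred p xs \<in> henkin_set \<Gamma>) e \<phi>" if "\<phi> \<in> \<Gamma>" for \<phi>
  proof -
    have "\<phi> \<in> henkin_seq \<Gamma> 0" using that by simp
    then have "\<phi> \<in> henkin_set \<Gamma>"
      by (subst henkin_set_def[OF assms(1,2)]) (rule UN_I[OF UNIV_I])
    then show ?thesis
      using that assms(3) by (simp add: henkin_truth[OF assms(1,2) e] rename_sentence)
  qed
  then show ?thesis using e by blast
qed

section \<open>Change of predicate symbols, and completeness\<close>

lemma rename_map_fm: "rename f (map_fm h \<phi>) = map_fm h (rename f \<phi>)"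
  by (induction \<phi> arbitrary: f) auto

lemma inst_map_fm: "inst x (map_fm h \<phi>) = map_fm h (inst x \<phi>)"
  by (simp add: inst_def rename_map_fm)

lemma proves_map_fm: "\<Gamma> \<turnstile> \<phi> \<Longrightarrow> map_fm h ` \<Gamma> \<turnstile> map_fm h \<phi>"
proof (induction rule: proves.induct)
  case (ForallI \<Gamma> \<phi>)
  then have "rename Suc ` map_fm h ` \<Gamma> \<turnstile> map_fm h \<phi>"
    by (simp add: image_image rename_map_fm)
  then show ?case by simp (rule proves.ForallI)
next
  case (ForallE \<Gamma> \<phi> x)
  then show ?case by (simp flip: inst_map_fm) (rule proves.ForallE)
next
  case (EqSubst \<Gamma> x y \<phi>)
  then show ?case by (simp flip: inst_map_fm) (rule proves.EqSubst)
next
  case (ImpE \<Gamma> \<phi> \<psi>)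
  then show ?case by (simp) (rule proves.ImpE)
next
  case (ImpI \<phi> \<Gamma> \<psi>)
  then show ?case by simp (rule proves.ImpI)
next
  case (Contr \<phi> \<Gamma>)
  then show ?case by (intro proves.Contr[of "map_fm h \<phi>"]) simp
qed (simp_all add: proves.Assm proves.EqRefl)

lemma free_vars_map_fm [simp]: "free_vars (map_fm h \<phi>) = free_vars \<phi>"
  by (induction \<phi>) auto

lemma sat_map_fm: "sat D I e (map_fm h \<phi>) \<longleftrightarrow> sat D (\<lambda>p. I (h p)) e \<phi>"
  by (induction \<phi> arbitrary: e) auto

lemma finite_set_fm: "finite (set_fm \<phi>)"
  by (induction \<phi>) auto

text \<open>Countable structures suffice, since by completeness this is derivability between
  sentences. Later an infinite domain can then be replaced by all of the naturals, where every code
  is an element.\<close>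

definition entails :: "'p fm \<Rightarrow> 'p fm \<Rightarrow> bool" where
  "entails \<phi> \<psi> \<longleftrightarrow> (\<forall>(D :: nat set) I e. range e \<subseteq> D \<longrightarrow> sat D I e \<phi> \<longrightarrow> sat D I e \<psi>)"

text \<open>The Henkin argument enumerates formulas, but the type of symbols need not be countable.
  Only finitely many symbols occur in the two sentences, so they are renamed injectively to
  naturals, and the refutation found there is renamed back.\<close>

theorem completeness:
  assumes "free_vars \<phi> = {}" "free_vars \<psi> = {}"
  shows "{\<phi>} \<turnstile> \<psi> \<longleftrightarrow> entails \<phi> \<psi>"
proof
  assume "{\<phi>} \<turnstile> \<psi>"
  then show "entails \<phi> \<psi>" unfolding entails_def
  proof (intro allI impI)
    fix D :: "nat set" and I :: "'a \<Rightarrow> nat list \<Rightarrow> bool" and e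
    assume "range e \<subseteq> D" "sat D I e \<phi>"
    then show "sat D I e \<psi>" using soundness[OF \<open>{\<phi>} \<turnstile> \<psi>\<close>] by blast
  qed
next
  assume ent: "entails \<phi> \<psi>"
  let ?X = "set_fm \<phi> \<union> set_fm \<psi>"
  have "finite ?X" by (simp add: finite_set_fm)
  from finite_imp_inj_to_nat_seg[OF this] obtain h :: "'a \<Rightarrow> nat" where h: "inj_on h ?X"
    by auto
  have inverse: "map_fm (inv_into ?X h) (map_fm h \<chi>) = \<chi>" if "set_fm \<chi> \<subseteq> ?X" for \<chi>
    unfolding fm.map_comp
    by (rule trans[OF fm.map_cong fm.map_id]) (use h that in \<open>auto simp: subset_iff\<close>)
  let ?\<Gamma> = "{map_fm h (Neg \<psi>), map_fm h \<phi>}"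
  have "?\<Gamma> \<turnstile> Bot"
  proof (rule ccontr)
    assume "consistent ?\<Gamma>"
    moreover have "\<And>\<chi>. \<chi> \<in> ?\<Gamma> \<Longrightarrow> free_vars \<chi> = {}" using assms by auto
    ultimately obtain D :: "nat set" and I e where "range e \<subseteq> D" "\<forall>\<phi>\<in>?\<Gamma>. sat D I e \<phi>"
      using model_existence[of ?\<Gamma>] by blast
    then have "range e \<subseteq> D" "sat D (\<lambda>p. I (h p)) e \<phi>" "\<not> sat D (\<lambda>p. I (h p)) e \<psi>"
      by (simp_all add: sat_map_fm)
    then show False using ent unfolding entails_def by blast
  qed
  then have "{Neg \<psi>, \<phi>} \<turnstile> Bot"
    using proves_map_fm[of ?\<Gamma> Bot "inv_into ?X h"] inverse[of \<phi>] inverse[of \<psi>] by simp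
  then show "{\<phi>} \<turnstile> \<psi>" by (rule proves.Contr)
qed

section \<open>Definable connectives and coding relations in a graph\<close>

definition And :: "'p fm \<Rightarrow> 'p fm \<Rightarrow> 'p fm" where
  "And \<phi> \<psi> = Neg (Imp \<phi> (Neg \<psi>))"

definition Or :: "'p fm \<Rightarrow> 'p fm \<Rightarrow> 'p fm" where
  "Or \<phi> \<psi> = Imp (Neg \<phi>) \<psi>"

definition Iff :: "'p fm \<Rightarrow> 'p fm \<Rightarrow> 'p fm" where
  "Iff \<phi> \<psi> = And (Imp \<phi> \<psi>) (Imp \<psi> \<phi>)"

definition Ex :: "'p fm \<Rightarrow> 'p fm" where
  "Ex \<phi> = Neg (Forall (Neg \<phi>))"

definition conjs :: "'p fm list \<Rightarrow> 'p fm" where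
  "conjs \<phi>s = foldr And \<phi>s (Neg Bot)"

definition disjs :: "'p fm list \<Rightarrow> 'p fm" where
  "disjs \<phi>s = foldr Or \<phi>s Bot"

definition alls :: "nat \<Rightarrow> 'p fm \<Rightarrow> 'p fm" where
  "alls n = Forall ^^ n"

definition exs :: "nat \<Rightarrow> 'p fm \<Rightarrow> 'p fm" where
  "exs n = Ex ^^ n"

primrec env :: "'d list \<Rightarrow> (nat \<Rightarrow> 'd) \<Rightarrow> nat \<Rightarrow> 'd" where
  "env [] e = e"
| "env (x # xs) e = case_nat x (env xs e)"

lemma env_nth: "env xs e i = (if i < length xs then xs ! i else e (i - length xs))"
  by (induction xs arbitrary: i) (auto split: nat.split)

lemma sat_connectives [simp]:
  "sat D I e (And \<phi> \<psi>) \<longleftrightarrow> sat D I e \<phi> \<and> sat D I e \<psi>"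
  "sat D I e (Or \<phi> \<psi>) \<longleftrightarrow> sat D I e \<phi> \<or> sat D I e \<psi>"
  "sat D I e (Iff \<phi> \<psi>) \<longleftrightarrow> (sat D I e \<phi> \<longleftrightarrow> sat D I e \<psi>)"
  "sat D I e (Ex \<phi>) \<longleftrightarrow> (\<exists>d\<in>D. sat D I (case_nat d e) \<phi>)"
  by (auto simp: And_def Or_def Iff_def Ex_def)

lemma sat_conjs [simp]: "sat D I e (conjs \<phi>s) \<longleftrightarrow> (\<forall>\<phi>\<in>set \<phi>s. sat D I e \<phi>)"
  by (induction \<phi>s) (auto simp: conjs_def)

lemma sat_disjs [simp]: "sat D I e (disjs \<phi>s) \<longleftrightarrow> (\<exists>\<phi>\<in>set \<phi>s. sat D I e \<phi>)"
  by (induction \<phi>s) (auto simp: disjs_def)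

lemma sat_alls [simp]:
  "sat D I e (alls n \<phi>) \<longleftrightarrow> (\<forall>xs. length xs = n \<longrightarrow> set xs \<subseteq> D \<longrightarrow> sat D I (env xs e) \<phi>)"
proof (induction n arbitrary: \<phi>)
  case (Suc n)
  have "sat D I e (alls (Suc n) \<phi>) \<longleftrightarrow> sat D I e (alls n (Forall \<phi>))"
    by (simp only: alls_def funpow_Suc_right o_apply)
  also have "\<dots> \<longleftrightarrow> (\<forall>xs. length xs = Suc n \<longrightarrow> set xs \<subseteq> D \<longrightarrow> sat D I (env xs e) \<phi>)"
    unfolding Suc sat.simps by (simp add: length_Suc_conv) (metis env.simps(2) insert_subset length_Cons list.set(2))
  finally show ?case .
qed (simp add: alls_def)

lemma sat_exs [simp]:
  "sat D I e (exs n \<phi>) \<longleftrightarrow> (\<exists>xs. length xs = n \<and> set xs \<subseteq> D \<and> sat D I (env xs e) \<phi>)"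
proof (induction n arbitrary: \<phi>)
  case (Suc n)
  have "sat D I e (exs (Suc n) \<phi>) \<longleftrightarrow> sat D I e (exs n (Ex \<phi>))"
    by (simp only: exs_def funpow_Suc_right o_apply)
  also have "\<dots> \<longleftrightarrow> (\<exists>xs. length xs = Suc n \<and> set xs \<subseteq> D \<and> sat D I (env xs e) \<phi>)"
    unfolding Suc sat_connectives by (simp add: length_Suc_conv) (metis env.simps(2) insert_subset length_Cons list.set(2))
  finally show ?case .
qed (simp add: exs_def)

text \<open>A bound passes through nested quantifiers by counting, which turns closedness of large
  explicit formulas into a calculation.\<close>

primrec bounded :: "nat \<Rightarrow> 'p fm \<Rightarrow> bool" where
  "bounded n (Pred p xs) \<longleftrightarrow> (\<forall>x\<in>set xs. x < n)"
| "bounded n (Eq x y) \<longleftrightarrow> x < n \<and> y < n"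
| "bounded n Bot \<longleftrightarrow> True"
| "bounded n (Imp \<phi> \<psi>) \<longleftrightarrow> bounded n \<phi> \<and> bounded n \<psi>"
| "bounded n (Forall \<phi>) \<longleftrightarrow> bounded (Suc n) \<phi>"

lemma bounded_iff: "bounded n \<phi> \<longleftrightarrow> free_vars \<phi> \<subseteq> {..<n}"
proof (induction \<phi> arbitrary: n)
  case (Forall \<phi>)
  have "free_vars \<phi> \<subseteq> {..<Suc n} \<longleftrightarrow> {k. Suc k \<in> free_vars \<phi>} \<subseteq> {..<n}"
    by (auto simp: subset_iff) (metis Suc_less_eq not0_implies_Suc zero_less_Suc)
  then show ?case using Forall by simp
qed auto

lemma bounded_0: "bounded 0 \<phi> \<longleftrightarrow> free_vars \<phi> = {}"
  by (simp add: bounded_iff)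

lemma bounded_mono: "bounded n \<phi> \<Longrightarrow> n \<le> m \<Longrightarrow> bounded m \<phi>"
  by (force simp: bounded_iff)

lemma bounded_connectives [simp]:
  "bounded n (And \<phi> \<psi>) \<longleftrightarrow> bounded n \<phi> \<and> bounded n \<psi>"
  "bounded n (Or \<phi> \<psi>) \<longleftrightarrow> bounded n \<phi> \<and> bounded n \<psi>"
  "bounded n (Iff \<phi> \<psi>) \<longleftrightarrow> bounded n \<phi> \<and> bounded n \<psi>"
  "bounded n (Ex \<phi>) \<longleftrightarrow> bounded (Suc n) \<phi>"
  by (auto simp: And_def Or_def Iff_def Ex_def)

lemma bounded_conjs [simp]: "bounded n (conjs \<phi>s) \<longleftrightarrow> (\<forall>\<phi>\<in>set \<phi>s. bounded n \<phi>)"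
  by (induction \<phi>s) (auto simp: conjs_def)

lemma bounded_disjs [simp]: "bounded n (disjs \<phi>s) \<longleftrightarrow> (\<forall>\<phi>\<in>set \<phi>s. bounded n \<phi>)"
  by (induction \<phi>s) (auto simp: disjs_def)

lemma bounded_alls [simp]: "bounded n (alls k \<phi>) \<longleftrightarrow> bounded (n + k) \<phi>"
  by (induction k arbitrary: n) (auto simp: alls_def)

lemma bounded_exs [simp]: "bounded n (exs k \<phi>) \<longleftrightarrow> bounded (n + k) \<phi>"
  by (induction k arbitrary: n) (auto simp: exs_def)

lemma fm_over_connectives [simp]:
  "fm_over S (And \<phi> \<psi>) \<longleftrightarrow> fm_over S \<phi> \<and> fm_over S \<psi>"
  "fm_over S (Or \<phi> \<psi>) \<longleftrightarrow> fm_over S \<phi> \<and> fm_over S \<psi>"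
  "fm_over S (Iff \<phi> \<psi>) \<longleftrightarrow> fm_over S \<phi> \<and> fm_over S \<psi>"
  "fm_over S (Ex \<phi>) \<longleftrightarrow> fm_over S \<phi>"
  by (auto simp: And_def Or_def Iff_def Ex_def)

lemma fm_over_conjs [simp]: "fm_over S (conjs \<phi>s) \<longleftrightarrow> (\<forall>\<phi>\<in>set \<phi>s. fm_over S \<phi>)"
  by (induction \<phi>s) (auto simp: conjs_def)

lemma fm_over_disjs [simp]: "fm_over S (disjs \<phi>s) \<longleftrightarrow> (\<forall>\<phi>\<in>set \<phi>s. fm_over S \<phi>)"
  by (induction \<phi>s) (auto simp: disjs_def)

lemma fm_over_alls [simp]: "fm_over S (alls k \<phi>) \<longleftrightarrow> fm_over S \<phi>"
  by (induction k) (auto simp: alls_def)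

lemma fm_over_exs [simp]: "fm_over S (exs k \<phi>) \<longleftrightarrow> fm_over S \<phi>"
  by (induction k) (auto simp: exs_def)

text \<open>A loop \<open>b\<close> is the name of the element pointing to it, and the name points
  to the cells that hold this element. As a loop also points to itself, \<open>b \<noteq> y\<close>
  keeps a name from being taken for its own bearer. An element may at the same time be a name or a
  cell.\<close>

definition reads_label :: "'d set \<Rightarrow> ('d \<Rightarrow> 'd \<Rightarrow> bool) \<Rightarrow> 'd \<Rightarrow> 'd \<Rightarrow> bool" where
  "reads_label D E c y \<longleftrightarrow> (\<exists>b\<in>D. b \<noteq> y \<and> E y b \<and> E b b \<and> E b c)"

text \<open>Loops are passed over in the search for the next cell because a cell, being an element,
  may also point to its own name.\<close>

primrec reads_next :: "'d set \<Rightarrow> ('d \<Rightarrow> 'd \<Rightarrow> bool) \<Rightarrow> 'd \<Rightarrow> 'd list \<Rightarrow> bool" where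
  "reads_next D E c [] \<longleftrightarrow> (\<forall>c'\<in>D. E c c' \<longrightarrow> E c' c')"
| "reads_next D E c (y # ys) \<longleftrightarrow>
     (\<exists>c'\<in>D. E c c' \<and> \<not> E c' c' \<and> reads_label D E c' y \<and> reads_next D E c' ys)"

text \<open>A first cell has only loops as predecessors, so a proper final segment of a stored list
  is not read as a list.\<close>

fun reads :: "'d set \<Rightarrow> ('d \<Rightarrow> 'd \<Rightarrow> bool) \<Rightarrow> 'd list \<Rightarrow> bool" where
  "reads D E [] \<longleftrightarrow> False"
| "reads D E (y # ys) \<longleftrightarrow> (\<exists>c\<in>D. \<not> E c c \<and> reads_label D E c y \<and>
     (\<forall>c'\<in>D. E c' c \<longrightarrow> E c' c') \<and> reads_next D E c ys)"

text \<open>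
  A set of lists of naturals as a binary relation: the even numbers \<open>2 * x + 2\<close> name the elements
  \<open>x\<close> and are told apart by being loops, the odd numbers are the cells of linked lists, and the
  name of an entry points to the cell holding it.
\<close>

definition cell :: "nat list \<Rightarrow> nat \<Rightarrow> nat" where
  "cell t i = 2 * prod_encode (list_encode t, i) + 1"

definition coding_graph :: "nat list set \<Rightarrow> nat \<Rightarrow> nat \<Rightarrow> bool" where
  "coding_graph Q x y \<longleftrightarrow> (\<exists>z. y = 2 * z + 2 \<and> (x = y \<or> x = z)) \<or>
     (\<exists>t\<in>Q. \<exists>i<length t. y = cell t i \<and> (x = 2 * (t ! i) + 2 \<or> i > 0 \<and> x = cell t (i - 1)))"

lemma cell_eq [simp]: "cell s i = cell t j \<longleftrightarrow> s = t \<and> i = j"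
  by (simp add: cell_def) (metis list_encode_inverse)

lemma cell_neq [simp]: "cell t i \<noteq> 2 * z + 2" "2 * z + 2 \<noteq> cell t i"
  "cell t i \<noteq> Suc (Suc (2 * z))" "Suc (Suc (2 * z)) \<noteq> cell t i"
  unfolding cell_def by presburger+

lemma coding_graph_cell:
  assumes "t \<in> Q" "i < length t"
  shows "coding_graph Q x (cell t i) \<longleftrightarrow> x = 2 * (t ! i) + 2 \<or> i > 0 \<and> x = cell t (i - 1)"
  using assms by (auto simp: coding_graph_def)

lemma coding_graph_name: "coding_graph Q x (2 * z + 2) \<longleftrightarrow> x = 2 * z + 2 \<or> x = z"
  by (auto simp: coding_graph_def)

lemma coding_graph_loop: "coding_graph Q y y \<longleftrightarrow> (\<exists>z. y = 2 * z + 2)"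
  by (auto simp: coding_graph_def)

text \<open>Automatic when the domain is all of the naturals; a finite domain has to contain every
  cell and name in use.\<close>

definition coding_closed :: "nat set \<Rightarrow> nat list set \<Rightarrow> bool" where
  "coding_closed D Q \<longleftrightarrow> (\<forall>t\<in>Q. \<forall>i<length t. cell t i \<in> D \<and> 2 * (t ! i) + 2 \<in> D)"

context
  fixes D :: "nat set" and Q :: "nat list set"
  assumes closed: "coding_closed D Q"
begin

lemma reads_label_coding_graph:
  assumes "t \<in> Q" "i < length t"
  shows "reads_label D (coding_graph Q) (cell t i) y \<longleftrightarrow> y = t ! i"
proof
  assume "reads_label D (coding_graph Q) (cell t i) y"
  then obtain b where b: "b \<noteq> y" "coding_graph Q y b" "coding_graph Q b b" "coding_graph Q b (cell t i)"
    by (auto simp: reads_label_def)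
  then obtain z where z: "b = 2 * z + 2" by (auto simp: coding_graph_loop)
  with b(1,2) have "y = z" by (auto simp only: coding_graph_name)
  moreover have "b = 2 * (t ! i) + 2" using b(4) z by (auto simp: coding_graph_cell assms)
  ultimately show "y = t ! i" using z by simp
next
  assume "y = t ! i"
  then show "reads_label D (coding_graph Q) (cell t i) y"
    using closed assms unfolding reads_label_def coding_closed_def
    by (intro bexI[of _ "2 * (t ! i) + 2"])
      (simp_all only: coding_graph_cell assms coding_graph_name, auto)
qed

text \<open>Apart from the edge to the next cell, a cell only points to its own name, which is a
  loop.\<close>

lemma coding_graph_from_cell:
  assumes "t \<in> Q" "i < length t" and "coding_graph Q (cell t i) y" "\<not> coding_graph Q y y"
  shows "Suc i < length t \<and> y = cell t (Suc i)"
proof -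
  from assms(3) consider z where "y = 2 * z + 2" |
     s j where "s \<in> Q" "j < length s" "y = cell s j" "cell t i = 2 * (s ! j) + 2 \<or> j > 0 \<and> cell t i = cell s (j - 1)"
    unfolding coding_graph_def by blast
  then show ?thesis
  proof cases
    case 1
    then show ?thesis using assms(4) coding_graph_loop by blast
  qed auto
qed

lemma reads_next_coding_graph:
  assumes "t \<in> Q" "i < length t"
  shows "reads_next D (coding_graph Q) (cell t i) ys \<longleftrightarrow> ys = drop (Suc i) t"
  using assms(2)
proof (induction ys arbitrary: i)
  case Nil
  have "(\<forall>c'\<in>D. coding_graph Q (cell t i) c' \<longrightarrow> coding_graph Q c' c') \<longleftrightarrow> \<not> Suc i < length t"
  proof
    assume *: "\<forall>c'\<in>D. coding_graph Q (cell t i) c' \<longrightarrow> coding_graph Q c' c'"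
    show "\<not> Suc i < length t"
    proof
      assume "Suc i < length t"
      then have "cell t (Suc i) \<in> D" "coding_graph Q (cell t i) (cell t (Suc i))"
        using closed assms by (auto simp: coding_closed_def coding_graph_cell)
      then show False using * coding_graph_loop by (metis cell_neq(1))
    qed
  next
    assume "\<not> Suc i < length t"
    then show "\<forall>c'\<in>D. coding_graph Q (cell t i) c' \<longrightarrow> coding_graph Q c' c'"
      using coding_graph_from_cell[OF assms(1) Nil] by blast
  qed
  then show ?case using Nil by auto
next
  case (Cons y ys)
  have "reads_next D (coding_graph Q) (cell t i) (y # ys) \<longleftrightarrow>
      Suc i < length t \<and> y = t ! Suc i \<and> ys = drop (Suc (Suc i)) t" (is "?L \<longleftrightarrow> ?R")
  proof
    assume ?L
    then obtain c where c: "coding_graph Q (cell t i) c" "\<not> coding_graph Q c c"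
      "reads_label D (coding_graph Q) c y" "reads_next D (coding_graph Q) c ys" by auto
    have "Suc i < length t" "c = cell t (Suc i)"
      using coding_graph_from_cell[OF assms(1) Cons.prems c(1,2)] by auto
    then show ?R using c Cons.IH[of "Suc i"] assms(1) by (simp add: reads_label_coding_graph)
  next
    assume R: ?R
    then have "cell t (Suc i) \<in> D" "coding_graph Q (cell t i) (cell t (Suc i))"
      using closed assms by (auto simp: coding_closed_def coding_graph_cell)
    moreover have "\<not> coding_graph Q (cell t (Suc i)) (cell t (Suc i))"
      by (simp add: coding_graph_loop)
    ultimately show ?L using R Cons.IH[of "Suc i"] assms(1)
      by (auto simp: reads_label_coding_graph intro!: bexI[of _ "cell t (Suc i)"])
  qed
  also have "?R \<longleftrightarrow> y # ys = drop (Suc i) t"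
    by (metis Cons_nth_drop_Suc drop_all list.distinct(1) list.inject not_le)
  finally show ?case .
qed

text \<open>A walk that qualifies starts at index 0 of some stored \<open>t\<close>, has to follow
  its cells in order and can stop only at the last one, so it spells the whole of
  \<open>t\<close>.\<close>

lemma reads_coding_graph:
  assumes "ys \<noteq> []"
  shows "reads D (coding_graph Q) ys \<longleftrightarrow> ys \<in> Q"
proof -
  obtain z zs where ys: "ys = z # zs" using assms by (cases ys) auto
  show ?thesis
  proof
    assume "reads D (coding_graph Q) ys"
    then obtain c where c: "c \<in> D" "\<not> coding_graph Q c c" "reads_label D (coding_graph Q) c z"
      "\<forall>c'\<in>D. coding_graph Q c' c \<longrightarrow> coding_graph Q c' c'" "reads_next D (coding_graph Q) c zs"
      by (auto simp: ys)
    from c(3) obtain b where b: "b \<in> D" "coding_graph Q b b" "coding_graph Q b c" by (auto simp: reads_label_def)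
    from b(3) consider w where "c = 2 * w + 2" | t i where "t \<in> Q" "i < length t" "c = cell t i"
      unfolding coding_graph_def by blast
    then show "ys \<in> Q"
    proof cases
      case 1
      then show ?thesis using c(2) coding_graph_loop by blast
    next
      case 2
      have "i = 0"
      proof (rule ccontr)
        assume "i \<noteq> 0"
        then have "coding_graph Q (cell t (i - 1)) c" "cell t (i - 1) \<in> D"
          using 2 closed by (auto simp: coding_graph_cell coding_closed_def)
        then show False using c(4) coding_graph_loop by (metis cell_neq(1))
      qed
      then have "z = t ! 0" "zs = drop 1 t"
        using 2 c(3,5) by (simp_all add: reads_label_coding_graph reads_next_coding_graph)
      then have "ys = t" using 2 \<open>i = 0\<close> ys by (cases t) auto
      then show ?thesis using 2 by simp
    qed
  next
    assume Q: "ys \<in> Q"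
    have "cell ys 0 \<in> D" using Q closed ys by (auto simp: coding_closed_def)
    moreover have "\<not> coding_graph Q (cell ys 0) (cell ys 0)" by (simp add: coding_graph_loop)
    moreover have "coding_graph Q c' c'" if "coding_graph Q c' (cell ys 0)" for c'
      using that Q ys by (auto simp: coding_graph_cell coding_graph_loop)
    moreover have "reads_next D (coding_graph Q) (cell ys 0) zs" "reads_label D (coding_graph Q) (cell ys 0) z"
      using reads_next_coding_graph[OF Q, of 0 zs] reads_label_coding_graph[OF Q, of 0 z] ys by simp_all
    ultimately show "reads D (coding_graph Q) ys" unfolding ys reads.simps by blast
  qed
qed

end

locale coding =
  fixes r :: 'p and m :: nat
  assumes m: "0 < m"
begin

text \<open>A symbol of arity \<open>Suc m\<close> serves as a binary one by giving all arguments
  after the first the same value.\<close>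

definition edge :: "nat \<Rightarrow> nat \<Rightarrow> 'p fm" where
  "edge x y = Pred r (x # replicate m y)"

definition label :: "nat \<Rightarrow> nat \<Rightarrow> 'p fm" where
  "label c y = Ex (conjs [Neg (Eq 0 (Suc y)), edge (Suc y) 0, edge 0 0, edge 0 (Suc c)])"

function next_cells :: "nat \<Rightarrow> nat list \<Rightarrow> 'p fm" where
  "next_cells c [] = Forall (Imp (edge (Suc c) 0) (edge 0 0))"
| "next_cells c (y # ys) =
     Ex (conjs [edge (Suc c) 0, Neg (edge 0 0), label 0 (Suc y), next_cells 0 (map Suc ys)])"
  by pat_completeness auto
termination by (relation "measure (length \<circ> snd)") simp_all

fun rel :: "nat list \<Rightarrow> 'p fm" where
  "rel [] = Bot"
| "rel (y # ys) = Ex (conjs [Neg (edge 0 0), label 0 (Suc y),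
     Forall (Imp (edge 0 1) (edge 0 0)), next_cells 0 (map Suc ys)])"

definition edges :: "('p \<Rightarrow> 'd list \<Rightarrow> bool) \<Rightarrow> 'd \<Rightarrow> 'd \<Rightarrow> bool" where
  "edges I x y \<longleftrightarrow> I r (x # replicate m y)"

lemma sat_edge: "sat D I e (edge x y) \<longleftrightarrow> edges I (e x) (e y)"
  by (simp add: edge_def edges_def)

lemma sat_label: "sat D I e (label c y) \<longleftrightarrow> reads_label D (edges I) (e c) (e y)"
  by (simp add: label_def reads_label_def sat_edge)

lemma sat_next_cells: "sat D I e (next_cells c ys) \<longleftrightarrow> reads_next D (edges I) (e c) (map e ys)"
  by (induction c ys arbitrary: e rule: next_cells.induct)
    (simp_all add: sat_edge sat_label comp_def)

lemma sat_rel: "sat D I e (rel ys) \<longleftrightarrow> reads D (edges I) (map e ys)"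
  by (cases ys) (simp_all add: sat_edge sat_label sat_next_cells comp_def)

lemma bounded_label: "c < n \<Longrightarrow> y < n \<Longrightarrow> bounded n (label c y)"
  by (simp add: label_def edge_def)

lemma bounded_next_cells: "c < n \<Longrightarrow> set ys \<subseteq> {..<n} \<Longrightarrow> bounded n (next_cells c ys)"
proof (induction c ys arbitrary: n rule: next_cells.induct)
  case (2 c y ys)
  then have "bounded (Suc n) (next_cells 0 (map Suc ys))" by (intro "2.IH") auto
  then show ?case using 2 by (auto simp: edge_def bounded_label)
qed (simp add: edge_def)

lemma bounded_rel: "set ys \<subseteq> {..<n} \<Longrightarrow> bounded n (rel ys)"
  by (cases ys) (auto simp: edge_def intro!: bounded_label bounded_next_cells)

lemma fm_over_rel:
  assumes "S r = Some (Suc m)"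
  shows "fm_over S (rel ys)"
proof -
  have edge: "fm_over S (edge x y)" for x y using assms by (simp add: edge_def)
  then have label: "fm_over S (label c y)" for c y by (simp add: label_def)
  have "fm_over S (next_cells c ys)" for c ys
    by (induction c ys rule: next_cells.induct) (simp_all add: edge label)
  then show ?thesis by (cases ys) (simp_all add: edge label)
qed

declare rel.simps [simp del]

end

declare reads.simps [simp del]

section \<open>Horn clauses over binary trees\<close>

datatype tree = Leaf | Node tree tree

datatype pat = PVar nat | PTree tree | PNode pat pat

type_synonym clause = "pat \<times> pat list"

primrec peval :: "(nat \<Rightarrow> tree) \<Rightarrow> pat \<Rightarrow> tree" where
  "peval \<theta> (PVar i) = \<theta> i"
| "peval \<theta> (PTree t) = t"
| "peval \<theta> (PNode p q) = Node (peval \<theta> p) (peval \<theta> q)"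

primrec pvars :: "pat \<Rightarrow> nat set" where
  "pvars (PVar i) = {i}"
| "pvars (PTree t) = {}"
| "pvars (PNode p q) = pvars p \<union> pvars q"

section \<open>Horn derivations, and structures that code them\<close>

inductive derivable :: "clause set \<Rightarrow> tree \<Rightarrow> bool" for P where
  "(h, bs) \<in> P \<Longrightarrow> (\<And>b. b \<in> set bs \<Longrightarrow> derivable P (peval \<theta> b)) \<Longrightarrow> derivable P (peval \<theta> h)"

record 'd trees =
  nil :: "'d \<Rightarrow> bool"
  con :: "'d \<Rightarrow> 'd \<Rightarrow> 'd \<Rightarrow> bool"
  lt :: "'d \<Rightarrow> 'd \<Rightarrow> bool"
  holds :: "'d \<Rightarrow> bool"

primrec denotes :: "'d set \<Rightarrow> 'd trees \<Rightarrow> tree \<Rightarrow> 'd \<Rightarrow> bool" where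
  "denotes D T Leaf u \<longleftrightarrow> nil T u"
| "denotes D T (Node s t) u \<longleftrightarrow> (\<exists>y\<in>D. denotes D T s y \<and> (\<exists>z\<in>D. denotes D T t z \<and> con T u y z))"

primrec matches :: "'d set \<Rightarrow> 'd trees \<Rightarrow> (nat \<Rightarrow> 'd) \<Rightarrow> pat \<Rightarrow> 'd \<Rightarrow> bool" where
  "matches D T \<theta> (PVar i) u \<longleftrightarrow> u = \<theta> i"
| "matches D T \<theta> (PTree t) u \<longleftrightarrow> denotes D T t u"
| "matches D T \<theta> (PNode p q) u \<longleftrightarrow>
     (\<exists>y\<in>D. \<exists>z\<in>D. con T u y z \<and> matches D T \<theta> p y \<and> matches D T \<theta> q z)"

definition node :: "'d set \<Rightarrow> 'd trees \<Rightarrow> 'd \<Rightarrow> bool" where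
  "node D T x \<longleftrightarrow> nil T x \<or> (\<exists>y\<in>D. \<exists>z\<in>D. con T x y z)"

text \<open>All conditions look downward: nodes have smaller children and facts have smaller
  premises, but no tree has to exist and no clause has to be applied. This permits finite models.
  Several nodes may carry the same tree, which leaves the order free to follow a derivation.\<close>

definition horn_model :: "clause set \<Rightarrow> nat \<Rightarrow> 'd set \<Rightarrow> 'd trees \<Rightarrow> bool" where
  "horn_model P k D T \<longleftrightarrow>
     (\<forall>x\<in>D. \<not> lt T x x) \<and>
     (\<forall>x\<in>D. \<forall>y\<in>D. \<forall>z\<in>D. lt T x y \<longrightarrow> lt T y z \<longrightarrow> lt T x z) \<and>
     (\<forall>x\<in>D. \<forall>y\<in>D. node D T x \<longrightarrow> node D T y \<longrightarrow> x = y \<or> lt T x y \<or> lt T y x) \<and>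
     (\<forall>x\<in>D. \<forall>y\<in>D. lt T x y \<longrightarrow> node D T x \<and> node D T y) \<and>
     (\<forall>x\<in>D. \<forall>y\<in>D. \<forall>z\<in>D. con T x y z \<longrightarrow>
        \<not> nil T x \<and> node D T y \<and> node D T z \<and> lt T y x \<and> lt T z x) \<and>
     (\<forall>x\<in>D. \<forall>y\<in>D. \<forall>z\<in>D. \<forall>y'\<in>D. \<forall>z'\<in>D. con T x y z \<longrightarrow> con T x y' z' \<longrightarrow> y = y' \<and> z = z') \<and>
     (\<forall>x\<in>D. holds T x \<longrightarrow> (\<exists>(h, bs)\<in>P. \<exists>\<theta>. (\<forall>i<k. \<theta> i \<in> D) \<and> matches D T \<theta> h x \<and>
        (\<forall>b\<in>set bs. \<exists>w\<in>D. lt T w x \<and> holds T w \<and> matches D T \<theta> b w)))"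

lemma matches_cong:
  "(\<And>i. i \<in> pvars p \<Longrightarrow> \<theta> i = \<theta>' i) \<Longrightarrow> matches D T \<theta> p u \<longleftrightarrow> matches D T \<theta>' p u"
proof (induction p arbitrary: u)
  case (PNode p q)
  then have "matches D T \<theta> p = matches D T \<theta>' p" "matches D T \<theta> q = matches D T \<theta>' q"
    by (auto intro!: ext)
  then show ?case by simp
qed auto

text \<open>A strict order on finitely many nodes is well-founded, so by induction every node
  unfolds to a genuine tree and every fact to a genuine derivation. With infinitely many nodes this
  induction is no longer available, and models of that kind are the ones to be exploited.\<close>

lemma horn_model_sound:
  fixes D :: "'d set"
  assumes model: "horn_model P k D T" and fin: "finite {x\<in>D. node D T x}"
  shows "\<exists>val. (\<forall>x\<in>D. \<forall>t. denotes D T t x \<longrightarrow> val x = t) \<and>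
    (\<forall>\<theta> p. \<forall>x\<in>D. matches D T \<theta> p x \<longrightarrow> val x = peval (val \<circ> \<theta>) p) \<and>
    (\<forall>x\<in>D. holds T x \<longrightarrow> derivable P (val x))"
proof -
  note model' = model[unfolded horn_model_def]
  have irrefl: "\<And>x. x \<in> D \<Longrightarrow> \<not> lt T x x"
    and lt_trans: "\<And>x y z. x \<in> D \<Longrightarrow> y \<in> D \<Longrightarrow> z \<in> D \<Longrightarrow> lt T x y \<Longrightarrow> lt T y z \<Longrightarrow> lt T x z"
    and lt_node: "\<And>x y. x \<in> D \<Longrightarrow> y \<in> D \<Longrightarrow> lt T x y \<Longrightarrow> node D T x \<and> node D T y"
    using model' by blast+
  note con = conjunct1[OF conjunct2[OF conjunct2[OF conjunct2[OF conjunct2[OF model']]]], rule_format]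
  note con_unique = conjunct1[OF conjunct2[OF conjunct2[OF conjunct2[OF conjunct2[OF conjunct2[OF model']]]]], rule_format]
  note clause = conjunct2[OF conjunct2[OF conjunct2[OF conjunct2[OF conjunct2[OF conjunct2[OF model']]]]], rule_format]
  define R where "R = {(y, x). x \<in> D \<and> y \<in> D \<and> lt T y x}"
  have "R \<subseteq> {x\<in>D. node D T x} \<times> {x\<in>D. node D T x}" using lt_node by (auto simp: R_def)
  then have "finite R" using fin by (meson finite_SigmaI finite_subset)
  moreover have "trans R" unfolding R_def by (rule transI) (use lt_trans in blast)
  then have "acyclic R" using irrefl by (auto simp: acyclic_def R_def)
  ultimately have wf: "wf R" by (rule finite_acyclic_wf)
  have unique: "denotes D T t x \<Longrightarrow> denotes D T t' x \<Longrightarrow> x \<in> D \<Longrightarrow> t = t'" for t t' x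
  proof (induction t arbitrary: t' x)
    case Leaf
    then show ?case using con by (cases t') auto
  next
    case (Node t1 t2)
    show ?case
    proof (cases t')
      case Leaf
      then show ?thesis using Node.prems con by auto
    next
      case (Node s1 s2)
      then obtain y z y' z' where "y \<in> D" "z \<in> D" "y' \<in> D" "z' \<in> D" "con T x y z" "con T x y' z'"
        "denotes D T t1 y" "denotes D T t2 z" "denotes D T s1 y'" "denotes D T s2 z'"
        using Node.prems by auto
      then show ?thesis using Node.IH con_unique \<open>x \<in> D\<close> Node by metis
    qed
  qed
  have exist: "x \<in> D \<Longrightarrow> node D T x \<Longrightarrow> \<exists>t. denotes D T t x" for x
  proof (induction x rule: wf_induct_rule[OF wf])
    case (1 x)
    consider "nil T x" | y z where "y \<in> D" "z \<in> D" "con T x y z"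
      using 1 by (auto simp: node_def)
    then show ?case
    proof cases
      case 1
      then show ?thesis by (metis denotes.simps(1))
    next
      case 2
      then have c: "node D T y" "node D T z" "lt T y x" "lt T z x" using con 1(2) by blast+
      obtain s where "denotes D T s y" using 1(1)[of y] 1(2) 2 c by (auto simp: R_def)
      moreover obtain t where "denotes D T t z" using 1(1)[of z] 1(2) 2 c by (auto simp: R_def)
      ultimately have "denotes D T (Node s t) x" using 2 by auto
      then show ?thesis ..
    qed
  qed
  \<comment> \<open>The default \<open>Leaf\<close> is for elements that denote no tree; a clause
    variable may be assigned such an element as well.\<close>
  define val where "val x = (if \<exists>t. denotes D T t x then SOME t. denotes D T t x else Leaf)" for x
  have val: "val x = t" if "x \<in> D" "denotes D T t x" for x t
  proof -
    have "denotes D T (SOME t. denotes D T t x) x" using that(2) by (rule someI)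
    then show ?thesis using that unique by (auto simp: val_def)
  qed
  have val_matches: "matches D T \<theta> p x \<Longrightarrow> x \<in> D \<Longrightarrow> val x = peval (val \<circ> \<theta>) p" for \<theta> p x
  proof (induction p arbitrary: x)
    case (PNode p q)
    then obtain y z where yz: "y \<in> D" "z \<in> D" "con T x y z" "matches D T \<theta> p y" "matches D T \<theta> q z"
      by auto
    obtain s t where "denotes D T s y" "denotes D T t z"
      using exist con[OF PNode.prems(2) yz(1-3)] yz by blast
    then have "denotes D T (Node s t) x" unfolding denotes.simps using yz by blast
    then have "val x = Node s t" "val y = s" "val z = t"
      using yz PNode.prems(2) \<open>denotes D T s y\<close> \<open>denotes D T t z\<close> val by blast+
    then show ?case using PNode.IH yz by auto
  qed (auto intro: val)
  have "holds T x \<longrightarrow> derivable P (val x)" if "x \<in> D" for x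
    using that
  proof (induction x rule: wf_induct_rule[OF wf])
    case (1 x)
    show ?case
    proof
      assume "holds T x"
      then obtain h bs \<theta> where hb: "(h, bs) \<in> P" "matches D T \<theta> h x"
        "\<And>b. b \<in> set bs \<Longrightarrow> \<exists>w\<in>D. lt T w x \<and> holds T w \<and> matches D T \<theta> b w"
        using clause[of x] 1 by auto
      have "derivable P (peval (val \<circ> \<theta>) h)"
      proof (rule derivable.intros[OF hb(1)])
        fix b assume "b \<in> set bs"
        then obtain w where w: "w \<in> D" "lt T w x" "holds T w" "matches D T \<theta> b w" using hb(3) by blast
        then have "derivable P (val w)" using 1 by (auto simp: R_def)
        then show "derivable P (peval (val \<circ> \<theta>) b)" using val_matches w by simp
      qed
      then show "derivable P (val x)" using val_matches hb(2) 1(2) by simp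
    qed
  qed
  then show ?thesis using val val_matches by blast
qed

text \<open>A bijective numbering under which subtrees get smaller numbers, so that the order of the
  naturals is compatible with \<open>con\<close>.\<close>

primrec tnat :: "tree \<Rightarrow> nat" where
  "tnat Leaf = 0"
| "tnat (Node s t) = Suc (prod_encode (tnat s, tnat t))"

lemma bij_tnat: "bij tnat"
proof (rule bijI)
  show "inj tnat"
  proof (rule injI)
    fix s t show "tnat s = tnat t \<Longrightarrow> s = t"
      by (induction s arbitrary: t) (case_tac t; auto simp: prod_encode_eq)+
  qed
  show "surj tnat"
  proof -
    have "\<exists>t. tnat t = n" for n
    proof (induction n rule: less_induct)
      case (less n)
      show ?case
      proof (cases n)
        case 0
        then show ?thesis by (metis tnat.simps(1))
      next
        case (Suc k)
        obtain a b where ab: "prod_decode k = (a, b)" by force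
        then have k: "prod_encode (a, b) = k" by (metis prod_decode_inverse)
        then have "a < n" "b < n" using le_prod_encode_1[of a b] le_prod_encode_2[of b a] Suc by auto
        then obtain s t where "tnat s = a" "tnat t = b" using less by blast
        then have "tnat (Node s t) = n" using k Suc by simp
        then show ?thesis ..
      qed
    qed
    then show ?thesis by (metis surjI)
  qed
qed

definition ntree :: "nat \<Rightarrow> tree" where
  "ntree = inv tnat"

lemma ntree_tnat [simp]: "ntree (tnat t) = t"
  unfolding ntree_def by (rule inv_f_f) (rule bij_is_inj[OF bij_tnat])

lemma tnat_ntree [simp]: "tnat (ntree n) = n"
  unfolding ntree_def by (rule surj_f_inv_f) (rule bij_is_surj[OF bij_tnat])

lemma tnat_Node_less: "tnat s < tnat (Node s t)" "tnat t < tnat (Node s t)"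
  using le_prod_encode_1[of "tnat s" "tnat t"] le_prod_encode_2[of "tnat t" "tnat s"] by simp_all

text \<open>Derivations are linearised because the nodes of a \<open>horn_model\<close> are linearly
  ordered, premises coming first.\<close>

inductive justified :: "clause set \<Rightarrow> tree list \<Rightarrow> bool" for P where
  Nil: "justified P []"
| snoc: "justified P fs \<Longrightarrow> (h, bs) \<in> P \<Longrightarrow> (\<And>b. b \<in> set bs \<Longrightarrow> peval \<theta> b \<in> set fs) \<Longrightarrow>
    justified P (fs @ [peval \<theta> h])"

lemma justified_append: "justified P gs \<Longrightarrow> justified P fs \<Longrightarrow> justified P (fs @ gs)"
proof (induction rule: justified.induct)
  case (snoc gs h bs \<theta>)
  have "justified P ((fs @ gs) @ [peval \<theta> h])"
    by (rule justified.snoc[OF snoc.IH[OF snoc.prems] snoc.hyps(2)]) (use snoc.hyps(3) in simp)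
  then show ?case by simp
qed simp

lemma justified_nth:
  "justified P fs \<Longrightarrow> i < length fs \<Longrightarrow> \<exists>(h, bs)\<in>P. \<exists>\<theta>. fs ! i = peval \<theta> h \<and>
     (\<forall>b\<in>set bs. \<exists>j<i. fs ! j = peval \<theta> b)"
proof (induction rule: justified.induct)
  case (snoc fs h bs \<theta>)
  have old: "(fs @ [peval \<theta> h]) ! j = fs ! j" if "j < length fs" for j
    using that by (simp add: nth_append)
  show ?case
  proof (cases "i < length fs")
    case True
    then obtain h' bs' \<theta>' where h': "(h', bs') \<in> P" "fs ! i = peval \<theta>' h'"
      "\<forall>b\<in>set bs'. \<exists>j<i. fs ! j = peval \<theta>' b" using snoc.IH by blast
    moreover have "\<forall>b\<in>set bs'. \<exists>j<i. (fs @ [peval \<theta> h]) ! j = peval \<theta>' b"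
      using h'(3) old True by (metis less_trans)
    ultimately show ?thesis using old[OF True] by (intro bexI[of _ "(h', bs')"]) auto
  next
    case False
    then have i: "i = length fs" using snoc.prems by simp
    have "\<forall>b\<in>set bs. \<exists>j<i. (fs @ [peval \<theta> h]) ! j = peval \<theta> b"
      using snoc.hyps(3) old unfolding i by (metis in_set_conv_nth)
    then show ?thesis using snoc.hyps(2) i by (intro bexI[of _ "(h, bs)"]) (auto intro!: exI[of _ \<theta>])
  qed
qed simp

lemma derivable_justified: "derivable P t \<Longrightarrow> \<exists>fs. justified P fs \<and> t \<in> set fs"
proof (induction rule: derivable.induct)
  case (1 h bs \<theta>)
  have "\<exists>fs. justified P fs \<and> (\<forall>b\<in>set bs'. peval \<theta> b \<in> set fs)" if "set bs' \<subseteq> set bs" for bs'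
    using that
  proof (induction bs')
    case Nil
    then show ?case using justified.Nil by auto
  next
    case (Cons b bs')
    then obtain fs gs where "justified P fs" "\<forall>b\<in>set bs'. peval \<theta> b \<in> set fs"
      "justified P gs" "peval \<theta> b \<in> set gs" using 1(3)[of b] by auto
    then show ?case by (intro exI[of _ "fs @ gs"]) (auto intro: justified_append)
  qed
  then obtain fs where "justified P fs" "\<And>b. b \<in> set bs \<Longrightarrow> peval \<theta> b \<in> set fs" by blast
  then have "justified P (fs @ [peval \<theta> h])" using 1(1) by (intro justified.snoc)
  then show ?case by force
qed

text \<open>The numbers below \<open>b\<close> stand for the trees they encode; above them come the facts \<open>fs\<close>.\<close>

definition fact_val :: "nat \<Rightarrow> tree list \<Rightarrow> nat \<Rightarrow> tree" where
  "fact_val b fs x = (if x < b then ntree x else fs ! (x - b))"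

definition fact_trees :: "nat \<Rightarrow> tree list \<Rightarrow> nat trees" where
  "fact_trees b fs =
    \<lparr>nil = (\<lambda>x. x < b + length fs \<and> fact_val b fs x = Leaf),
     con = (\<lambda>x y z. x < b + length fs \<and> y < b \<and> z < b \<and> fact_val b fs x = Node (ntree y) (ntree z)),
     lt = (\<lambda>x y. x < y \<and> y < b + length fs),
     holds = (\<lambda>x. b \<le> x \<and> x < b + length fs)\<rparr>"

context
  fixes b :: nat and fs :: "tree list" and D :: "nat set"
  assumes D: "{..<b + length fs} \<subseteq> D" and fs: "\<forall>f\<in>set fs. tnat f < b"
begin

lemma tnat_fact_val: "x < b + length fs \<Longrightarrow> tnat (fact_val b fs x) < b"
  by (auto simp: fact_val_def fs)

lemma con_fact_trees:
  assumes "x < b + length fs" "fact_val b fs x = Node s t"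
  shows "tnat s < b" "tnat t < b" "con (fact_trees b fs) x (tnat s) (tnat t)"
proof -
  have "tnat (Node s t) < b" using tnat_fact_val[OF assms(1)] by (simp add: assms(2))
  then show "tnat s < b" "tnat t < b" 
    using less_trans[OF tnat_Node_less(1)[of s t]] less_trans[OF tnat_Node_less(2)[of t s]] by blast+
  then show "con (fact_trees b fs) x (tnat s) (tnat t)" using assms by (simp add: fact_trees_def)
qed

lemma node_fact_trees: "node D (fact_trees b fs) x \<longleftrightarrow> x < b + length fs"
proof
  assume x: "x < b + length fs"
  show "node D (fact_trees b fs) x"
  proof (cases "fact_val b fs x")
    case Leaf
    then show ?thesis using x by (simp add: node_def fact_trees_def)
  next
    case (Node s t)
    have "tnat s \<in> D" "tnat t \<in> D" using con_fact_trees[OF x Node] D by auto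
    then show ?thesis using con_fact_trees[OF x Node] unfolding node_def by blast
  qed
qed (auto simp: node_def fact_trees_def)

lemma denotes_fact_trees: "x < b + length fs \<Longrightarrow> denotes D (fact_trees b fs) (fact_val b fs x) x"
proof (induction "fact_val b fs x" arbitrary: x)
  case Leaf
  then show ?case by (subst Leaf(1)[symmetric]) (simp add: fact_trees_def)
next
  case (Node s t)
  note ab = con_fact_trees[OF Node.prems Node.hyps(3)[symmetric]]
  have "denotes D (fact_trees b fs) s (tnat s)" "denotes D (fact_trees b fs) t (tnat t)"
    using Node.hyps(1)[of "tnat s"] Node.hyps(2)[of "tnat t"] ab by (simp_all add: fact_val_def)
  moreover have "tnat s \<in> D" "tnat t \<in> D" using ab D by auto
  ultimately show ?case unfolding Node.hyps(3)[symmetric] using ab by auto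
qed

text \<open>A bare variable is excluded: it matches only the element assigned to it, here the code
  of its value, and not a copy above \<open>b\<close>. Inside a \<open>PNode\<close> all children
  are codes below \<open>b\<close>, so variables are harmless there.\<close>

lemma matches_fact_trees:
  assumes "x < b + length fs" "fact_val b fs x = peval \<theta> p" "\<And>i. p \<noteq> PVar i"
  shows "matches D (fact_trees b fs) (tnat \<circ> \<theta>) p x"
  using assms
proof (induction p arbitrary: x)
  case (PTree t)
  then show ?case using denotes_fact_trees[of x] by simp
next
  case (PNode p q)
  have "fact_val b fs x = Node (peval \<theta> p) (peval \<theta> q)" using PNode.prems(2) by simp
  note ab = con_fact_trees[OF PNode.prems(1) this]
  have sub: "matches D (fact_trees b fs) (tnat \<circ> \<theta>) p' (tnat (peval \<theta> p'))"
    if IH: "\<And>x. x < b + length fs \<Longrightarrow> fact_val b fs x = peval \<theta> p' \<Longrightarrow> (\<And>i. p' \<noteq> PVar i) \<Longrightarrow>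
        matches D (fact_trees b fs) (tnat \<circ> \<theta>) p' x"
      and "tnat (peval \<theta> p') < b" for p'
  proof (cases "\<exists>i. p' = PVar i")
    case False
    show ?thesis by (rule IH) (use that(2) False in \<open>auto simp: fact_val_def\<close>)
  qed auto
  have "tnat (peval \<theta> p) \<in> D" "tnat (peval \<theta> q) \<in> D" using ab D by auto
  moreover note sub[OF PNode.IH(1) ab(1)] sub[OF PNode.IH(2) ab(2)]
  ultimately show ?case unfolding matches.simps using ab(3) by blast
qed auto

end

text \<open>Numerical order need not respect the order of derivation. Therefore the codes below
  \<open>b\<close> only provide the subtrees, and the facts are repeated above \<open>b\<close> in
  the order in which they are derived.\<close>

lemma horn_model_complete:
  assumes "derivable P t" and P: "\<And>h bs p. (h, bs) \<in> P \<Longrightarrow> p \<in> insert h (set bs) \<Longrightarrow> \<exists>p1 p2. p = PNode p1 p2"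
  shows "\<exists>b fs. a < b \<and> t \<in> set fs \<and> (\<forall>f\<in>set fs. tnat f < b) \<and>
    (\<forall>D. {..<b + length fs} \<subseteq> D \<longrightarrow> horn_model P k D (fact_trees b fs))"
proof -
  obtain fs where fs: "justified P fs" "t \<in> set fs" using derivable_justified[OF assms(1)] by blast
  define J where "J i z \<longleftrightarrow> (case z of (h, bs, \<theta>) \<Rightarrow> (h, bs) \<in> P \<and> fs ! i = peval \<theta> h \<and>
     (\<forall>c\<in>set bs. \<exists>j<i. fs ! j = peval \<theta> c))" for i z
  have "\<forall>i\<in>{..<length fs}. \<exists>z. J i z"
  proof
    fix i assume "i \<in> {..<length fs}"
    then have "i < length fs" by simp
    from justified_nth[OF fs(1) this] show "\<exists>z. J i z" unfolding J_def by fast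
  qed
  then obtain z where z: "\<forall>i\<in>{..<length fs}. J i (z i)" by (rule bchoice[THEN exE])
  define hs bss \<theta>s where "hs i = fst (z i)" and "bss i = fst (snd (z i))" and "\<theta>s i = snd (snd (z i))" for i
  have just: "(hs i, bss i) \<in> P \<and> fs ! i = peval (\<theta>s i) (hs i) \<and>
     (\<forall>c\<in>set (bss i). \<exists>j<i. fs ! j = peval (\<theta>s i) c)" if "i < length fs" for i
    using z that by (simp add: J_def hs_def bss_def \<theta>s_def split_beta)
  \<comment> \<open>\<open>b\<close> has to exceed \<open>a\<close>, the codes of all facts, and the
    codes of the values that the first \<open>k\<close> variables take in the clause instances, as
    these values must be elements of the domain.\<close>
  define X where "X = insert a (tnat ` set fs \<union> (\<Union>i<length fs. \<Union>v<k. {tnat (\<theta>s i v)}))"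
  have "finite X" by (auto simp: X_def)
  then obtain b where b: "\<And>x. x \<in> X \<Longrightarrow> x < b"
    by (metis finite_nat_set_iff_bounded)
  have fsb: "\<forall>f\<in>set fs. tnat f < b" using b by (auto simp: X_def)
  have "horn_model P k D (fact_trees b fs)" if D: "{..<b + length fs} \<subseteq> D" for D
    unfolding horn_model_def
  proof (intro conjI)
    show "\<forall>x\<in>D. \<forall>y\<in>D. \<forall>z\<in>D. con (fact_trees b fs) x y z \<longrightarrow> \<not> nil (fact_trees b fs) x \<and>
        node D (fact_trees b fs) y \<and> node D (fact_trees b fs) z \<and>
        lt (fact_trees b fs) y x \<and> lt (fact_trees b fs) z x"
    proof (intro ballI impI)
      fix x y z assume "con (fact_trees b fs) x y z"
      then have c: "x < b + length fs" "y < b" "z < b" "fact_val b fs x = Node (ntree y) (ntree z)"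
        by (auto simp: fact_trees_def)
      have "y < x \<and> z < x"
      proof (cases "x < b")
        case True
        then have "x = tnat (Node (ntree y) (ntree z))" using c(4) by (simp add: fact_val_def) (metis tnat_ntree tnat.simps(2))
        then show ?thesis using tnat_Node_less[of "ntree y" "ntree z"] tnat_Node_less(2)[of "ntree z" "ntree y"] by simp
      qed (use c in auto)
      then show "\<not> nil (fact_trees b fs) x \<and> node D (fact_trees b fs) y \<and> node D (fact_trees b fs) z \<and>
        lt (fact_trees b fs) y x \<and> lt (fact_trees b fs) z x"
        using c unfolding node_fact_trees[OF D fsb] by (simp add: fact_trees_def)
    qed
    show "\<forall>x\<in>D. \<forall>y\<in>D. \<forall>z\<in>D. \<forall>y'\<in>D. \<forall>z'\<in>D. con (fact_trees b fs) x y z \<longrightarrow>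
       con (fact_trees b fs) x y' z' \<longrightarrow> y = y' \<and> z = z'"
    proof (intro ballI impI)
      fix x y z y' z' assume "con (fact_trees b fs) x y z" "con (fact_trees b fs) x y' z'"
      then have "ntree y = ntree y'" "ntree z = ntree z'" by (simp_all add: fact_trees_def)
      then show "y = y' \<and> z = z'" by (metis tnat_ntree)
    qed
    show "\<forall>x\<in>D. holds (fact_trees b fs) x \<longrightarrow> (\<exists>(h, bs)\<in>P. \<exists>\<theta>. (\<forall>i<k. \<theta> i \<in> D) \<and>
        matches D (fact_trees b fs) \<theta> h x \<and> (\<forall>c\<in>set bs. \<exists>w\<in>D. lt (fact_trees b fs) w x \<and>
        holds (fact_trees b fs) w \<and> matches D (fact_trees b fs) \<theta> c w))"
    proof (intro ballI impI)
      fix x assume "holds (fact_trees b fs) x"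
      define i where "i = x - b"
      with \<open>holds (fact_trees b fs) x\<close> have i: "x = b + i" "i < length fs"
        by (auto simp: fact_trees_def)
      note ji = just[OF i(2)]
      have "\<theta>s i v \<in> ntree ` D" if "v < k" for v
      proof -
        have "tnat (\<theta>s i v) \<in> X" using i(2) that by (auto simp: X_def)
        then have "tnat (\<theta>s i v) < b" by (rule b)
        then have "tnat (\<theta>s i v) \<in> D" using D by auto
        then show ?thesis by (metis image_eqI ntree_tnat)
      qed
      then have "\<forall>v<k. (tnat \<circ> \<theta>s i) v \<in> D" by force
      moreover have "matches D (fact_trees b fs) (tnat \<circ> \<theta>s i) (hs i) x"
      proof (rule matches_fact_trees[OF D fsb])
        show "hs i \<noteq> PVar v" for v using P[of "hs i" "bss i" "hs i"] ji by auto
      qed (use i ji in \<open>simp_all add: fact_val_def\<close>)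
      moreover have "\<exists>w\<in>D. lt (fact_trees b fs) w x \<and> holds (fact_trees b fs) w \<and>
          matches D (fact_trees b fs) (tnat \<circ> \<theta>s i) c w" if c: "c \<in> set (bss i)" for c
      proof -
        obtain j where j: "j < i" "fs ! j = peval (\<theta>s i) c" using ji c by blast
        have "matches D (fact_trees b fs) (tnat \<circ> \<theta>s i) c (b + j)"
        proof (rule matches_fact_trees[OF D fsb])
          show "c \<noteq> PVar v" for v using P[of "hs i" "bss i" c] ji c by auto
        qed (use i j in \<open>simp_all add: fact_val_def\<close>)
        then show ?thesis using i j D by (intro bexI[of _ "b + j"]) (auto simp: fact_trees_def)
      qed
      ultimately show "\<exists>(h, bs)\<in>P. \<exists>\<theta>. (\<forall>i<k. \<theta> i \<in> D) \<and>
        matches D (fact_trees b fs) \<theta> h x \<and> (\<forall>c\<in>set bs. \<exists>w\<in>D. lt (fact_trees b fs) w x \<and>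
        holds (fact_trees b fs) w \<and> matches D (fact_trees b fs) \<theta> c w)"
        using ji by (intro bexI[of _ "(hs i, bss i)"] case_prodI exI[of _ "tnat \<circ> \<theta>s i"] conjI) simp_all
    qed
  next
    show "\<forall>x\<in>D. \<forall>y\<in>D. node D (fact_trees b fs) x \<longrightarrow> node D (fact_trees b fs) y \<longrightarrow>
        x = y \<or> lt (fact_trees b fs) x y \<or> lt (fact_trees b fs) y x"
      unfolding node_fact_trees[OF D fsb] by (auto simp: fact_trees_def)
    show "\<forall>x\<in>D. \<forall>y\<in>D. lt (fact_trees b fs) x y \<longrightarrow> node D (fact_trees b fs) x \<and> node D (fact_trees b fs) y"
      unfolding node_fact_trees[OF D fsb] by (auto simp: fact_trees_def)
  qed (simp_all add: fact_trees_def)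
  moreover have "a < b" by (rule b) (simp add: X_def)
  ultimately show ?thesis using fs(2) fsb by (intro exI[of _ b] exI[of _ fs] conjI allI impI)
qed

section \<open>Provability as a Horn program\<close>

primrec num :: "nat \<Rightarrow> tree" where
  "num 0 = Leaf"
| "num (Suc n) = Node Leaf (num n)"

text \<open>Decoding is total: every tree counts as some numeral, list or formula. Program variables
  range over all trees, so the clauses are sound without side conditions on well-formed
  codes.\<close>

primrec denum :: "tree \<Rightarrow> nat" where
  "denum Leaf = 0"
| "denum (Node s t) = Suc (denum t)"

primrec tlist :: "tree list \<Rightarrow> tree" where
  "tlist [] = Leaf"
| "tlist (t # ts) = Node t (tlist ts)"

primrec dlist :: "tree \<Rightarrow> tree list" where
  "dlist Leaf = []"
| "dlist (Node s t) = s # dlist t"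

lemma denum_num [simp]: "denum (num n) = n"
  by (induction n) auto

lemma dlist_tlist [simp]: "dlist (tlist ts) = ts"
  by (induction ts) auto

section \<open>Codes of formulas and facts, and patterns for them\<close>

definition tPred :: "tree \<Rightarrow> tree \<Rightarrow> tree" where "tPred p xs = Node (num 0) (Node p xs)"
definition tEq :: "tree \<Rightarrow> tree \<Rightarrow> tree" where "tEq x y = Node (num 1) (Node x y)"
definition tBot :: tree where "tBot = Node (num 2) Leaf"
definition tImp :: "tree \<Rightarrow> tree \<Rightarrow> tree" where "tImp a b = Node (num 3) (Node a b)"
definition tForall :: "tree \<Rightarrow> tree" where "tForall a = Node (num 4) a"
definition fact :: "nat \<Rightarrow> tree list \<Rightarrow> tree" where "fact k ts = Node (num k) (tlist ts)"

lemma fact_eq [simp]: "fact k ts = fact l us \<longleftrightarrow> k = l \<and> ts = us"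
  unfolding fact_def by (metis denum_num dlist_tlist tree.inject)

primrec enc :: "('p \<Rightarrow> nat) \<Rightarrow> 'p fm \<Rightarrow> tree" where
  "enc idx (Pred p xs) = tPred (num (idx p)) (tlist (map num xs))"
| "enc idx (Eq x y) = tEq (num x) (num y)"
| "enc idx Bot = tBot"
| "enc idx (Imp \<phi> \<psi>) = tImp (enc idx \<phi>) (enc idx \<psi>)"
| "enc idx (Forall \<phi>) = tForall (enc idx \<phi>)"

text \<open>Tag 4 is tested before the second component is split, since the body of a quantifier may
  be any tree whereas the remaining proper tags expect a pair. Malformed trees decode to
  \<open>Bot\<close>.\<close>

fun dec :: "(nat \<Rightarrow> 'p) \<Rightarrow> tree \<Rightarrow> 'p fm" where
  "dec symb Leaf = Bot"
| "dec symb (Node t u) = (if denum t = 4 then Forall (dec symb u) else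
     (case u of Leaf \<Rightarrow> Bot | Node a b \<Rightarrow>
       if denum t = 0 then Pred (symb (denum a)) (map denum (dlist b))
       else if denum t = 1 then Eq (denum a) (denum b)
       else if denum t = 3 then Imp (dec symb a) (dec symb b)
       else Bot))"

lemma dec_simps [simp]:
  "dec symb (tPred p xs) = Pred (symb (denum p)) (map denum (dlist xs))"
  "dec symb (tEq x y) = Eq (denum x) (denum y)"
  "dec symb tBot = Bot"
  "dec symb (tImp a b) = Imp (dec symb a) (dec symb b)"
  "dec symb (tForall a) = Forall (dec symb a)"
  by (simp_all add: tPred_def tEq_def tBot_def tImp_def tForall_def del: num.simps)

lemma dec_enc: "(\<And>p. p \<in> set_fm \<phi> \<Longrightarrow> symb (idx p) = p) \<Longrightarrow> dec symb (enc idx \<phi>) = \<phi>"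
  by (induction \<phi>) (simp_all add: comp_def)

primrec plist :: "pat list \<Rightarrow> pat" where
  "plist [] = PTree Leaf"
| "plist (p # ps) = PNode p (plist ps)"

definition pS :: "pat \<Rightarrow> pat" where "pS p = PNode (PTree Leaf) p"
definition pPred :: "pat \<Rightarrow> pat \<Rightarrow> pat" where "pPred p xs = PNode (PTree (num 0)) (PNode p xs)"
definition pEq :: "pat \<Rightarrow> pat \<Rightarrow> pat" where "pEq x y = PNode (PTree (num 1)) (PNode x y)"
definition pImp :: "pat \<Rightarrow> pat \<Rightarrow> pat" where "pImp a b = PNode (PTree (num 3)) (PNode a b)"
definition pForall :: "pat \<Rightarrow> pat" where "pForall a = PNode (PTree (num 4)) a"
definition pFact :: "nat \<Rightarrow> pat list \<Rightarrow> pat" where "pFact k ps = PNode (PTree (num k)) (plist ps)"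

abbreviation "pBot \<equiv> PTree tBot"
abbreviation "pNeg a \<equiv> pImp a pBot"
abbreviation "pAnd a b \<equiv> pNeg (pImp a (pNeg b))"
abbreviation "pEx a \<equiv> pNeg (pForall (pNeg a))"
abbreviation "pNil \<equiv> PTree Leaf"

lemma peval_plist: "peval \<theta> (plist ps) = tlist (map (peval \<theta>) ps)"
  by (induction ps) auto

lemma peval_simps [simp]:
  "peval \<theta> (pS p) = Node Leaf (peval \<theta> p)"
  "peval \<theta> (pPred p xs) = tPred (peval \<theta> p) (peval \<theta> xs)"
  "peval \<theta> (pEq p q) = tEq (peval \<theta> p) (peval \<theta> q)"
  "peval \<theta> (pImp p q) = tImp (peval \<theta> p) (peval \<theta> q)"
  "peval \<theta> (pForall p) = tForall (peval \<theta> p)"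
  "peval \<theta> (pFact k ps) = fact k (map (peval \<theta>) ps)"
  by (simp_all add: pS_def pPred_def pEq_def pImp_def pForall_def pFact_def
    tPred_def tEq_def tImp_def tForall_def fact_def peval_plist)

lemma pvars_plist: "pvars (plist ps) = (\<Union>p\<in>set ps. pvars p)"
  by (induction ps) auto

lemma pvars_simps [simp]:
  "pvars (pS p) = pvars p"
  "pvars (pPred p q) = pvars p \<union> pvars q"
  "pvars (pEq p q) = pvars p \<union> pvars q"
  "pvars (pImp p q) = pvars p \<union> pvars q"
  "pvars (pForall p) = pvars p"
  "pvars (pFact k ps) = (\<Union>p\<in>set ps. pvars p)"
  by (simp_all add: pS_def pPred_def pEq_def pImp_def pForall_def pFact_def pvars_plist)

text \<open>
  A renaming is coded by a numeral: 0 for \<open>Suc\<close> and \<open>Suc x\<close> for instantiating the index 0 by \<open>x\<close>.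
\<close>

fun renaming :: "nat \<Rightarrow> nat \<Rightarrow> nat" where
  "renaming 0 = Suc"
| "renaming (Suc x) = case_nat x (\<lambda>n. n)"

text \<open>The renaming in force below \<open>k\<close> quantifiers, by the recursion of
  \<open>rename\<close>. The program thus only has to keep track of \<open>k\<close> and of the code
  of the original renaming.\<close>

primrec lifted :: "nat \<Rightarrow> (nat \<Rightarrow> nat) \<Rightarrow> nat \<Rightarrow> nat" where
  "lifted 0 f = f"
| "lifted (Suc k) f = case_nat 0 (\<lambda>n. Suc (lifted k f n))"

abbreviation "RenameVar k f x y \<equiv> pFact 0 [k, f, x, y]"
abbreviation "RenameVars k f xs ys \<equiv> pFact 1 [k, f, xs, ys]"
abbreviation "Rename k f a b \<equiv> pFact 2 [k, f, a, b]"
abbreviation "ShiftAll G H \<equiv> pFact 3 [G, H]"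
abbreviation "Member a G \<equiv> pFact 4 [a, G]"
abbreviation "Proves G a \<equiv> pFact 5 [G, a]"
abbreviation "Quote t d \<equiv> pFact 6 [t, d]"
abbreviation "Diag t \<equiv> pFact 7 [t]"

abbreviation "v0 \<equiv> PVar 0"
abbreviation "v1 \<equiv> PVar 1"
abbreviation "v2 \<equiv> PVar 2"
abbreviation "v3 \<equiv> PVar 3"
abbreviation "v4 \<equiv> PVar 4"
abbreviation "v5 \<equiv> PVar 5"

text \<open>The first three clauses tabulate \<open>renaming\<close> at depth 0, for the shift and
  for an instantiation; the last two pass one quantifier.\<close>

definition rename_var_clauses :: "clause list" where
  "rename_var_clauses = [
     (RenameVar pNil pNil v0 (pS v0), []),
     (RenameVar pNil (pS v0) pNil v0, []),
     (RenameVar pNil (pS v0) (pS v1) v1, []),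
     (RenameVar (pS v0) v1 pNil pNil, []),
     (RenameVar (pS v0) v1 (pS v2) (pS v3), [RenameVar v0 v1 v2 v3])]"

definition rename_vars_clauses :: "clause list" where
  "rename_vars_clauses = [
     (RenameVars v0 v1 pNil pNil, []),
     (RenameVars v0 v1 (PNode v2 v3) (PNode v4 v5), [RenameVar v0 v1 v2 v4, RenameVars v0 v1 v3 v5])]"

definition rename_clauses :: "clause list" where
  "rename_clauses = [
     (Rename v0 v1 (pPred v2 v3) (pPred v2 v4), [RenameVars v0 v1 v3 v4]),
     (Rename v0 v1 (pEq v2 v3) (pEq v4 v5), [RenameVar v0 v1 v2 v4, RenameVar v0 v1 v3 v5]),
     (Rename v0 v1 pBot pBot, []),
     (Rename v0 v1 (pImp v2 v3) (pImp v4 v5), [Rename v0 v1 v2 v4, Rename v0 v1 v3 v5]),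
     (Rename v0 v1 (pForall v2) (pForall v3), [Rename (pS v0) v1 v2 v3])]"

definition context_clauses :: "clause list" where
  "context_clauses = [
     (ShiftAll pNil pNil, []),
     (ShiftAll (PNode v0 v1) (PNode v2 v3), [Rename pNil pNil v0 v2, ShiftAll v1 v3]),
     (Member v0 (PNode v0 v1), []),
     (Member v0 (PNode v1 v2), [Member v0 v2])]"

text \<open>One clause for each rule of \<open>proves\<close>, with lists as contexts. In the last
  clause, the two renamings of \<open>v3\<close> express that premise and conclusion are instances
  of the same formula.\<close>

definition proof_clauses :: "clause list" where
  "proof_clauses = [
     (Proves v0 v1, [Member v1 v0]),
     (Proves v0 (pImp v1 v2), [Proves (PNode v1 v0) v2]),
     (Proves v0 v2, [Proves v0 (pImp v1 v2), Proves v0 v1]),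
     (Proves v0 v1, [Proves (PNode (pNeg v1) v0) pBot]),
     (Proves v0 (pForall v1), [ShiftAll v0 v2, Proves v2 v1]),
     (Proves v0 v3, [Proves v0 (pForall v1), Rename pNil (pS v2) v1 v3]),
     (Proves v0 (pEq v1 v1), []),
     (Proves v0 v5, [Proves v0 (pEq v1 v2), Rename pNil (pS v1) v3 v4, Proves v0 v4,
        Rename pNil (pS v2) v3 v5])]"

section \<open>Quotation, diagonalisation and soundness of the program\<close>

locale provability =
  fixes idx :: "'p \<Rightarrow> nat" and symb :: "nat \<Rightarrow> 'p" and nilF conF \<alpha> :: "'p fm"
  assumes symb: "\<And>p. p \<in> set_fm nilF \<union> set_fm conF \<union> set_fm \<alpha> \<Longrightarrow> symb (idx p) = p"
begin

text \<open>With \<open>nilF\<close> and \<open>conF\<close> defining the two constructors,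
  \<open>quote t\<close> says of the variable 0 that it is the tree \<open>t\<close>. Each component
  is described directly below its own quantifier, where its variable is again 0; hence the code of a
  quotation is computed without renaming.\<close>

primrec quote :: "tree \<Rightarrow> 'p fm" where
  "quote Leaf = nilF"
| "quote (Node s t) = Ex (And (quote s) (Ex (And (quote t) conF)))"

text \<open>\<open>Diag t\<close> applies the formula coded by \<open>t\<close> to its own code and
  asks whether the result proves \<open>\<alpha>\<close>. As no term denotes a tree, substitution of
  the code is replaced by an existential quantifier over an element described as
  \<open>t\<close>.\<close>

definition diag_clauses :: "clause list" where
  "diag_clauses = [
     (Quote pNil (PTree (enc idx nilF)), []),
     (Quote (PNode v0 v1) (pEx (pAnd v2 (pEx (pAnd v3 (PTree (enc idx conF)))))), [Quote v0 v2, Quote v1 v3]),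
     (Diag v0, [Quote v0 v1, Proves (PNode (pEx (pAnd v0 v1)) pNil) (PTree (enc idx \<alpha>))])]"

definition prog :: "clause list" where
  "prog = rename_var_clauses @ rename_vars_clauses @ rename_clauses @ context_clauses @
     proof_clauses @ diag_clauses"

text \<open>The intended reading compares decoded arguments, because a malformed tree may decode to
  the same formula as a proper code.\<close>

definition meaning :: "nat \<Rightarrow> tree list \<Rightarrow> bool" where
  "meaning k ts \<longleftrightarrow> (
    if k = 0 then denum (ts ! 3) = lifted (denum (ts ! 0)) (renaming (denum (ts ! 1))) (denum (ts ! 2))
    else if k = 1 then map denum (dlist (ts ! 3)) =
      map (lifted (denum (ts ! 0)) (renaming (denum (ts ! 1)))) (map denum (dlist (ts ! 2)))
    else if k = 2 then dec symb (ts ! 3) =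
      rename (lifted (denum (ts ! 0)) (renaming (denum (ts ! 1)))) (dec symb (ts ! 2))
    else if k = 3 then map (dec symb) (dlist (ts ! 1)) = map (rename Suc) (map (dec symb) (dlist (ts ! 0)))
    else if k = 4 then dec symb (ts ! 0) \<in> dec symb ` set (dlist (ts ! 1))
    else if k = 5 then dec symb ` set (dlist (ts ! 0)) \<turnstile> dec symb (ts ! 1)
    else if k = 6 then dec symb (ts ! 1) = quote (ts ! 0)
    else {Ex (And (dec symb (ts ! 0)) (quote (ts ! 0)))} \<turnstile> \<alpha>)"

definition valid :: "tree \<Rightarrow> bool" where
  "valid t \<longleftrightarrow> (\<exists>k ts. t = fact k ts \<and> meaning k ts)"

lemma valid_fact [simp]: "valid (fact k ts) \<longleftrightarrow> meaning k ts"
  by (auto simp: valid_def)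

definition sound_clauses :: "clause list \<Rightarrow> bool" where
  "sound_clauses cs \<longleftrightarrow> (\<forall>(h, bs)\<in>set cs. \<forall>\<theta>. (\<forall>b\<in>set bs. valid (peval \<theta> b)) \<longrightarrow> valid (peval \<theta> h))"

lemma sound_rename_clauses:
  "sound_clauses rename_var_clauses" "sound_clauses rename_vars_clauses" "sound_clauses rename_clauses"
  by (simp_all add: sound_clauses_def rename_var_clauses_def rename_vars_clauses_def
    rename_clauses_def meaning_def comp_def)

lemma sound_context_clauses: "sound_clauses context_clauses"
  by (simp add: sound_clauses_def context_clauses_def meaning_def)

lemma sound_proof_clauses: "sound_clauses proof_clauses"
proof -
  have shift: "\<Gamma> \<turnstile> Forall \<phi>" if "map (dec symb) (dlist H) = map (rename Suc) (map (dec symb) (dlist G))"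
    "dec symb ` set (dlist H) \<turnstile> \<phi>" "\<Gamma> = dec symb ` set (dlist G)" for G H \<phi> \<Gamma>
    using arg_cong[OF that(1), of set] that(2,3) by (intro proves.ForallI) (simp add: image_image)
  have inst: "rename (case_nat x (\<lambda>n. n)) \<phi> = inst x \<phi>" for x and \<phi> :: "'p fm"
    by (simp add: inst_def)
  show ?thesis
    unfolding sound_clauses_def proof_clauses_def list.set ball_simps prod.case simp_thms
  proof (intro conjI allI impI)
    fix \<theta> :: "nat \<Rightarrow> tree"
    let ?\<Gamma> = "dec symb ` set (dlist (\<theta> 0))"
    show "valid (peval \<theta> (Proves v0 v1))" if "valid (peval \<theta> (Member v1 v0))"
      using that by (simp add: meaning_def proves.Assm)
    show "valid (peval \<theta> (Proves v0 (pImp v1 v2)))" if "valid (peval \<theta> (Proves (PNode v1 v0) v2))"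
      using that by (simp add: meaning_def) (rule proves.ImpI)
    show "valid (peval \<theta> (Proves v0 v2))"
      if "valid (peval \<theta> (Proves v0 (pImp v1 v2))) \<and> valid (peval \<theta> (Proves v0 v1))"
      using that by (simp add: meaning_def) (blast intro: proves.ImpE)
    show "valid (peval \<theta> (Proves v0 v1))" if "valid (peval \<theta> (Proves (PNode (pNeg v1) v0) pBot))"
      using that by (simp add: meaning_def) (erule proves.Contr)
    show "valid (peval \<theta> (Proves v0 (pForall v1)))"
      if "valid (peval \<theta> (ShiftAll v0 v2)) \<and> valid (peval \<theta> (Proves v2 v1))"
      using that shift[of "\<theta> 2" "\<theta> 0" "dec symb (\<theta> 1)" ?\<Gamma>] by (simp add: meaning_def)
    show "valid (peval \<theta> (Proves v0 v3))"
      if "valid (peval \<theta> (Proves v0 (pForall v1))) \<and> valid (peval \<theta> (Rename pNil (pS v2) v1 v3))"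
      using that proves.ForallE[of ?\<Gamma> "dec symb (\<theta> 1)" "denum (\<theta> 2)"] by (simp add: meaning_def inst)
    show "valid (peval \<theta> (Proves v0 (pEq v1 v1)))"
      by (simp add: meaning_def proves.EqRefl)
    show "valid (peval \<theta> (Proves v0 v5))"
      if "valid (peval \<theta> (Proves v0 (pEq v1 v2))) \<and> valid (peval \<theta> (Rename pNil (pS v1) v3 v4)) \<and>
        valid (peval \<theta> (Proves v0 v4)) \<and> valid (peval \<theta> (Rename pNil (pS v2) v3 v5))"
      using that proves.EqSubst[of ?\<Gamma> "denum (\<theta> 1)" "denum (\<theta> 2)" "dec symb (\<theta> 3)"]
      by (auto simp: meaning_def inst)
  qed
qed

lemma sound_diag_clauses: "sound_clauses diag_clauses"
  using symb by (clarsimp simp: sound_clauses_def diag_clauses_def meaning_def dec_enc Ex_def And_def)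

lemma derivable_valid: "derivable (set prog) t \<Longrightarrow> valid t"
proof (induction rule: derivable.induct)
  case (1 h bs \<theta>)
  then show ?case
    using sound_rename_clauses sound_context_clauses sound_proof_clauses sound_diag_clauses
    unfolding prog_def sound_clauses_def by auto
qed

text \<open>The list \<open>ts\<close> gives the values of the clause variables \<open>v0\<close>,
  \<open>v1\<close> and so on.\<close>

lemma clauseI:
  assumes "set cs \<subseteq> P" "i < length cs" "peval ((!) ts) (fst (cs ! i)) = t"
    "\<forall>b\<in>set (snd (cs ! i)). derivable P (peval ((!) ts) b)"
  shows "derivable P t"
proof -
  have "(fst (cs ! i), snd (cs ! i)) \<in> P" using assms(1,2) nth_mem by force
  then show ?thesis unfolding assms(3)[symmetric] using assms(4) by (blast intro: derivable.intros)
qed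

lemma clauses_subset:
  "set rename_var_clauses \<subseteq> set prog" "set rename_vars_clauses \<subseteq> set prog"
  "set rename_clauses \<subseteq> set prog" "set context_clauses \<subseteq> set prog"
  "set proof_clauses \<subseteq> set prog" "set diag_clauses \<subseteq> set prog"
  unfolding prog_def set_append by blast+

section \<open>Completeness of the program for derivability\<close>

abbreviation "drv \<equiv> derivable (set prog)"

lemma drv_rename_var: "drv (fact 0 [num k, num f, num n, num (lifted k (renaming f) n)])"
proof (induction k arbitrary: n)
  case 0
  show ?case
  proof (cases f)
    case 0
    then show ?thesis
      by (intro clauseI[OF clauses_subset(1), of 0 "[num n]"])
        (simp_all add: rename_var_clauses_def)
  next
    case f: (Suc x)
    show ?thesis
    proof (cases n)
      case 0
      then show ?thesis using f
        by (intro clauseI[OF clauses_subset(1), of 1 "[num x]"])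
          (simp_all add: rename_var_clauses_def)
    next
      case (Suc n')
      then show ?thesis using f
        by (intro clauseI[OF clauses_subset(1), of 2 "[num x, num n']"])
          (simp_all add: rename_var_clauses_def)
    qed
  qed
next
  case (Suc k)
  show ?case
  proof (cases n)
    case 0
    then show ?thesis
      by (intro clauseI[OF clauses_subset(1), of 3 "[num k, num f]"])
        (simp_all add: rename_var_clauses_def)
  next
    case (Suc n')
    then show ?thesis using Suc.IH[of n']
      by (intro clauseI[OF clauses_subset(1), of 4 "[num k, num f, num n', num (lifted k (renaming f) n')]"])
        (simp_all add: rename_var_clauses_def)
  qed
qed

lemma drv_rename_vars:
  "drv (fact 1 [num k, num f, tlist (map num xs), tlist (map num (map (lifted k (renaming f)) xs))])"
proof (induction xs)
  case Nil
  show ?case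
    by (intro clauseI[OF clauses_subset(2), of 0 "[num k, num f]"])
      (simp_all add: rename_vars_clauses_def)
next
  case (Cons x xs)
  then show ?case using drv_rename_var[of k f x]
    by (intro clauseI[OF clauses_subset(2), of 1
        "[num k, num f, num x, tlist (map num xs), num (lifted k (renaming f) x), tlist (map num (map (lifted k (renaming f)) xs))]"])
      (simp_all add: rename_vars_clauses_def)
qed

lemma drv_rename: "drv (fact 2 [num k, num f, enc idx \<phi>, enc idx (rename (lifted k (renaming f)) \<phi>)])"
proof (induction \<phi> arbitrary: k)
  case (Pred p xs)
  show ?case using drv_rename_vars[of k f xs]
    by (intro clauseI[OF clauses_subset(3), of 0
        "[num k, num f, num (idx p), tlist (map num xs), tlist (map num (map (lifted k (renaming f)) xs))]"])
      (simp_all add: rename_clauses_def)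
next
  case (Eq x y)
  show ?case using drv_rename_var[of k f x] drv_rename_var[of k f y]
    by (intro clauseI[OF clauses_subset(3), of 1
        "[num k, num f, num x, num y, num (lifted k (renaming f) x), num (lifted k (renaming f) y)]"])
      (simp_all add: rename_clauses_def)
next
  case Bot
  show ?case
    by (intro clauseI[OF clauses_subset(3), of 2 "[num k, num f]"])
      (simp_all add: rename_clauses_def)
next
  case (Imp \<phi> \<psi>)
  show ?case using Imp.IH(1)[of k] Imp.IH(2)[of k]
    by (intro clauseI[OF clauses_subset(3), of 3
        "[num k, num f, enc idx \<phi>, enc idx \<psi>, enc idx (rename (lifted k (renaming f)) \<phi>), enc idx (rename (lifted k (renaming f)) \<psi>)]"])
      (simp_all add: rename_clauses_def)
next
  case (Forall \<phi>)
  show ?case using Forall.IH[of "Suc k"]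
    by (intro clauseI[OF clauses_subset(3), of 4
        "[num k, num f, enc idx \<phi>, enc idx (rename (lifted (Suc k) (renaming f)) \<phi>)]"])
      (simp_all add: rename_clauses_def)
qed

abbreviation encs :: "'p fm list \<Rightarrow> tree" where
  "encs L \<equiv> tlist (map (enc idx) L)"

lemma drv_shift_all: "drv (fact 3 [encs L, encs (map (rename Suc) L)])"
proof (induction L)
  case Nil
  show ?case
    by (intro clauseI[OF clauses_subset(4), of 0 "[]"])
      (simp_all add: context_clauses_def)
next
  case (Cons \<phi> L)
  then show ?case using drv_rename[of 0 0 \<phi>]
    by (intro clauseI[OF clauses_subset(4), of 1
        "[enc idx \<phi>, encs L, enc idx (rename Suc \<phi>), encs (map (rename Suc) L)]"])
      (simp_all add: context_clauses_def)
qed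

lemma drv_member: "\<phi> \<in> set L \<Longrightarrow> drv (fact 4 [enc idx \<phi>, encs L])"
proof (induction L)
  case (Cons \<psi> L)
  show ?case
  proof (cases "\<phi> = \<psi>")
    case True
    then show ?thesis
      by (intro clauseI[OF clauses_subset(4), of 2 "[enc idx \<phi>, encs L]"])
        (simp_all add: context_clauses_def)
  next
    case False
    then show ?thesis using Cons
      by (intro clauseI[OF clauses_subset(4), of 3 "[enc idx \<phi>, enc idx \<psi>, encs L]"])
        (simp_all add: context_clauses_def)
  qed
qed simp

lemma drv_inst: "drv (fact 2 [Leaf, Node Leaf (num x), enc idx \<phi>, enc idx (inst x \<phi>)])"
  using drv_rename[of 0 "Suc x" \<phi>] by (simp add: inst_def)

text \<open>Contexts are sets in \<open>proves\<close> but lists in the program. Speaking of every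
  list that covers a fixed finite part of \<Gamma> builds weakening and reordering into the
  induction, as the rules that alter the context require.\<close>

lemma drv_proves:
  "\<Gamma> \<turnstile> \<phi> \<Longrightarrow> \<exists>L\<^sub>0. set L\<^sub>0 \<subseteq> \<Gamma> \<and> (\<forall>L. set L\<^sub>0 \<subseteq> set L \<longrightarrow> drv (fact 5 [encs L, enc idx \<phi>]))"
proof (induction rule: proves.induct)
  case (Assm \<phi> \<Gamma>)
  have "drv (fact 5 [encs L, enc idx \<phi>])" if "\<phi> \<in> set L" for L
    using drv_member[OF that]
    by (intro clauseI[OF clauses_subset(5), of 0 "[encs L, enc idx \<phi>]"])
      (simp_all add: proof_clauses_def)
  then show ?case using Assm by (intro exI[of _ "[\<phi>]"]) auto
next
  case (ImpI \<phi> \<Gamma> \<psi>)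
  then obtain L0 where L0: "set L0 \<subseteq> insert \<phi> \<Gamma>" "\<And>L. set L0 \<subseteq> set L \<Longrightarrow> drv (fact 5 [encs L, enc idx \<psi>])"
    by blast
  have "drv (fact 5 [encs L, enc idx (Imp \<phi> \<psi>)])" if "set (removeAll \<phi> L0) \<subseteq> set L" for L
    using L0(2)[of "\<phi> # L"] that
    by (intro clauseI[OF clauses_subset(5), of 1 "[encs L, enc idx \<phi>, enc idx \<psi>]"])
      (auto simp: proof_clauses_def)
  then show ?case using L0(1) by (intro exI[of _ "removeAll \<phi> L0"]) auto
next
  case (ImpE \<Gamma> \<phi> \<psi>)
  obtain L1 where L1: "set L1 \<subseteq> \<Gamma>" "\<And>L. set L1 \<subseteq> set L \<Longrightarrow> drv (fact 5 [encs L, enc idx (Imp \<phi> \<psi>)])"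
    using ImpE.IH(1) by blast
  obtain L2 where L2: "set L2 \<subseteq> \<Gamma>" "\<And>L. set L2 \<subseteq> set L \<Longrightarrow> drv (fact 5 [encs L, enc idx \<phi>])"
    using ImpE.IH(2) by blast
  have "drv (fact 5 [encs L, enc idx \<psi>])" if "set (L1 @ L2) \<subseteq> set L" for L
    using L1(2)[of L] L2(2)[of L] that
    by (intro clauseI[OF clauses_subset(5), of 2 "[encs L, enc idx \<phi>, enc idx \<psi>]"])
      (auto simp: proof_clauses_def)
  then show ?case using L1(1) L2(1) by (intro exI[of _ "L1 @ L2"]) auto
next
  case (Contr \<phi> \<Gamma>)
  then obtain L0 where L0: "set L0 \<subseteq> insert (Neg \<phi>) \<Gamma>" "\<And>L. set L0 \<subseteq> set L \<Longrightarrow> drv (fact 5 [encs L, enc idx Bot])"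
    by blast
  have "drv (fact 5 [encs L, enc idx \<phi>])" if "set (removeAll (Neg \<phi>) L0) \<subseteq> set L" for L
    using L0(2)[of "Neg \<phi> # L"] that
    by (intro clauseI[OF clauses_subset(5), of 3 "[encs L, enc idx \<phi>]"])
      (auto simp: proof_clauses_def)
  then show ?case using L0(1) by (intro exI[of _ "removeAll (Neg \<phi>) L0"]) auto
next
  case (ForallI \<Gamma> \<phi>)
  then obtain L0 where L0: "set L0 \<subseteq> rename Suc ` \<Gamma>" "\<And>L. set L0 \<subseteq> set L \<Longrightarrow> drv (fact 5 [encs L, enc idx \<phi>])"
    by blast
  \<comment> \<open>\<open>ShiftAll\<close> relates whole lists, so the finite part of the shifted
    context is pulled back to a list of unshifted formulas.\<close>
  from L0(1) have "\<exists>L1. set L1 \<subseteq> \<Gamma> \<and> map (rename Suc) L1 = L0"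
  proof (induction L0)
    case (Cons \<psi> L)
    then obtain L1 \<chi> where "set L1 \<subseteq> \<Gamma>" "map (rename Suc) L1 = L" "\<chi> \<in> \<Gamma>" "\<psi> = rename Suc \<chi>" by auto
    then show ?case by (intro exI[of _ "\<chi> # L1"]) auto
  qed simp
  then obtain L1 where L1: "set L1 \<subseteq> \<Gamma>" "map (rename Suc) L1 = L0" by blast
  have "drv (fact 5 [encs L, enc idx (Forall \<phi>)])" if "set L1 \<subseteq> set L" for L
  proof -
    have "drv (fact 5 [encs (map (rename Suc) L), enc idx \<phi>])"
      using L0(2)[of "map (rename Suc) L"] image_mono[OF that, of "rename Suc"] L1(2) by auto
    then show ?thesis using drv_shift_all[of L]
      by (intro clauseI[OF clauses_subset(5), of 4 "[encs L, enc idx \<phi>, encs (map (rename Suc) L)]"])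
        (auto simp: proof_clauses_def)
  qed
  then show ?case using L1(1) by blast
next
  case (ForallE \<Gamma> \<phi> x)
  then obtain L0 where L0: "set L0 \<subseteq> \<Gamma>" "\<And>L. set L0 \<subseteq> set L \<Longrightarrow> drv (fact 5 [encs L, enc idx (Forall \<phi>)])"
    by blast
  have "drv (fact 5 [encs L, enc idx (inst x \<phi>)])" if "set L0 \<subseteq> set L" for L
    using L0(2)[OF that] drv_inst[of x \<phi>]
    by (intro clauseI[OF clauses_subset(5), of 5 "[encs L, enc idx \<phi>, num x, enc idx (inst x \<phi>)]"])
      (auto simp: proof_clauses_def)
  then show ?case using L0(1) by blast
next
  case (EqRefl \<Gamma> x)
  have "drv (fact 5 [encs L, enc idx (Eq x x)])" for L
    by (intro clauseI[OF clauses_subset(5), of 6 "[encs L, num x]"])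
      (auto simp: proof_clauses_def)
  then show ?case by (intro exI[of _ "[]"]) auto
next
  case (EqSubst \<Gamma> x y \<phi>)
  obtain L1 where L1: "set L1 \<subseteq> \<Gamma>" "\<And>L. set L1 \<subseteq> set L \<Longrightarrow> drv (fact 5 [encs L, enc idx (Eq x y)])"
    using EqSubst.IH(1) by blast
  obtain L2 where L2: "set L2 \<subseteq> \<Gamma>" "\<And>L. set L2 \<subseteq> set L \<Longrightarrow> drv (fact 5 [encs L, enc idx (inst x \<phi>)])"
    using EqSubst.IH(2) by blast
  have "drv (fact 5 [encs L, enc idx (inst y \<phi>)])" if "set (L1 @ L2) \<subseteq> set L" for L
    using L1(2)[of L] L2(2)[of L] that drv_inst[of x \<phi>] drv_inst[of y \<phi>]
    by (intro clauseI[OF clauses_subset(5), of 7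
        "[encs L, num x, num y, enc idx \<phi>, enc idx (inst x \<phi>), enc idx (inst y \<phi>)]"])
      (auto simp: proof_clauses_def)
  then show ?case using L1(1) L2(1) by (intro exI[of _ "L1 @ L2"]) auto
qed

lemma drv_quote: "drv (fact 6 [t, enc idx (quote t)])"
proof (induction t)
  case Leaf
  show ?case
    by (intro clauseI[OF clauses_subset(6), of 0 "[]"])
      (simp_all add: diag_clauses_def)
next
  case (Node s t)
  then show ?case
    by (intro clauseI[OF clauses_subset(6), of 1
        "[s, t, enc idx (quote s), enc idx (quote t)]"])
      (simp_all add: diag_clauses_def Ex_def And_def)
qed

text \<open>One direction is soundness of the program. For the other, the derivation runs in the
  context that lists just the diagonal sentence, and \<open>drv_quote\<close> supplies the quotation
  \<open>Diag\<close> asks for.\<close>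

lemma derivable_diag_iff:
  assumes "\<And>p. p \<in> set_fm \<phi> \<Longrightarrow> symb (idx p) = p"
  shows "drv (peval (\<lambda>_. enc idx \<phi>) (Diag v0)) \<longleftrightarrow> {Ex (And \<phi> (quote (enc idx \<phi>)))} \<turnstile> \<alpha>"
proof
  assume "drv (peval (\<lambda>_. enc idx \<phi>) (Diag v0))"
  then show "{Ex (And \<phi> (quote (enc idx \<phi>)))} \<turnstile> \<alpha>"
    using derivable_valid[of "fact 7 [enc idx \<phi>]"] assms by (simp add: meaning_def dec_enc)
next
  let ?\<gamma> = "Ex (And \<phi> (quote (enc idx \<phi>)))"
  assume "{?\<gamma>} \<turnstile> \<alpha>"
  then obtain L0 where "set L0 \<subseteq> {?\<gamma>}" "\<forall>L. set L0 \<subseteq> set L \<longrightarrow> drv (fact 5 [encs L, enc idx \<alpha>])"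
    using drv_proves by blast
  then have "drv (fact 5 [encs [?\<gamma>], enc idx \<alpha>])" by (metis empty_set list.simps(15))
  then show "drv (peval (\<lambda>_. enc idx \<phi>) (Diag v0))" using drv_quote[of "enc idx \<phi>"]
    by (intro clauseI[OF clauses_subset(6), of 2
        "[enc idx \<phi>, enc idx (quote (enc idx \<phi>))]"])
      (simp_all add: diag_clauses_def Ex_def And_def)
qed

text \<open>The shape is what \<open>horn_model_complete\<close> demands; the number 6 counts the
  variables \<open>v0\<close> to \<open>v5\<close>.\<close>

lemma prog_shape:
  assumes "(h, bs) \<in> set prog" "p \<in> insert h (set bs)"
  shows "(\<exists>p1 p2. p = PNode p1 p2) \<and> pvars p \<subseteq> {..<6}"
proof -
  have fact: "(\<exists>p1 p2. pFact k ps = PNode p1 p2) \<longleftrightarrow> True" for k ps by (simp add: pFact_def)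
  define good where "good p \<longleftrightarrow> (\<exists>p1 p2. p = PNode p1 p2) \<and> pvars p \<subseteq> {..<6}" for p
  have good: "good (pFact k ps) \<longleftrightarrow> (\<forall>p\<in>set ps. pvars p \<subseteq> {..<6})" for k ps
    unfolding good_def fact by (simp add: UN_subset_iff)
  have "\<forall>c\<in>set prog. good (fst c) \<and> (\<forall>p\<in>set (snd c). good p)"
    by (simp add: prog_def rename_var_clauses_def rename_vars_clauses_def rename_clauses_def
      context_clauses_def proof_clauses_def diag_clauses_def good)
  then have "good p" using assms by force
  then show ?thesis by (simp add: good_def)
qed

end

section \<open>A self-referential sentence\<close>

text \<open>Four relations share one set of lists. Repeated arguments bring their lists to the
  distinct lengths 1 to 4, so that the length alone tells them apart.\<close>

definition trees_of :: "'d set \<Rightarrow> ('d \<Rightarrow> 'd \<Rightarrow> bool) \<Rightarrow> 'd trees" where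
  "trees_of D E = \<lparr>nil = (\<lambda>x. reads D E [x]), con = (\<lambda>x y z. reads D E [x, y, z, z]),
     lt = (\<lambda>x y. reads D E [x, y, y]), holds = (\<lambda>x. reads D E [x, x])\<rparr>"

definition tree_lists :: "'d trees \<Rightarrow> 'd list set" where
  "tree_lists T = {[x] | x. nil T x} \<union> {[x, x] | x. holds T x} \<union> {[x, y, y] | x y. lt T x y} \<union>
     {[x, y, z, z] | x y z. con T x y z}"

lemma trees_of_coding_graph:
  assumes "coding_closed D Q" and "\<And>ys. length ys \<le> 4 \<Longrightarrow> ys \<in> Q \<longleftrightarrow> ys \<in> tree_lists T"
  shows "trees_of D (coding_graph Q) = (T :: nat trees)"
  by (simp add: trees_of_def reads_coding_graph[OF assms(1)] assms(2)) (simp add: tree_lists_def)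

lemma fm_over_set_fm: "fm_over S \<phi> \<Longrightarrow> set_fm \<phi> \<subseteq> dom S"
  by (induction \<phi>) auto

lemma sat_sentence: "sentence S \<phi> \<Longrightarrow> sat D I e \<phi> \<longleftrightarrow> sat D I e' \<phi>"
  by (rule sat_cong) (simp add: sentence_def)

context coding
begin

section \<open>The conditions of \<open>horn_model\<close> as a formula\<close>

definition fnil :: "nat \<Rightarrow> 'p fm" where "fnil x = rel [x]"
definition fcon :: "nat \<Rightarrow> nat \<Rightarrow> nat \<Rightarrow> 'p fm" where "fcon x y z = rel [x, y, z, z]"
definition flt :: "nat \<Rightarrow> nat \<Rightarrow> 'p fm" where "flt x y = rel [x, y, y]"
definition fholds :: "nat \<Rightarrow> 'p fm" where "fholds x = rel [x, x]"
definition fnode :: "nat \<Rightarrow> 'p fm" where "fnode x = Or (fnil x) (Ex (Ex (fcon (Suc (Suc x)) 1 0)))"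

primrec fden :: "tree \<Rightarrow> 'p fm" where
  "fden Leaf = fnil 0"
| "fden (Node s t) = Ex (And (fden s) (Ex (And (fden t) (fcon 2 1 0))))"

text \<open>\<open>d\<close> counts the quantifiers passed since the pattern variables were bound. A
  constant tree is first copied to index 0, the only free variable of \<open>fden t\<close>.\<close>

primrec fpat :: "pat \<Rightarrow> nat \<Rightarrow> nat \<Rightarrow> 'p fm" where
  "fpat (PVar i) d x = Eq x (i + d)"
| "fpat (PTree t) d x = Ex (And (Eq 0 (Suc x)) (fden t))"
| "fpat (PNode p q) d x = Ex (Ex (conjs [fcon (Suc (Suc x)) 1 0, fpat p (Suc (Suc d)) 1, fpat q (Suc (Suc d)) 0]))"

definition fclause :: "nat \<Rightarrow> clause \<Rightarrow> 'p fm" where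
  "fclause k c = exs k (conjs (fpat (fst c) 0 k #
     map (\<lambda>b. Ex (conjs [flt 0 (Suc k), fholds 0, fpat b 1 0])) (snd c)))"

definition fhorn :: "clause list \<Rightarrow> nat \<Rightarrow> 'p fm" where
  "fhorn cs k = conjs [
     Forall (Neg (flt 0 0)),
     Forall (Forall (Forall (Imp (flt 2 1) (Imp (flt 1 0) (flt 2 0))))),
     Forall (Forall (Imp (fnode 1) (Imp (fnode 0) (disjs [Eq 1 0, flt 1 0, flt 0 1])))),
     Forall (Forall (Imp (flt 1 0) (And (fnode 1) (fnode 0)))),
     Forall (Forall (Forall (Imp (fcon 2 1 0)
       (conjs [Neg (fnil 2), fnode 1, fnode 0, flt 1 2, flt 0 2])))),
     Forall (Forall (Forall (Forall (Forall (Imp (fcon 4 3 2) (Imp (fcon 4 1 0)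
       (And (Eq 3 1) (Eq 2 0)))))))),
     Forall (Imp (fholds 0) (disjs (map (fclause k) cs)))]"

lemma sat_tree_atoms:
  "sat D I e (fnil x) \<longleftrightarrow> nil (trees_of D (edges I)) (e x)"
  "sat D I e (fcon x y z) \<longleftrightarrow> con (trees_of D (edges I)) (e x) (e y) (e z)"
  "sat D I e (flt x y) \<longleftrightarrow> lt (trees_of D (edges I)) (e x) (e y)"
  "sat D I e (fholds x) \<longleftrightarrow> holds (trees_of D (edges I)) (e x)"
  "sat D I e (fnode x) \<longleftrightarrow> node D (trees_of D (edges I)) (e x)"
proof -
  show *: "sat D I e (fnil x) \<longleftrightarrow> nil (trees_of D (edges I)) (e x)"
    "sat D I e (fcon x y z) \<longleftrightarrow> con (trees_of D (edges I)) (e x) (e y) (e z)" for e x y z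
    by (simp_all add: fnil_def fcon_def trees_of_def sat_rel)
  show "sat D I e (flt x y) \<longleftrightarrow> lt (trees_of D (edges I)) (e x) (e y)"
    "sat D I e (fholds x) \<longleftrightarrow> holds (trees_of D (edges I)) (e x)"
    by (simp_all add: flt_def fholds_def trees_of_def sat_rel)
  show "sat D I e (fnode x) \<longleftrightarrow> node D (trees_of D (edges I)) (e x)"
    by (simp add: fnode_def node_def *)
qed

lemma sat_fden: "sat D I e (fden t) \<longleftrightarrow> denotes D (trees_of D (edges I)) t (e 0)"
  by (induction t arbitrary: e) (simp_all add: sat_tree_atoms)

lemma sat_fpat:
  "e x \<in> D \<Longrightarrow> sat D I e (fpat p d x) \<longleftrightarrow> matches D (trees_of D (edges I)) (\<lambda>i. e (i + d)) p (e x)"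
  by (induction p arbitrary: e d x) (auto simp: sat_tree_atoms sat_fden)

lemma sat_fclause:
  assumes e: "range e \<subseteq> D" and vars: "pvars h \<subseteq> {..<k}" "\<And>b. b \<in> set bs \<Longrightarrow> pvars b \<subseteq> {..<k}"
  shows "sat D I e (fclause k (h, bs)) \<longleftrightarrow>
     (\<exists>\<theta>. (\<forall>i<k. \<theta> i \<in> D) \<and> matches D (trees_of D (edges I)) \<theta> h (e 0) \<and>
        (\<forall>b\<in>set bs. \<exists>w\<in>D. lt (trees_of D (edges I)) w (e 0) \<and> holds (trees_of D (edges I)) w \<and>
          matches D (trees_of D (edges I)) \<theta> b w))" (is "_ \<longleftrightarrow> ?R")
proof -
  let ?T = "trees_of D (edges I)"
  let ?M = "\<lambda>\<theta>. matches D ?T \<theta> h (e 0) \<and>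
      (\<forall>b\<in>set bs. \<exists>w\<in>D. lt ?T w (e 0) \<and> holds ?T w \<and> matches D ?T \<theta> b w)"
  have [simp]: "e 0 \<in> D" using e by auto
  have "sat D I e (fclause k (h, bs)) \<longleftrightarrow> (\<exists>xs. length xs = k \<and> set xs \<subseteq> D \<and> ?M (env xs e))"
  proof -
    have "sat D I (env xs e) (conjs (fpat h 0 k # map (\<lambda>b. Ex (conjs [flt 0 (Suc k), fholds 0, fpat b 1 0])) bs))
        \<longleftrightarrow> ?M (env xs e)" if "length xs = k" for xs
    proof -
      have [simp]: "env xs e k = e 0" using that by (simp add: env_nth)
      show ?thesis by (auto simp: sat_tree_atoms sat_fpat)
    qed
    then show ?thesis unfolding fclause_def sat_exs fst_conv snd_conv by blast
  qed
  also have "\<dots> \<longleftrightarrow> ?R"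
  proof
    assume "\<exists>xs. length xs = k \<and> set xs \<subseteq> D \<and> ?M (env xs e)"
    then obtain xs where xs: "length xs = k" "set xs \<subseteq> D" "?M (env xs e)" by blast
    have "\<forall>i<k. env xs e i \<in> D" using xs by (auto simp: env_nth)
    then show ?R using xs(3) by blast
  next
    assume ?R
    then obtain \<theta> where \<theta>: "\<forall>i<k. \<theta> i \<in> D" "?M \<theta>" by blast
    let ?xs = "map \<theta> [0..<k]"
    have "matches D ?T (env ?xs e) p u \<longleftrightarrow> matches D ?T \<theta> p u" if "pvars p \<subseteq> {..<k}" for p u
      by (rule matches_cong) (use that in \<open>auto simp: env_nth\<close>)
    then have "?M (env ?xs e)" using \<theta>(2) vars by (metis (no_types, lifting))
    then show "\<exists>xs. length xs = k \<and> set xs \<subseteq> D \<and> ?M (env xs e)"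
      using \<theta>(1) by (intro exI[of _ ?xs]) auto
  qed
  finally show ?thesis .
qed

lemma sat_fhorn:
  assumes "range e \<subseteq> D"
    and "\<And>h bs p. (h, bs) \<in> set cs \<Longrightarrow> p \<in> insert h (set bs) \<Longrightarrow> pvars p \<subseteq> {..<k}"
  shows "sat D I e (fhorn cs k) \<longleftrightarrow> horn_model (set cs) k D (trees_of D (edges I))"
proof -
  have "sat D I (case_nat x e) (fclause k c) \<longleftrightarrow> (case c of (h, bs) \<Rightarrow>
      \<exists>\<theta>. (\<forall>i<k. \<theta> i \<in> D) \<and> matches D (trees_of D (edges I)) \<theta> h x \<and>
        (\<forall>b\<in>set bs. \<exists>w\<in>D. lt (trees_of D (edges I)) w x \<and> holds (trees_of D (edges I)) w \<and>
          matches D (trees_of D (edges I)) \<theta> b w))" if "c \<in> set cs" "x \<in> D" for c x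
  proof (cases c)
    case (Pair h bs)
    have "range (case_nat x e) \<subseteq> D" using assms(1) that(2) by (auto split: nat.split simp: range_subsetD)
    from sat_fclause[OF this, of h k bs I] show ?thesis
      using assms(2) that(1) Pair by simp
  qed
  then show ?thesis
    unfolding fhorn_def horn_model_def by (simp add: sat_tree_atoms)
qed

lemma bounded_tree_atoms [simp]:
  "x < n \<Longrightarrow> bounded n (fnil x)" "x < n \<Longrightarrow> bounded n (fholds x)"
  "x < n \<Longrightarrow> y < n \<Longrightarrow> bounded n (flt x y)"
  "x < n \<Longrightarrow> y < n \<Longrightarrow> z < n \<Longrightarrow> bounded n (fcon x y z)"
  "x < n \<Longrightarrow> bounded n (fnode x)"
  by (simp_all add: fnil_def fholds_def flt_def fcon_def fnode_def bounded_rel)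

lemma bounded_fden: "0 < n \<Longrightarrow> bounded n (fden t)"
  by (induction t arbitrary: n) simp_all

lemma bounded_fpat: "x < n \<Longrightarrow> (\<And>i. i \<in> pvars p \<Longrightarrow> i + d < n) \<Longrightarrow> bounded n (fpat p d x)"
proof (induction p arbitrary: n d x)
  case (PNode p q)
  have "bounded (Suc (Suc n)) (fpat p (Suc (Suc d)) 1)" "bounded (Suc (Suc n)) (fpat q (Suc (Suc d)) 0)"
    by (rule PNode.IH; use PNode.prems in simp)+
  then show ?case using PNode.prems(1) by simp
qed (simp_all add: bounded_fden)

lemma bounded_fclause:
  assumes "\<And>p. p \<in> insert h (set bs) \<Longrightarrow> pvars p \<subseteq> {..<k}"
  shows "bounded (Suc n) (fclause k (h, bs))"
proof -
  have "bounded (Suc n + k) (fpat h 0 k)"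
    by (rule bounded_fpat) (use assms[of h] in auto)
  moreover have "bounded (Suc (Suc n + k)) (fpat b 1 0)" if "b \<in> set bs" for b
    by (rule bounded_fpat) (use assms[of b] that in auto)
  ultimately show ?thesis unfolding fclause_def by simp
qed

lemma bounded_fhorn:
  assumes "\<And>h bs p. (h, bs) \<in> set cs \<Longrightarrow> p \<in> insert h (set bs) \<Longrightarrow> pvars p \<subseteq> {..<k}"
  shows "bounded n (fhorn cs k)"
proof -
  have "bounded (Suc n) (fclause k c)" if "c \<in> set cs" for c
    using bounded_fclause[of "fst c" "snd c" k n] assms[of "fst c" "snd c"] that by simp
  then show ?thesis by (simp add: fhorn_def)
qed

lemma fm_over_tree_atoms:
  assumes "S r = Some (Suc m)"
  shows "fm_over S (fnil x)" "fm_over S (fholds x)" "fm_over S (flt x y)" "fm_over S (fcon x y z)"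
    "fm_over S (fnode x)" "fm_over S (fden t)" "fm_over S (fpat p d x)" "fm_over S (fhorn cs k)"
proof -
  show *: "fm_over S (fnil x)" "fm_over S (fholds x)" "fm_over S (flt x y)" "fm_over S (fcon x y z)"
    for x y z
    by (simp_all add: fnil_def fholds_def flt_def fcon_def fm_over_rel[of S, OF assms])
  then show **: "fm_over S (fnode x)" for x by (simp add: fnode_def)
  show den: "fm_over S (fden t)" for t by (induction t) (simp_all add: *)
  show pat: "fm_over S (fpat p d x)" for p d x by (induction p arbitrary: d x) (simp_all add: * den)
  show "fm_over S (fhorn cs k)" by (simp add: fhorn_def fclause_def * ** pat)
qed

text \<open>
  The sentence \<open>\<gamma>\<close> says \<open>\<chi>\<close> and that a derivation of \<open>\<alpha>\<close> from \<open>\<gamma>\<close> itself is coded: a model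
  either codes an actual derivation or has infinitely many nodes.
\<close>

definition self_refuting :: "'p signature \<Rightarrow> 'p fm \<Rightarrow> 'p fm \<Rightarrow> 'p fm \<Rightarrow> bool" where
  "self_refuting S \<chi> \<alpha> \<gamma> \<longleftrightarrow> sentence S \<gamma> \<and>
    (\<forall>(D :: nat set) I e. range e \<subseteq> D \<longrightarrow> sat D I e \<gamma> \<longrightarrow> sat D I e \<chi>) \<and>
    (\<forall>(D :: nat set) I e. range e \<subseteq> D \<longrightarrow> sat D I e \<gamma> \<longrightarrow> \<not> {\<gamma>} \<turnstile> \<alpha> \<longrightarrow>
      infinite {x\<in>D. node D (trees_of D (edges I)) x} \<and> (\<exists>P k. horn_model P k D (trees_of D (edges I)))) \<and>
    ({\<gamma>} \<turnstile> \<alpha> \<longrightarrow> (\<exists>b fs. (\<forall>f\<in>set fs. tnat f < b) \<and>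
      (\<forall>(D :: nat set) I e. range e \<subseteq> D \<longrightarrow> {..<b + length fs} \<subseteq> D \<longrightarrow>
        trees_of D (edges I) = fact_trees b fs \<longrightarrow> sat D I e \<chi> \<longrightarrow> sat D I e \<gamma>)))"

text \<open>The program depends only on \<open>\<alpha>\<close> and on the coding formulas. It is
  therefore available before the formula \<Phi> that speaks of it, and \<gamma> is the
  diagonalisation of \<Phi> at its own code.\<close>

theorem self_refuting_sentence:
  assumes S: "S r = Some (Suc m)" "finite (dom S)" and \<chi>: "sentence S \<chi>" and \<alpha>: "sentence S \<alpha>"
  shows "\<exists>\<gamma>. self_refuting S \<chi> \<alpha> \<gamma>"
proof -
  obtain idx :: "'p \<Rightarrow> nat" where idx: "inj_on idx (dom S)"
    using finite_imp_inj_to_nat_seg[OF S(2)] by auto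
  define symb where "symb = inv_into (dom S) idx"
  have symb_idx: "symb (idx p) = p" if "fm_over S \<phi>" "p \<in> set_fm \<phi>" for p \<phi>
    unfolding symb_def using inv_into_f_f[OF idx] fm_over_set_fm[OF that(1)] that(2) by blast
  note over = fm_over_tree_atoms[of S, OF S(1)]
  interpret provability idx symb "fnil 0" "fcon 2 (Suc 0) 0" \<alpha>
  proof
    show "symb (idx p) = p" if "p \<in> set_fm (fnil 0) \<union> set_fm (fcon 2 (Suc 0) 0) \<union> set_fm \<alpha>" for p
      using that symb_idx over(1,4) \<alpha> unfolding sentence_def by blast
  qed
  have quote: "quote t = fden t" for t by (induction t) simp_all
  have vars: "pvars p \<subseteq> {..<6}" if "(h, bs) \<in> set prog" "p \<in> insert h (set bs)" for h bs p
    using prog_shape that by blast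
  \<comment> \<open>The free variable 0 of \<Phi> stands for the code to be diagonalised. Below the
    quantifier it has index 1, hence the shift of the pattern by 1.\<close>
  define \<Phi> where "\<Phi> = conjs [fhorn prog 6, \<chi>, Ex (And (fholds 0) (fpat (Diag v0) 1 0))]"
  define g where "g = enc idx \<Phi>"
  define \<gamma> where "\<gamma> = Ex (And \<Phi> (fden g))"
  have \<Phi>: "fm_over S \<Phi>" using \<chi> by (simp add: \<Phi>_def over sentence_def)
  have diag: "drv (peval (\<lambda>_. g) (Diag v0)) \<longleftrightarrow> {\<gamma>} \<turnstile> \<alpha>"
    using derivable_diag_iff[of \<Phi>] symb_idx[OF \<Phi>] by (simp add: \<gamma>_def g_def quote)
  have sent: "sentence S \<gamma>"
  proof -
    have "bounded 1 \<chi>" using \<chi> bounded_mono[of 0 \<chi> 1] by (simp add: sentence_def bounded_0)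
    moreover have "bounded (Suc (Suc 0)) (fpat (Diag v0) 1 0)" by (rule bounded_fpat) simp_all
    moreover have "bounded 1 (fhorn prog 6)" by (rule bounded_fhorn) (rule vars)
    ultimately have "bounded 1 \<Phi>" unfolding \<Phi>_def by simp
    then have "bounded 0 \<gamma>" by (simp add: \<gamma>_def bounded_fden)
    moreover have "fm_over S \<gamma>" using \<Phi> by (simp add: \<gamma>_def over)
    ultimately show ?thesis unfolding sentence_def bounded_0 by blast
  qed
  have sat_\<gamma>: "sat D I e \<gamma> \<longleftrightarrow> sat D I e \<chi> \<and> horn_model (set prog) 6 D (trees_of D (edges I)) \<and>
      (\<exists>x\<in>D. denotes D (trees_of D (edges I)) g x \<and> (\<exists>y\<in>D. holds (trees_of D (edges I)) y \<and>
        matches D (trees_of D (edges I)) (\<lambda>i. case_nat x e i) (Diag v0) y))"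
    if e: "range e \<subseteq> D" for D :: "nat set" and I e
  proof -
    have "range (case_nat x e) \<subseteq> D" if "x \<in> D" for x
      using e that by (auto split: nat.split simp: range_subsetD)
    then have "sat D I (case_nat x e) (fhorn prog 6) \<longleftrightarrow> horn_model (set prog) 6 D (trees_of D (edges I))"
      if "x \<in> D" for x
      using sat_fhorn[of "case_nat x e" D prog 6 I] vars that by blast
    moreover have "sat D I (case_nat x e) \<chi> \<longleftrightarrow> sat D I e \<chi>" for x by (rule sat_sentence[OF \<chi>])
    moreover have "sat D I (case_nat y (case_nat x e)) (fpat (Diag v0) 1 0) \<longleftrightarrow>
        matches D (trees_of D (edges I)) (\<lambda>i. case_nat x e i) (Diag v0) y" if "y \<in> D" for x y
      using sat_fpat[of "case_nat y (case_nat x e)" 0 D I "Diag v0" 1] that by simp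
    ultimately show ?thesis unfolding \<gamma>_def \<Phi>_def by (auto simp: sat_tree_atoms sat_fden)
  qed
  have "self_refuting S \<chi> \<alpha> \<gamma>"
    unfolding self_refuting_def
  proof (intro conjI allI impI sent)
    fix D :: "nat set" and I e assume "range e \<subseteq> D" "sat D I e \<gamma>"
    then show "sat D I e \<chi>" using sat_\<gamma> by blast
  next
    fix D :: "nat set" and I e assume e: "range e \<subseteq> D" and "sat D I e \<gamma>" and unprovable: "\<not> {\<gamma>} \<turnstile> \<alpha>"
    let ?T = "trees_of D (edges I)"
    obtain x y where model: "horn_model (set prog) 6 D ?T" and xy: "x \<in> D" "y \<in> D" "denotes D ?T g x"
      "holds ?T y" "matches D ?T (\<lambda>i. case_nat x e i) (Diag v0) y"
      using \<open>sat D I e \<gamma>\<close> sat_\<gamma>[OF e] by blast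
    have "infinite {x\<in>D. node D ?T x}"
    proof
      assume "finite {x\<in>D. node D ?T x}"
      from horn_model_sound[OF model this] obtain val where
        val: "\<And>x t. x \<in> D \<Longrightarrow> denotes D ?T t x \<Longrightarrow> val x = t"
        "\<And>\<theta> p x. x \<in> D \<Longrightarrow> matches D ?T \<theta> p x \<Longrightarrow> val x = peval (val \<circ> \<theta>) p"
        "\<And>x. x \<in> D \<Longrightarrow> holds ?T x \<Longrightarrow> drv (val x)" by blast
      have "val x = g" "val y = peval (val \<circ> (\<lambda>i. case_nat x e i)) (Diag v0)" "drv (val y)"
        using val xy by blast+
      then have "drv (peval (\<lambda>_. g) (Diag v0))" by simp
      then show False using diag unprovable by simp
    qed
    then show "infinite {x\<in>D. node D ?T x}" .
    show "\<exists>P k. horn_model P k D ?T" using model by blast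
  next
    assume "{\<gamma>} \<turnstile> \<alpha>"
    then have drv: "drv (peval (\<lambda>_. g) (Diag v0))" using diag by simp
    have shape: "\<exists>p1 p2. p = PNode p1 p2" if "(h, bs) \<in> set prog" "p \<in> insert h (set bs)" for h bs p
      using prog_shape that by blast
    \<comment> \<open>With \<open>tnat g\<close> below \<open>b\<close>, the element described by
      \<open>fden g\<close> can be the very element that \<open>v0\<close> is assigned to.\<close>
    have "\<exists>b fs. tnat g < b \<and> peval (\<lambda>_. g) (Diag v0) \<in> set fs \<and> (\<forall>f\<in>set fs. tnat f < b) \<and>
        (\<forall>D. {..<b + length fs} \<subseteq> D \<longrightarrow> horn_model (set prog) 6 D (fact_trees b fs))"
      by (rule horn_model_complete[OF drv]) (rule shape)
    then obtain b fs where b: "tnat g < b" "peval (\<lambda>_. g) (Diag v0) \<in> set fs" "\<forall>f\<in>set fs. tnat f < b"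
      and model: "\<And>D. {..<b + length fs} \<subseteq> D \<Longrightarrow> horn_model (set prog) 6 D (fact_trees b fs)"
      by blast
    have "sat D I e \<gamma>"
      if e: "range e \<subseteq> D" and D: "{..<b + length fs} \<subseteq> D" and T: "trees_of D (edges I) = fact_trees b fs"
        and "sat D I e \<chi>" for D :: "nat set" and I e
    proof -
      obtain i where i: "i < length fs" "fs ! i = peval (\<lambda>_. g) (Diag v0)"
        using b(2) by (metis in_set_conv_nth)
      have "denotes D (fact_trees b fs) g (tnat g)"
        using denotes_fact_trees[OF D b(3), of "tnat g"] b(1) by (simp add: fact_val_def)
      moreover have "matches D (fact_trees b fs) (tnat \<circ> (\<lambda>_. g)) (Diag v0) (b + i)"
        by (rule matches_fact_trees[OF D b(3)]) (use i in \<open>simp_all add: fact_val_def pFact_def del: peval_simps(6)\<close>)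
      then have "matches D (fact_trees b fs) (\<lambda>j. case_nat (tnat g) e j) (Diag v0) (b + i)"
        by (subst matches_cong[of _ _ "tnat \<circ> (\<lambda>_. g)"]) simp_all
      moreover have "holds (fact_trees b fs) (b + i)" using i by (simp add: fact_trees_def)
      moreover have "tnat g \<in> D" "b + i \<in> D" using b(1) i(1) D by auto
      ultimately show ?thesis
        unfolding sat_\<gamma>[OF e] T using model[OF D] \<open>sat D I e \<chi>\<close> by blast
    qed
    then show "\<exists>b fs. (\<forall>f\<in>set fs. tnat f < b) \<and> (\<forall>(D :: nat set) I e. range e \<subseteq> D \<longrightarrow> {..<b + length fs} \<subseteq> D \<longrightarrow>
      trees_of D (edges I) = fact_trees b fs \<longrightarrow> sat D I e \<chi> \<longrightarrow> sat D I e \<gamma>)"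
      using b(3) by (intro exI[of _ b] exI[of _ fs]) auto
  qed
  then show ?thesis ..
qed

end

section \<open>Back-and-forth games\<close>

primrec qrank :: "'p fm \<Rightarrow> nat" where
  "qrank (Pred p xs) = 0"
| "qrank (Eq x y) = 0"
| "qrank Bot = 0"
| "qrank (Imp \<phi> \<psi>) = max (qrank \<phi>) (qrank \<psi>)"
| "qrank (Forall \<phi>) = Suc (qrank \<phi>)"

definition partial_iso :: "'p signature \<Rightarrow> ('p \<Rightarrow> 'a list \<Rightarrow> bool) \<Rightarrow> ('p \<Rightarrow> 'b list \<Rightarrow> bool) \<Rightarrow> ('a \<times> 'b) set \<Rightarrow> bool" where
  "partial_iso S I J Z \<longleftrightarrow> (\<forall>x y x' y'. (x, y) \<in> Z \<longrightarrow> (x', y') \<in> Z \<longrightarrow> (x = x' \<longleftrightarrow> y = y')) \<and>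
     (\<forall>p xs ys. S p = Some (length xs) \<longrightarrow> list_all2 (\<lambda>x y. (x, y) \<in> Z) xs ys \<longrightarrow> (I p xs \<longleftrightarrow> J p ys))"

text \<open>A formula of rank \<open>n\<close> asks for at most \<open>n\<close> moves, and
  \<open>\<Z> n\<close> holds positions with \<open>n\<close> moves in reserve. The families are
  left general so as to cover a single isomorphism, as a constant family, as well as the coded
  games.\<close>

lemma back_and_forth:
  assumes iso: "\<And>n Z. Z \<in> \<Z> n \<Longrightarrow> partial_iso S I J Z"
    and forth: "\<And>n Z x. Z \<in> \<Z> (Suc n) \<Longrightarrow> x \<in> D \<Longrightarrow> \<exists>Z'\<in>\<Z> n. Z \<subseteq> Z' \<and> (\<exists>y\<in>D'. (x, y) \<in> Z')"
    and backward: "\<And>n Z y. Z \<in> \<Z> (Suc n) \<Longrightarrow> y \<in> D' \<Longrightarrow> \<exists>Z'\<in>\<Z> n. Z \<subseteq> Z' \<and> (\<exists>x\<in>D. (x, y) \<in> Z')"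
  shows "fm_over S \<phi> \<Longrightarrow> qrank \<phi> \<le> n \<Longrightarrow> Z \<in> \<Z> n \<Longrightarrow> (\<And>i. i \<in> free_vars \<phi> \<Longrightarrow> (e i, f i) \<in> Z) \<Longrightarrow>
    sat D I e \<phi> \<longleftrightarrow> sat D' J f \<phi>"
proof (induction \<phi> arbitrary: n Z e f)
  case (Pred p xs)
  have "list_all2 (\<lambda>x y. (x, y) \<in> Z) (map e xs) (map f xs)"
    using Pred by (simp add: list_all2_conv_all_nth)
  then show ?case using iso[OF Pred(3)] Pred(1) by (simp add: partial_iso_def)
next
  case (Eq x y)
  then show ?case using iso[OF Eq(3)] by (auto simp: partial_iso_def)
next
  case (Imp \<phi> \<psi>)
  have "sat D I e \<phi> \<longleftrightarrow> sat D' J f \<phi>" "sat D I e \<psi> \<longleftrightarrow> sat D' J f \<psi>"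
    using Imp.IH(1)[of n Z e f] Imp.IH(2)[of n Z e f] Imp.prems by simp_all
  then show ?case by simp
next
  case (Forall \<phi>)
  then obtain n' where n: "n = Suc n'" "qrank \<phi> \<le> n'" by (cases n) auto
  have step: "sat D I (case_nat x e) \<phi> \<longleftrightarrow> sat D' J (case_nat y f) \<phi>"
    if "Z' \<in> \<Z> n'" "Z \<subseteq> Z'" "(x, y) \<in> Z'" for Z' x y
    by (rule Forall.IH[OF _ n(2) that(1)]) (use that Forall.prems in \<open>auto split: nat.split\<close>)
  have f: "\<exists>y\<in>D'. sat D I (case_nat x e) \<phi> \<longleftrightarrow> sat D' J (case_nat y f) \<phi>" if "x \<in> D" for x
    using forth[of Z n' x] that Forall.prems(3) n(1) step by blast
  have b: "\<exists>x\<in>D. sat D I (case_nat x e) \<phi> \<longleftrightarrow> sat D' J (case_nat y f) \<phi>" if "y \<in> D'" for y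
    using backward[of Z n' y] that Forall.prems(3) n(1) step by blast
  show ?case unfolding sat.simps using f b by blast
qed simp

lemma isomorphic_sat:
  assumes iso: "partial_iso S I J Z" and Z: "\<And>x. x \<in> D \<Longrightarrow> \<exists>y\<in>D'. (x, y) \<in> Z" "\<And>y. y \<in> D' \<Longrightarrow> \<exists>x\<in>D. (x, y) \<in> Z"
    and \<phi>: "sentence S \<phi>"
  shows "sat D I e \<phi> \<longleftrightarrow> sat D' J f \<phi>"
  by (rule back_and_forth[where \<Z> = "\<lambda>_. {Z}" and n = "qrank \<phi>" and Z = Z and S = S])
    (use assms in \<open>auto simp: sentence_def\<close>)

lemma transport:
  assumes h: "bij_betw h D D'"
  shows "\<exists>J. \<forall>\<phi> e f. sentence S \<phi> \<longrightarrow> (sat D I e \<phi> \<longleftrightarrow> sat D' J f \<phi>)"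
proof -
  let ?J = "\<lambda>p ys. I p (map (inv_into D h) ys)"
  have "partial_iso S I ?J {(x, h x) | x. x \<in> D}"
    unfolding partial_iso_def
  proof (intro conjI allI impI)
    fix x y x' y' assume "(x, y) \<in> {(x, h x) |x. x \<in> D}" "(x', y') \<in> {(x, h x) |x. x \<in> D}"
    then show "x = x' \<longleftrightarrow> y = y'" using h by (auto simp: bij_betw_def inj_on_def)
  next
    fix p xs ys assume "list_all2 (\<lambda>x y. (x, y) \<in> {(x, h x) |x. x \<in> D}) xs ys"
    then have "map (inv_into D h) ys = xs"
      using h by (induction rule: list_all2_induct) (auto simp: bij_betw_def)
    then show "I p xs \<longleftrightarrow> I p (map (inv_into D h) ys)" by simp
  qed
  then have "sat D I e \<phi> \<longleftrightarrow> sat D' ?J f \<phi>" if "sentence S \<phi>" for \<phi> e f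
    by (rule isomorphic_sat) (use h that in \<open>auto simp: bij_betw_def\<close>)
  then show ?thesis by blast
qed

section \<open>Ehrenfeucht-Fraisse games and Hintikka formulas\<close>

definition atoms :: "'p signature \<Rightarrow> nat \<Rightarrow> 'p fm set" where
  "atoms S k = {Eq i j | i j. i < k \<and> j < k} \<union> {Pred p xs | p xs. S p = Some (length xs) \<and> set xs \<subseteq> {..<k}}"

lemma finite_atoms: "finite (dom S) \<Longrightarrow> finite (atoms S k)"
proof -
  assume "finite (dom S)"
  have "finite ((\<lambda>(i, j). Eq i j :: 'a fm) ` ({..<k} \<times> {..<k}))" by simp
  then have "finite {Eq i j :: 'a fm | i j. i < k \<and> j < k}" by (rule rev_finite_subset) auto
  moreover have "finite (\<Union>p\<in>dom S. Pred p ` {xs. set xs \<subseteq> {..<k} \<and> length xs = the (S p)})"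
    using \<open>finite (dom S)\<close> by (auto intro: finite_lists_length_eq)
  then have "finite {Pred p xs | p xs. S p = Some (length xs) \<and> set xs \<subseteq> {..<k}}"
    by (rule rev_finite_subset) force
  ultimately show ?thesis by (simp add: atoms_def)
qed

text \<open>\<open>k\<close> variables are already in play and \<open>n\<close> moves are to come;
  atoms are compared only at the end.\<close>

primrec ef_equiv :: "'p signature \<Rightarrow> nat \<Rightarrow> nat \<Rightarrow> 'a set \<Rightarrow> ('p \<Rightarrow> 'a list \<Rightarrow> bool) \<Rightarrow> (nat \<Rightarrow> 'a) \<Rightarrow>
    'b set \<Rightarrow> ('p \<Rightarrow> 'b list \<Rightarrow> bool) \<Rightarrow> (nat \<Rightarrow> 'b) \<Rightarrow> bool" where
  "ef_equiv S 0 k D I e D' J f \<longleftrightarrow> (\<forall>a\<in>atoms S k. sat D I e a \<longleftrightarrow> sat D' J f a)"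
| "ef_equiv S (Suc n) k D I e D' J f \<longleftrightarrow>
     (\<forall>x\<in>D. \<exists>y\<in>D'. ef_equiv S n (Suc k) D I (case_nat x e) D' J (case_nat y f)) \<and>
     (\<forall>y\<in>D'. \<exists>x\<in>D. ef_equiv S n (Suc k) D I (case_nat x e) D' J (case_nat y f))"

text \<open>Each formula describes a complete type: at rank 0 by a sign for every atom, at rank
  \<open>Suc n\<close> by the set of rank \<open>n\<close> types that one further element realises.
  Lists and \<open>subseqs\<close> make the number of types finite by construction.\<close>

primrec hintikka :: "'p signature \<Rightarrow> nat \<Rightarrow> nat \<Rightarrow> 'p fm list" where
  "hintikka S 0 k = (let as = (SOME as. set as = atoms S k) in
     map (\<lambda>X. conjs (map (\<lambda>a. if a \<in> set X then a else Neg a) as)) (subseqs as))"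
| "hintikka S (Suc n) k =
     map (\<lambda>X. And (conjs (map Ex X)) (Forall (disjs X))) (subseqs (hintikka S n (Suc k)))"

lemma subseqs_Collect: "\<exists>ys\<in>set (subseqs xs). set ys = {x\<in>set xs. P x}"
proof -
  have "{x\<in>set xs. P x} \<in> Pow (set xs)" by auto
  then show ?thesis unfolding subseqs_powset[symmetric] by force
qed

lemma sat_literals: "\<exists>X\<in>set (subseqs \<phi>s). sat D I e (conjs (map (\<lambda>a. if a \<in> set X then a else Neg a) \<phi>s))"
proof -
  obtain X where X: "X \<in> set (subseqs \<phi>s)" "set X = {a\<in>set \<phi>s. sat D I e a}"
    using subseqs_Collect[of \<phi>s "\<lambda>a. sat D I e a"] by (elim bexE) (rule that)
  have "sat D I e (if a \<in> set X then a else Neg a)" if "a \<in> set \<phi>s" for a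
    using that by (cases "a \<in> set X") (simp_all add: X(2))
  then have "sat D I e (conjs (map (\<lambda>a. if a \<in> set X then a else Neg a) \<phi>s))"
    unfolding sat_conjs set_map by (intro ballI) (erule imageE, simp only:)
  then show ?thesis using X(1) by blast
qed

lemma subseqs_subset: "ys \<in> set (subseqs xs) \<Longrightarrow> set ys \<subseteq> set xs"
  using subseqs_powset[of xs] by blast

context
  fixes S :: "'p signature"
  assumes finite_sig: "finite (dom S)"
begin

lemma atoms_list: "set (SOME as. set as = atoms S k) = atoms S k"
  by (rule someI_ex) (rule finite_list[OF finite_atoms[OF finite_sig]])

lemma hintikka_exists: "range e \<subseteq> D \<Longrightarrow> \<exists>H\<in>set (hintikka S n k). sat D I e H"
proof (induction n arbitrary: k e)
  case 0
  show ?case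
    using sat_literals[of "SOME as. set as = atoms S k" D I e] by (simp add: Let_def)
next
  case (Suc n)
  obtain X where X: "X \<in> set (subseqs (hintikka S n (Suc k)))"
      "set X = {H\<in>set (hintikka S n (Suc k)). sat D I e (Ex H)}"
    using subseqs_Collect[of "hintikka S n (Suc k)" "\<lambda>H. sat D I e (Ex H)"] by (elim bexE) (rule that)
  have "sat D I e (Forall (disjs X))"
    unfolding sat.simps sat_disjs
  proof
    fix d assume d: "d \<in> D"
    then have "range (case_nat d e) \<subseteq> D" using Suc.prems by (auto split: nat.split simp: range_subsetD)
    then obtain H where "H \<in> set (hintikka S n (Suc k))" "sat D I (case_nat d e) H" using Suc.IH by blast
    moreover from this have "H \<in> set X" using d by (auto simp: X(2))
    ultimately show "\<exists>H\<in>set X. sat D I (case_nat d e) H" by blast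
  qed
  moreover have "sat D I e (conjs (map Ex X))" using X(2) by (simp del: sat_connectives)
  ultimately have "sat D I e (And (conjs (map Ex X)) (Forall (disjs X)))" by (simp only: sat_connectives)
  moreover have "And (conjs (map Ex X)) (Forall (disjs X)) \<in> set (hintikka S (Suc n) k)"
    unfolding hintikka.simps set_map using X(1) by (rule imageI)
  ultimately show ?case by (rule rev_bexI[rotated])
qed

lemma hintikka_ef_equiv:
  "H \<in> set (hintikka S n k) \<Longrightarrow> sat D I e H \<Longrightarrow> sat D' J f H \<Longrightarrow> ef_equiv S n k D I e D' J f"
proof (induction n arbitrary: k e f H)
  case 0
  define as where "as = (SOME as. set as = atoms S k)"
  obtain X where X: "H = conjs (map (\<lambda>a. if a \<in> set X then a else Neg a) as)"
    using 0(1) by (auto simp: Let_def simp flip: as_def)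
  have "sat D I e a \<longleftrightarrow> sat D' J f a" if "a \<in> set as" for a
  proof -
    have "(if a \<in> set X then a else Neg a) \<in> set (map (\<lambda>a. if a \<in> set X then a else Neg a) as)"
      using that by auto
    then have "sat D I e (if a \<in> set X then a else Neg a)" "sat D' J f (if a \<in> set X then a else Neg a)"
      using 0(2,3) unfolding X sat_conjs by blast+
    then show ?thesis by (auto split: if_splits)
  qed
  then show ?case using atoms_list[of k] by (simp flip: as_def)
next
  case (Suc n)
  then obtain X where X: "X \<in> set (subseqs (hintikka S n (Suc k)))"
    "H = And (conjs (map Ex X)) (Forall (disjs X))" by auto
  then have sub: "set X \<subseteq> set (hintikka S n (Suc k))" by (simp add: subseqs_subset)
  have 1: "\<exists>d\<in>D. sat D I (case_nat d e) G" "\<exists>d\<in>D'. sat D' J (case_nat d f) G" if "G \<in> set X" for G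
    using Suc.prems(2,3) that by (auto simp: X(2))
  have 2: "d \<in> D \<Longrightarrow> \<exists>G\<in>set X. sat D I (case_nat d e) G" "d' \<in> D' \<Longrightarrow> \<exists>G\<in>set X. sat D' J (case_nat d' f) G" for d d'
    using Suc.prems(2,3) by (auto simp: X(2))
  have step: "ef_equiv S n (Suc k) D I (case_nat d e) D' J (case_nat d' f)"
    if "G \<in> set X" "sat D I (case_nat d e) G" "sat D' J (case_nat d' f) G" for d d' G
    by (rule Suc.IH[OF _ that(2,3)]) (use sub that(1) in blast)
  show ?case unfolding ef_equiv.simps
  proof (intro conjI ballI)
    fix d assume "d \<in> D"
    then obtain G where "G \<in> set X" "sat D I (case_nat d e) G" using 2(1) by blast
    then show "\<exists>d'\<in>D'. ef_equiv S n (Suc k) D I (case_nat d e) D' J (case_nat d' f)"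
      using 1(2) step by blast
  next
    fix d' assume "d' \<in> D'"
    then obtain G where "G \<in> set X" "sat D' J (case_nat d' f) G" using 2(2) by blast
    then show "\<exists>d\<in>D. ef_equiv S n (Suc k) D I (case_nat d e) D' J (case_nat d' f)"
      using 1(1) step by blast
  qed
qed

lemma hintikka_formula: "H \<in> set (hintikka S n k) \<Longrightarrow> fm_over S H \<and> bounded k H"
proof (induction n arbitrary: k H)
  case 0
  have "fm_over S a \<and> bounded k a" if "a \<in> atoms S k" for a using that by (auto simp: atoms_def)
  then show ?case using 0 atoms_list[of k] by (auto simp: Let_def)
next
  case (Suc n)
  then obtain X where X: "X \<in> set (subseqs (hintikka S n (Suc k)))"
    "H = And (conjs (map Ex X)) (Forall (disjs X))" by auto
  then have sub: "set X \<subseteq> set (hintikka S n (Suc k))" by (simp add: subseqs_subset)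
  then show ?case using Suc.IH by (auto simp: X(2))
qed

text \<open>The sentence is the disjunction of the finitely many Hintikka sentences that occur in
  models of \<open>\<alpha>\<close>. It is a consequence of \<open>\<alpha>\<close> in the smaller
  signature, and \<open>n\<close> moves cannot tell its models from models of
  \<open>\<alpha>\<close>.\<close>

lemma ef_type_sentence:
  "\<exists>\<sigma>. sentence S \<sigma> \<and> entails \<alpha> \<sigma> \<and> (\<forall>(D :: nat set) I e. range e \<subseteq> D \<longrightarrow> sat D I e \<sigma> \<longrightarrow>
    (\<exists>(D' :: nat set) J f. range f \<subseteq> D' \<and> sat D' J f \<alpha> \<and> ef_equiv S n 0 D I e D' J f))"
proof -
  let ?\<sigma> = "disjs (filter (\<lambda>H. \<exists>(D' :: nat set) J f. range f \<subseteq> D' \<and> sat D' J f \<alpha> \<and> sat D' J f H) (hintikka S n 0))"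
  have "sentence S ?\<sigma>" using hintikka_formula[of _ n 0] by (auto simp: sentence_def simp flip: bounded_0)
  moreover have "entails \<alpha> ?\<sigma>"
    unfolding entails_def sat_disjs
  proof (intro allI impI)
    fix D :: "nat set" and I e assume e: "range e \<subseteq> D" "sat D I e \<alpha>"
    obtain H where H: "H \<in> set (hintikka S n 0)" "sat D I e H" using hintikka_exists[OF e(1)] by blast
    show "\<exists>H\<in>set (filter (\<lambda>H. \<exists>(D' :: nat set) J f. range f \<subseteq> D' \<and> sat D' J f \<alpha> \<and> sat D' J f H) (hintikka S n 0)). sat D I e H"
    proof (rule bexI[of _ H])
      show "H \<in> set (filter (\<lambda>H. \<exists>(D' :: nat set) J f. range f \<subseteq> D' \<and> sat D' J f \<alpha> \<and> sat D' J f H) (hintikka S n 0))"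
        unfolding set_filter using H e by blast
    qed (rule H(2))
  qed
  moreover have "\<exists>(D' :: nat set) J f. range f \<subseteq> D' \<and> sat D' J f \<alpha> \<and> ef_equiv S n 0 D I e D' J f"
    if \<sigma>: "sat D I e ?\<sigma>" for D :: "nat set" and I e
  proof -
    obtain H where H: "H \<in> set (hintikka S n 0)" "sat D I e H"
      "\<exists>(D' :: nat set) J f. range f \<subseteq> D' \<and> sat D' J f \<alpha> \<and> sat D' J f H"
      using \<sigma> unfolding sat_disjs set_filter by blast
    then obtain D' :: "nat set" and J f where "range f \<subseteq> D'" "sat D' J f \<alpha>" "sat D' J f H" by blast
    then show ?thesis using hintikka_ef_equiv[OF H(1,2)] by blast
  qed
  ultimately show ?thesis by blast
qed

end

text \<open>A surplus move is spent on an arbitrary element, hence the nonempty domain, and the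
  variable it adds is skipped by renaming with \<open>Suc\<close>.\<close>

lemma ef_equiv_Suc: "ef_equiv S (Suc n) k D I e D' J f \<Longrightarrow> D \<noteq> {} \<Longrightarrow> ef_equiv S n k D I e D' J f"
proof (induction n arbitrary: k e f)
  case 0
  obtain x where "x \<in> D" using 0(2) by blast
  with 0(1) obtain y where xy:
    "\<forall>a\<in>atoms S (Suc k). sat D I (case_nat x e) a \<longleftrightarrow> sat D' J (case_nat y f) a"
    by (auto simp only: ef_equiv.simps)
  show ?case unfolding ef_equiv.simps
  proof
    fix a assume "a \<in> atoms S k"
    then have "rename Suc a \<in> atoms S (Suc k)" by (auto simp: atoms_def)
    moreover have "case_nat x e \<circ> Suc = e" "case_nat y f \<circ> Suc = f" by auto
    ultimately show "sat D I e a \<longleftrightarrow> sat D' J f a"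
      using bspec[OF xy, of "rename Suc a"] by (simp only: sat_rename)
  qed
next
  case (Suc n)
  note ef = Suc.prems(1)[unfolded ef_equiv.simps(2)[of S "Suc n"]]
  show ?case unfolding ef_equiv.simps(2)
  proof (intro conjI ballI)
    fix x assume "x \<in> D"
    then show "\<exists>y\<in>D'. ef_equiv S n (Suc k) D I (case_nat x e) D' J (case_nat y f)"
      using Suc.IH[OF _ Suc.prems(2)] ef by blast
  next
    fix y assume "y \<in> D'"
    then show "\<exists>x\<in>D. ef_equiv S n (Suc k) D I (case_nat x e) D' J (case_nat y f)"
      using Suc.IH[OF _ Suc.prems(2)] ef by blast
  qed
qed

lemma ef_equiv_mono: "ef_equiv S n k D I e D' J f \<Longrightarrow> m \<le> n \<Longrightarrow> D \<noteq> {} \<Longrightarrow> ef_equiv S m k D I e D' J f"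
proof (induction n)
  case (Suc n)
  show ?case
  proof (cases "m = Suc n")
    case True
    then show ?thesis using Suc.prems(1) by (simp only:)
  next
    case False
    then show ?thesis using Suc.IH ef_equiv_Suc[OF Suc.prems(1,3)] Suc.prems by simp
  qed
qed simp

section \<open>Positions of a play as lists of pairs\<close>

definition ef_position :: "'p signature \<Rightarrow> 'a set \<Rightarrow> ('p \<Rightarrow> 'a list \<Rightarrow> bool) \<Rightarrow> (nat \<Rightarrow> 'a) \<Rightarrow>
    'b set \<Rightarrow> ('p \<Rightarrow> 'b list \<Rightarrow> bool) \<Rightarrow> (nat \<Rightarrow> 'b) \<Rightarrow> nat \<Rightarrow> ('a \<times> 'b) list \<Rightarrow> bool" where
  "ef_position S D I e D' J f n ps \<longleftrightarrow> set ps \<subseteq> D \<times> D' \<and>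
     ef_equiv S n (length ps) D I (env (map fst ps) e) D' J (env (map snd ps) f)"

lemma ef_position_mono:
  "ef_position S D I e D' J f n ps \<Longrightarrow> m \<le> n \<Longrightarrow> D \<noteq> {} \<Longrightarrow> ef_position S D I e D' J f m ps"
  by (auto simp: ef_position_def intro: ef_equiv_mono)

lemma ef_position_forth:
  "ef_position S D I e D' J f (Suc n) ps \<Longrightarrow> x \<in> D \<Longrightarrow> \<exists>y\<in>D'. ef_position S D I e D' J f n ((x, y) # ps)"
  by (auto simp: ef_position_def)

lemma ef_position_back:
  "ef_position S D I e D' J f (Suc n) ps \<Longrightarrow> y \<in> D' \<Longrightarrow> \<exists>x\<in>D. ef_position S D I e D' J f n ((x, y) # ps)"
  by (auto simp: ef_position_def)

lemma ef_position_partial_iso: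
  assumes "ef_position S D I e D' J f n ps" "D \<noteq> {}"
  shows "partial_iso S I J (set ps)"
proof -
  let ?e = "env (map fst ps) e" and ?f = "env (map snd ps) f"
  have atoms: "sat D I ?e a \<longleftrightarrow> sat D' J ?f a" if "a \<in> atoms S (length ps)" for a
    using ef_position_mono[OF assms(1) le0 assms(2)] that by (simp add: ef_position_def)
  have idx: "\<exists>i<length ps. ?e i = x \<and> ?f i = y" if xy: "(x, y) \<in> set ps" for x y
  proof -
    obtain i where "i < length ps" "ps ! i = (x, y)" using xy by (auto simp: in_set_conv_nth)
    then show ?thesis by (intro exI[of _ i]) (simp add: env_nth)
  qed
  show ?thesis unfolding partial_iso_def
  proof (intro conjI allI impI)
    fix x y x' y' assume xy: "(x, y) \<in> set ps" "(x', y') \<in> set ps"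
    obtain i where "i < length ps" "?e i = x" "?f i = y" using idx[OF xy(1)] by blast
    moreover obtain j where "j < length ps" "?e j = x'" "?f j = y'" using idx[OF xy(2)] by blast
    ultimately show "x = x' \<longleftrightarrow> y = y'" using atoms[of "Eq i j"] by (auto simp: atoms_def)
  next
    fix p xs ys assume p: "S p = Some (length xs)" and xy: "list_all2 (\<lambda>x y. (x, y) \<in> set ps) xs ys"
    from xy have "\<exists>is. set is \<subseteq> {..<length ps} \<and> map ?e is = xs \<and> map ?f is = ys"
    proof (induction rule: list_all2_induct)
      case (Cons x xs y ys)
      obtain "is" where "set is \<subseteq> {..<length ps}" "map ?e is = xs" "map ?f is = ys" using Cons.IH by blast
      moreover obtain i where "i < length ps" "?e i = x" "?f i = y" using idx[OF Cons.hyps(1)] by blast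
      ultimately show ?case by (intro exI[of _ "i # is"]) auto
    qed simp
    then obtain "is" where "set is \<subseteq> {..<length ps}" "map ?e is = xs" "map ?f is = ys" by blast
    then show "I p xs \<longleftrightarrow> J p ys" using atoms[of "Pred p is"] p by (auto simp: atoms_def)
  qed
qed

text \<open>All elements of \<open>D\<close> can be played in \<open>n\<close> moves. The one move
  that is left shows that \<open>D'\<close> contains nothing further, so the position is an
  isomorphism.\<close>

lemma ef_equiv_small:
  assumes D: "finite D" "card D \<le> n" "D \<noteq> {}" and ef: "ef_equiv S (Suc n) 0 D I e D' J f" and "sentence S \<phi>"
  shows "sat D I e \<phi> \<longleftrightarrow> sat D' J f \<phi>"
proof -
  have start: "ef_position S D I e D' J f (Suc n) []" using ef by (simp add: ef_position_def)
  have "\<exists>ps. ef_position S D I e D' J f (Suc n - card X) ps \<and> X \<subseteq> fst ` set ps" if "X \<subseteq> D" for X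
    using finite_subset[OF that D(1)] that
  proof (induction rule: finite_induct)
    case empty
    then show ?case using start by auto
  next
    case (insert x X)
    then obtain ps where ps: "ef_position S D I e D' J f (Suc n - card X) ps" "X \<subseteq> fst ` set ps" by auto
    have "card (insert x X) \<le> card D" using insert.prems D(1) by (rule card_mono[rotated])
    then have "Suc n - card X = Suc (Suc n - card (insert x X))" using insert.hyps D(2) by simp
    then obtain y where "ef_position S D I e D' J f (Suc n - card (insert x X)) ((x, y) # ps)"
      using ef_position_forth[of S D I e D' J f _ ps x] ps(1) insert.prems by auto
    then show ?case using ps(2) by (intro exI[of _ "(x, y) # ps"]) auto
  qed
  from this[of D] obtain ps where "ef_position S D I e D' J f (Suc n - card D) ps" and cov: "D \<subseteq> fst ` set ps"
    by auto
  then have pos: "ef_position S D I e D' J f (Suc 0) ps"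
    using ef_position_mono D(2,3) by (metis Suc_diff_le Suc_le_mono le0)
  have iso: "partial_iso S I J (set ps)" by (rule ef_position_partial_iso[OF pos D(3)])
  have sub: "set ps \<subseteq> D \<times> D'" using pos by (simp add: ef_position_def)
  show ?thesis
  proof (rule isomorphic_sat[OF iso _ _ \<open>sentence S \<phi>\<close>])
    show "\<exists>y\<in>D'. (x, y) \<in> set ps" if "x \<in> D" for x using cov sub that by force
    show "\<exists>x\<in>D. (x, y) \<in> set ps" if y: "y \<in> D'" for y
    proof -
      obtain x where x: "x \<in> D" "ef_position S D I e D' J f 0 ((x, y) # ps)"
        using ef_position_back[OF pos y] by blast
      obtain y' where "(x, y') \<in> set ps" using cov x(1) by force
      then have "y = y'" using ef_position_partial_iso[OF x(2) D(3)] unfolding partial_iso_def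
        by (auto dest!: conjunct1 spec[of _ x])
      then show ?thesis using x(1) \<open>(x, y') \<in> set ps\<close> by blast
    qed
  qed
qed

section \<open>Coded games\<close>

lemma sat_fm_over:
  assumes "fm_over S \<phi>" and "\<And>p xs. S p = Some (length xs) \<Longrightarrow> I p xs \<longleftrightarrow> J p xs"
  shows "sat D I e \<phi> \<longleftrightarrow> sat D J e \<phi>"
  using assms(1) by (induction \<phi> arbitrary: e) (simp_all add: assms(2))

text \<open>
  The graph codes a structure \<open>N\<close> with domain \<open>coded_domain\<close> and positions of a
  back-and-forth game with the given structure, which lead down along the order of the trees.
\<close>

definition coded_domain :: "'d set \<Rightarrow> ('d \<Rightarrow> 'd \<Rightarrow> bool) \<Rightarrow> 'd set" where
  "coded_domain D E = {x\<in>D. reads D E (replicate 7 x)}"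

text \<open>The list length \<open>w p\<close> identifies the symbol. The padding is a quantified
  element rather than a copy of an entry because \<open>xs\<close> may be empty.\<close>

definition coded_interp :: "('p \<Rightarrow> nat) \<Rightarrow> 'd set \<Rightarrow> ('d \<Rightarrow> 'd \<Rightarrow> bool) \<Rightarrow> 'p \<Rightarrow> 'd list \<Rightarrow> bool" where
  "coded_interp w D E p xs \<longleftrightarrow> (\<exists>z\<in>D. reads D E (xs @ replicate (w p - length xs) z))"

definition coded_pos :: "'d set \<Rightarrow> ('d \<Rightarrow> 'd \<Rightarrow> bool) \<Rightarrow> 'd \<Rightarrow> 'd \<Rightarrow> 'd \<Rightarrow> bool" where
  "coded_pos D E q x y \<longleftrightarrow> reads D E [q, x, y, y, y]"

definition coded_level :: "'d set \<Rightarrow> ('d \<Rightarrow> 'd \<Rightarrow> bool) \<Rightarrow> 'd \<Rightarrow> 'd \<Rightarrow> bool" where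
  "coded_level D E q l \<longleftrightarrow> reads D E [q, l, l, l, l, l]"

definition coded_game :: "'p signature \<Rightarrow> 'd set \<Rightarrow> ('p \<Rightarrow> 'd list \<Rightarrow> bool) \<Rightarrow> 'd set \<Rightarrow> ('p \<Rightarrow> 'd list \<Rightarrow> bool) \<Rightarrow>
    'd trees \<Rightarrow> ('d \<Rightarrow> 'd \<Rightarrow> 'd \<Rightarrow> bool) \<Rightarrow> ('d \<Rightarrow> 'd \<Rightarrow> bool) \<Rightarrow> bool" where
  "coded_game S D I D' J T pos lev \<longleftrightarrow>
     (\<forall>l\<in>D. node D T l \<longrightarrow> (\<exists>q\<in>D. lev q l)) \<and>
     (\<forall>q\<in>D. \<forall>l\<in>D. \<forall>l'\<in>D. \<forall>x\<in>D. lev q l \<longrightarrow> lt T l' l \<longrightarrow>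
       (\<exists>q'\<in>D. lev q' l' \<and> (\<forall>u\<in>D. \<forall>v\<in>D. pos q u v \<longrightarrow> pos q' u v) \<and> (\<exists>y\<in>D. y \<in> D' \<and> pos q' x y))) \<and>
     (\<forall>q\<in>D. \<forall>l\<in>D. \<forall>l'\<in>D. \<forall>y\<in>D. lev q l \<longrightarrow> lt T l' l \<longrightarrow> y \<in> D' \<longrightarrow>
       (\<exists>q'\<in>D. lev q' l' \<and> (\<forall>u\<in>D. \<forall>v\<in>D. pos q u v \<longrightarrow> pos q' u v) \<and> (\<exists>x\<in>D. pos q' x y))) \<and>
     (\<forall>q\<in>D. \<forall>l\<in>D. lev q l \<longrightarrow> (\<forall>x\<in>D. \<forall>y\<in>D. \<forall>x'\<in>D. \<forall>y'\<in>D. pos q x y \<longrightarrow> pos q x' y' \<longrightarrow>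
       (x = x' \<longleftrightarrow> y = y'))) \<and>
     (\<forall>p\<in>dom S. \<forall>q\<in>D. \<forall>l\<in>D. lev q l \<longrightarrow> (\<forall>xs ys. length xs = the (S p) \<longrightarrow> length ys = the (S p) \<longrightarrow>
       set xs \<subseteq> D \<longrightarrow> set ys \<subseteq> D \<longrightarrow> (\<forall>i<the (S p). pos q (xs ! i) (ys ! i)) \<longrightarrow> (I p xs \<longleftrightarrow> J p ys)))"

lemma strict_max_exists:
  "finite X \<Longrightarrow> X \<noteq> {} \<Longrightarrow> \<forall>x\<in>X. \<forall>y\<in>X. x = y \<or> R x y \<or> R y x \<Longrightarrow>
    \<forall>x\<in>X. \<forall>y\<in>X. \<forall>z\<in>X. R x y \<longrightarrow> R y z \<longrightarrow> R x z \<Longrightarrow> \<exists>m\<in>X. \<forall>x\<in>X. x \<noteq> m \<longrightarrow> R x m"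
proof (induction rule: finite_ne_induct)
  case (insert x X)
  have "\<forall>x\<in>X. \<forall>y\<in>X. x = y \<or> R x y \<or> R y x" using insert.prems(1) by blast
  moreover have "\<forall>x\<in>X. \<forall>y\<in>X. \<forall>z\<in>X. R x y \<longrightarrow> R y z \<longrightarrow> R x z" using insert.prems(2) by blast
  ultimately have "\<exists>m\<in>X. \<forall>y\<in>X. y \<noteq> m \<longrightarrow> R y m" by (rule insert.IH)
  then obtain m where m: "m \<in> X" "\<forall>y\<in>X. y \<noteq> m \<longrightarrow> R y m" by (elim bexE) (rule that)
  have "x = m \<or> R x m \<or> R m x" using insert.prems(1) m(1) by blast
  then show ?case
  proof (elim disjE)
    assume R: "R m x"
    have "R y x" if "y \<in> X" for y
    proof (cases "y = m")
      case False
      then have "R y m" using m(2) that by blast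
      then show ?thesis using insert.prems(2)[rule_format, of y m x] R that m(1) by simp
    qed (use R in simp)
    then show ?thesis by (intro bexI[of _ x]) simp_all
  next
    assume "x = m"
    then show ?thesis using m by (intro bexI[of _ m]) simp_all
  next
    assume "R x m"
    then show ?thesis using m by (intro bexI[of _ m]) simp_all
  qed
next case (singleton x) show ?case by (rule bexI[of _ x]) simp_all
qed

primrec chain :: "'d set \<Rightarrow> ('d \<Rightarrow> 'd \<Rightarrow> bool) \<Rightarrow> nat \<Rightarrow> 'd \<Rightarrow> bool" where
  "chain D R 0 l \<longleftrightarrow> True"
| "chain D R (Suc n) l \<longleftrightarrow> (\<exists>l'\<in>D. R l' l \<and> chain D R n l')"

text \<open>No infinite descent is needed: any \<open>Suc n\<close> nodes are linearly ordered, and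
  their greatest element has the others below it.\<close>

lemma chain_exists:
  assumes model: "horn_model P k D T" and inf: "infinite {x\<in>D. node D T x}"
  shows "\<exists>l\<in>D. node D T l \<and> chain D (lt T) n l"
proof -
  note model' = model[unfolded horn_model_def]
  have tot: "x = y \<or> lt T x y \<or> lt T y x" if "x \<in> D" "node D T x" "y \<in> D" "node D T y" for x y
    using model' that by blast
  have trans: "lt T x z" if "x \<in> D" "y \<in> D" "z \<in> D" "lt T x y" "lt T y z" for x y z
    using model' that by blast
  have *: "\<exists>l\<in>X. chain D (lt T) n l" if "X \<subseteq> {x\<in>D. node D T x}" "card X = Suc n" for X
    using that
  proof (induction n arbitrary: X)
    case 0
    then have "X \<noteq> {}" by auto
    then show ?case by auto
  next
    case (Suc n)
    have fin: "finite X" using Suc.prems(2) by (intro card_ge_0_finite) simp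
    have "\<exists>m\<in>X. \<forall>x\<in>X. x \<noteq> m \<longrightarrow> lt T x m"
    proof (rule strict_max_exists[OF fin])
      show "X \<noteq> {}" using Suc.prems(2) by auto
      show "\<forall>x\<in>X. \<forall>y\<in>X. x = y \<or> lt T x y \<or> lt T y x"
        using tot Suc.prems(1) by (simp add: subset_iff)
      show "\<forall>x\<in>X. \<forall>y\<in>X. \<forall>z\<in>X. lt T x y \<longrightarrow> lt T y z \<longrightarrow> lt T x z"
      proof (intro ballI impI)
        fix x y z assume "x \<in> X" "y \<in> X" "z \<in> X" "lt T x y" "lt T y z"
        then show "lt T x z" using trans[of x y z] Suc.prems(1) by (simp add: subset_iff)
      qed
    qed
    then obtain m where m: "m \<in> X" "\<forall>x\<in>X. x \<noteq> m \<longrightarrow> lt T x m" by blast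
    have "card (X - {m}) = Suc n" using m(1) Suc.prems(2) fin by simp
    then obtain l where l: "l \<in> X - {m}" "chain D (lt T) n l" using Suc.IH[of "X - {m}"] Suc.prems(1) by blast
    then have "l \<in> D" "lt T l m" using m(2) Suc.prems(1) by auto
    then show ?case using l(2) m(1) by (intro bexI[of _ m]) auto
  qed
  obtain X where X: "X \<subseteq> {x\<in>D. node D T x}" "card X = Suc n"
    using infinite_arbitrarily_large[OF inf] by blast
  obtain l where "l \<in> X" "chain D (lt T) n l" using *[OF X] by blast
  then show ?thesis using X(1) by blast
qed

text \<open>A sentence uses only as many moves as its rank, so chains of every finite length give
  agreement on all sentences.\<close>

lemma coded_game_sat:
  assumes game: "coded_game S D I D' J T pos lev" and D': "D' \<subseteq> D"
    and model: "horn_model P k D T" and inf: "infinite {x\<in>D. node D T x}" and \<phi>: "sentence S \<phi>"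
  shows "sat D I e \<phi> \<longleftrightarrow> sat D' J f \<phi>"
proof -
  note game' = game[unfolded coded_game_def]
  note start = conjunct1[OF game', rule_format]
    and forth = conjunct1[OF conjunct2[OF game'], rule_format]
    and backward = conjunct1[OF conjunct2[OF conjunct2[OF game']], rule_format]
    and inj = conjunct1[OF conjunct2[OF conjunct2[OF conjunct2[OF game']]], rule_format]
    and atom = conjunct2[OF conjunct2[OF conjunct2[OF conjunct2[OF game']]], rule_format]
  define Z where "Z q = {(x, y). x \<in> D \<and> y \<in> D \<and> pos q x y}" for q
  define \<Z> where "\<Z> n = {Z q | q l. q \<in> D \<and> l \<in> D \<and> lev q l \<and> chain D (lt T) n l}" for n
  obtain l where l: "l \<in> D" "node D T l" "chain D (lt T) (qrank \<phi>) l" using chain_exists[OF model inf] by blast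
  obtain q where q: "q \<in> D" "lev q l" using start l by blast
  show ?thesis
  proof (rule back_and_forth[where \<Z> = \<Z> and n = "qrank \<phi>" and Z = "Z q" and S = S])
    show "Z q \<in> \<Z> (qrank \<phi>)" using q l by (auto simp: \<Z>_def)
    show "fm_over S \<phi>" using \<phi> by (simp add: sentence_def)
    show "(e i, f i) \<in> Z q" if "i \<in> free_vars \<phi>" for i using \<phi> that by (simp add: sentence_def)
    show "partial_iso S I J X" if X: "X \<in> \<Z> n" for n X
    proof -
      obtain q l where ql: "X = Z q" "q \<in> D" "l \<in> D" "lev q l" using X by (auto simp: \<Z>_def)
      show ?thesis unfolding partial_iso_def
      proof (intro conjI allI impI)
        fix x y x' y' assume "(x, y) \<in> X" "(x', y') \<in> X"
        then show "x = x' \<longleftrightarrow> y = y'" using inj[OF ql(2-4)] by (simp add: ql(1) Z_def)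
      next
        fix p xs ys assume p: "S p = Some (length xs)" and "list_all2 (\<lambda>x y. (x, y) \<in> X) xs ys"
        then have "length ys = length xs" and nth: "\<And>i. i < length xs \<Longrightarrow> (xs ! i, ys ! i) \<in> Z q"
          by (simp_all add: list_all2_conv_all_nth ql(1))
        moreover from this have "set xs \<subseteq> D" "set ys \<subseteq> D"
          by (auto simp: in_set_conv_nth Z_def)
        ultimately show "I p xs \<longleftrightarrow> J p ys" using p ql
          by (intro atom[of p q l]) (auto simp: Z_def)
      qed
    qed
    show "\<exists>X'\<in>\<Z> n. X \<subseteq> X' \<and> (\<exists>y\<in>D'. (x, y) \<in> X')" if X: "X \<in> \<Z> (Suc n)" and x: "x \<in> D" for n X x
    proof -
      obtain q l where ql: "X = Z q" "q \<in> D" "l \<in> D" "lev q l" "chain D (lt T) (Suc n) l" using X by (auto simp: \<Z>_def)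
      obtain l' where l': "l' \<in> D" "lt T l' l" "chain D (lt T) n l'" using ql(5) by auto
      obtain q' y where q': "q' \<in> D" "lev q' l'" "\<forall>u\<in>D. \<forall>v\<in>D. pos q u v \<longrightarrow> pos q' u v" "y \<in> D" "y \<in> D'" "pos q' x y"
        using forth[OF ql(2,3) l'(1) x ql(4) l'(2)] by blast
      have "Z q' \<in> \<Z> n" using q' l' unfolding \<Z>_def by blast
      moreover have "X \<subseteq> Z q'" using q'(3) by (auto simp: ql(1) Z_def)
      moreover have "(x, y) \<in> Z q'" using x q' by (simp add: Z_def)
      ultimately show ?thesis using q'(5) by blast
    qed
    show "\<exists>X'\<in>\<Z> n. X \<subseteq> X' \<and> (\<exists>x\<in>D. (x, y) \<in> X')" if X: "X \<in> \<Z> (Suc n)" and y: "y \<in> D'" for n X y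
    proof -
      have yD: "y \<in> D" using y D' by blast
      obtain q l where ql: "X = Z q" "q \<in> D" "l \<in> D" "lev q l" "chain D (lt T) (Suc n) l" using X by (auto simp: \<Z>_def)
      obtain l' where l': "l' \<in> D" "lt T l' l" "chain D (lt T) n l'" using ql(5) by auto
      obtain q' x where q': "q' \<in> D" "lev q' l'" "\<forall>u\<in>D. \<forall>v\<in>D. pos q u v \<longrightarrow> pos q' u v" "x \<in> D" "pos q' x y"
        using backward[OF ql(2,3) l'(1) yD ql(4) l'(2) y] by blast
      have "Z q' \<in> \<Z> n" using q' l' unfolding \<Z>_def by blast
      moreover have "X \<subseteq> Z q'" using q'(3) by (auto simp: ql(1) Z_def)
      moreover have "(x, y) \<in> Z q'" using yD q' by (simp add: Z_def)
      ultimately show ?thesis using q'(4) by blast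
    qed
  qed simp
qed

context coding
begin

section \<open>Relativisation to the coded structure, and the game as a formula\<close>

definition fdom :: "nat \<Rightarrow> 'p fm" where "fdom x = rel (replicate 7 x)"
definition fpos :: "nat \<Rightarrow> nat \<Rightarrow> nat \<Rightarrow> 'p fm" where "fpos q x y = rel [q, x, y, y, y]"
definition flev :: "nat \<Rightarrow> nat \<Rightarrow> 'p fm" where "flev q l = rel [q, l, l, l, l, l]"
definition fatom :: "('p \<Rightarrow> nat) \<Rightarrow> 'p \<Rightarrow> nat list \<Rightarrow> 'p fm" where
  "fatom w p xs = Ex (rel (map Suc xs @ replicate (w p - length xs) 0))"
definition fincl :: "nat \<Rightarrow> nat \<Rightarrow> 'p fm" where
  "fincl q q' = Forall (Forall (Imp (fpos (Suc (Suc q)) 1 0) (fpos (Suc (Suc q')) 1 0)))"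

primrec frel :: "('p \<Rightarrow> nat) \<Rightarrow> 'p fm \<Rightarrow> 'p fm" where
  "frel w (Pred p xs) = fatom w p xs"
| "frel w (Eq x y) = Eq x y"
| "frel w Bot = Bot"
| "frel w (Imp \<phi> \<psi>) = Imp (frel w \<phi>) (frel w \<psi>)"
| "frel w (Forall \<phi>) = Forall (Imp (fdom 0) (frel w \<phi>))"

text \<open>Below the \<open>k + k\<close> quantifiers, indices less than \<open>k\<close> hold the
  tuple of the coded structure, the next \<open>k\<close> that of the ambient one,
  \<open>k + k\<close> is the level and \<open>Suc (k + k)\<close> the position.\<close>

definition fpreserve :: "('p \<Rightarrow> nat) \<Rightarrow> 'p \<Rightarrow> nat \<Rightarrow> 'p fm" where
  "fpreserve w p k = Forall (Forall (Imp (flev 1 0) (alls (k + k)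
     (Imp (conjs (map (\<lambda>i. fpos (Suc (k + k)) (k + i) i) [0..<k]))
       (Iff (Pred p [k..<k + k]) (fatom w p [0..<k]))))))"

definition fgame :: "('p \<Rightarrow> nat) \<Rightarrow> 'p signature \<Rightarrow> 'p list \<Rightarrow> 'p fm" where
  "fgame w S ps = conjs ([
     Forall (Imp (fnode 0) (Ex (flev 0 1))),
     Forall (Forall (Forall (Forall (Imp (flev 3 2) (Imp (flt 1 2)
       (Ex (conjs [flev 0 2, fincl 4 0, Ex (And (fdom 0) (fpos 1 2 0))]))))))),
     Forall (Forall (Forall (Forall (Imp (flev 3 2) (Imp (flt 1 2) (Imp (fdom 0)
       (Ex (conjs [flev 0 2, fincl 4 0, Ex (fpos 1 0 2)])))))))),
     Forall (Forall (Imp (flev 1 0) (Forall (Forall (Forall (Forall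
       (Imp (fpos 5 3 2) (Imp (fpos 5 1 0) (Iff (Eq 3 1) (Eq 2 0)))))))))) ] @
     map (\<lambda>p. fpreserve w p (the (S p))) ps)"

lemma sat_game_atoms:
  "sat D I e (fpos q x y) \<longleftrightarrow> coded_pos D (edges I) (e q) (e x) (e y)"
  "sat D I e (flev q l) \<longleftrightarrow> coded_level D (edges I) (e q) (e l)"
  "e x \<in> D \<Longrightarrow> sat D I e (fdom x) \<longleftrightarrow> e x \<in> coded_domain D (edges I)"
  "sat D I e (fatom w p xs) \<longleftrightarrow> coded_interp w D (edges I) p (map e xs)"
  by (simp_all add: fpos_def flev_def fdom_def fatom_def coded_pos_def coded_level_def
    coded_domain_def coded_interp_def sat_rel comp_def)

lemma sat_fincl: "sat D I e (fincl q q') \<longleftrightarrow>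
    (\<forall>u\<in>D. \<forall>v\<in>D. coded_pos D (edges I) (e q) u v \<longrightarrow> coded_pos D (edges I) (e q') u v)"
  by (simp add: fincl_def sat_game_atoms)

lemma sat_frel:
  "range e \<subseteq> D \<Longrightarrow> sat D I e (frel w \<phi>) \<longleftrightarrow> sat (coded_domain D (edges I)) (coded_interp w D (edges I)) e \<phi>"
proof (induction \<phi> arbitrary: e)
  case (Forall \<phi>)
  have "sat D I (case_nat x e) (frel w \<phi>) \<longleftrightarrow>
      sat (coded_domain D (edges I)) (coded_interp w D (edges I)) (case_nat x e) \<phi>" if "x \<in> D" for x
    by (rule Forall.IH) (use that Forall.prems in \<open>auto split: nat.split simp: range_subsetD\<close>)
  moreover have "coded_domain D (edges I) \<subseteq> D" by (auto simp: coded_domain_def)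
  ultimately show ?case by (simp add: sat_game_atoms(3)) blast
qed (simp_all add: sat_game_atoms)

lemma sat_fpreserve:
  "sat D I e (fpreserve w p k) \<longleftrightarrow> (\<forall>q\<in>D. \<forall>l\<in>D. coded_level D (edges I) q l \<longrightarrow>
     (\<forall>xs ys. length xs = k \<longrightarrow> length ys = k \<longrightarrow> set xs \<subseteq> D \<longrightarrow> set ys \<subseteq> D \<longrightarrow>
       (\<forall>i<k. coded_pos D (edges I) q (xs ! i) (ys ! i)) \<longrightarrow>
       (I p xs \<longleftrightarrow> coded_interp w D (edges I) p ys)))"
proof -
  let ?A = "conjs (map (\<lambda>i. fpos (Suc (k + k)) (k + i) i) [0..<k])"
  let ?B = "Iff (Pred p [k..<k + k]) (fatom w p [0..<k])"
  have body: "sat D I (env (ys @ xs) (case_nat l (case_nat q e))) (Imp ?A ?B) \<longleftrightarrow>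
      ((\<forall>i<k. coded_pos D (edges I) q (xs ! i) (ys ! i)) \<longrightarrow> (I p xs \<longleftrightarrow> coded_interp w D (edges I) p ys))"
    if len: "length xs = k" "length ys = k" for q l xs ys
  proof -
    let ?e = "env (ys @ xs) (case_nat l (case_nat q e))"
    have e: "?e (Suc (k + k)) = q" "\<And>i. i < k \<Longrightarrow> ?e i = ys ! i" "\<And>i. i < k \<Longrightarrow> ?e (k + i) = xs ! i"
      using len by (simp_all add: env_nth nth_append)
    have xs: "map ?e [k..<k + k] = xs" by (rule nth_equalityI) (use len e in simp_all)
    have ys: "map ?e [0..<k] = ys" by (rule nth_equalityI) (use len e in simp_all)
    have "sat D I ?e ?A \<longleftrightarrow> (\<forall>i<k. coded_pos D (edges I) q (xs ! i) (ys ! i))"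
      using e by (simp add: sat_game_atoms) auto
    moreover have "sat D I ?e ?B \<longleftrightarrow> (I p xs \<longleftrightarrow> coded_interp w D (edges I) p ys)"
      unfolding sat_connectives sat.simps sat_game_atoms xs ys ..
    ultimately show ?thesis by (simp only: sat.simps)
  qed
  have alls: "sat D I e' (alls (k + k) (Imp ?A ?B)) \<longleftrightarrow>
     (\<forall>xs ys. length xs = k \<longrightarrow> length ys = k \<longrightarrow> set xs \<subseteq> D \<longrightarrow> set ys \<subseteq> D \<longrightarrow>
       sat D I (env (ys @ xs) e') (Imp ?A ?B))" for e'
  proof
    assume *: "sat D I e' (alls (k + k) (Imp ?A ?B))"
    show "\<forall>xs ys. length xs = k \<longrightarrow> length ys = k \<longrightarrow> set xs \<subseteq> D \<longrightarrow> set ys \<subseteq> D \<longrightarrow>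
       sat D I (env (ys @ xs) e') (Imp ?A ?B)"
    proof (intro allI impI)
      fix xs ys assume "length xs = k" "length ys = k" "set xs \<subseteq> D" "set ys \<subseteq> D"
      then show "sat D I (env (ys @ xs) e') (Imp ?A ?B)"
        using *[unfolded sat_alls, rule_format, of "ys @ xs"] by simp
    qed
  next
    assume *: "\<forall>xs ys. length xs = k \<longrightarrow> length ys = k \<longrightarrow> set xs \<subseteq> D \<longrightarrow> set ys \<subseteq> D \<longrightarrow>
       sat D I (env (ys @ xs) e') (Imp ?A ?B)"
    show "sat D I e' (alls (k + k) (Imp ?A ?B))" unfolding sat_alls
    proof (intro allI impI)
      fix zs assume zs: "length zs = k + k" "set zs \<subseteq> D"
      have "set (drop k zs) \<subseteq> D" "set (take k zs) \<subseteq> D"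
        using zs(2) set_drop_subset[of k zs] set_take_subset[of k zs] by (blast dest: subset_trans)+
      then show "sat D I (env zs e') (Imp ?A ?B)"
        using *[rule_format, of "drop k zs" "take k zs"] zs(1) by (simp only: append_take_drop_id) simp
    qed
  qed
  have level: "sat D I (case_nat l (case_nat q e)) (flev 1 0) \<longleftrightarrow> coded_level D (edges I) q l" for q l
    by (simp add: sat_game_atoms)
  show ?thesis
    unfolding fpreserve_def sat.simps(5) sat.simps(4)[of D I _ "flev 1 0"] level alls
    by (intro ball_cong refl imp_cong all_cong1 body)
qed

lemma sat_fgame:
  assumes "set ps = dom S" and e: "range e \<subseteq> D"
  shows "sat D I e (fgame w S ps) \<longleftrightarrow>
    coded_game S D I (coded_domain D (edges I)) (coded_interp w D (edges I)) (trees_of D (edges I))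
      (coded_pos D (edges I)) (coded_level D (edges I))"
proof -
  have "sat D I e (conjs (map (\<lambda>p. fpreserve w p (the (S p))) ps)) \<longleftrightarrow>
    (\<forall>p\<in>dom S. sat D I e (fpreserve w p (the (S p))))" using assms(1) by simp
  then show ?thesis
    unfolding fgame_def coded_game_def
    by (simp add: sat_tree_atoms sat_game_atoms sat_fincl sat_fpreserve assms(1))
qed

lemma bounded_game_atoms [simp]:
  "q < n \<Longrightarrow> x < n \<Longrightarrow> y < n \<Longrightarrow> bounded n (fpos q x y)"
  "q < n \<Longrightarrow> l < n \<Longrightarrow> bounded n (flev q l)"
  "x < n \<Longrightarrow> bounded n (fdom x)"
  "set xs \<subseteq> {..<n} \<Longrightarrow> bounded n (fatom w p xs)"
  "q < n \<Longrightarrow> q' < n \<Longrightarrow> bounded n (fincl q q')"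
  unfolding fpos_def flev_def fdom_def fatom_def fincl_def
  by (auto simp: subset_iff intro!: bounded_rel)

lemma bounded_frel: "bounded n \<phi> \<Longrightarrow> bounded n (frel w \<phi>)"
  by (induction \<phi> arbitrary: n) (auto simp: subset_iff)

lemma bounded_fgame: "bounded n (fgame w S ps)"
proof -
  have "bounded n (fpreserve w p k)" for p k by (simp add: fpreserve_def subset_iff)
  then show ?thesis by (simp add: fgame_def)
qed

lemma fm_over_game:
  assumes S: "S' r = Some (Suc m)" and ps: "set ps = dom S" "S \<subseteq>\<^sub>m S'"
  shows "fm_over S' (frel w \<phi>)" "fm_over S' (fgame w S ps)" "fm_over S' (fdom x)"
proof -
  have *: "fm_over S' (fpos q x y)" "fm_over S' (flev q x)" "fm_over S' (fdom x)" "fm_over S' (fatom w p xs)"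
    "fm_over S' (fincl q y)" for q x y p xs
    by (simp_all add: fpos_def flev_def fdom_def fatom_def fincl_def fm_over_rel[of S', OF S])
  show "fm_over S' (frel w \<phi>)" by (induction \<phi>) (simp_all add: *)
  show "fm_over S' (fdom x)" by (rule *)
  have "fm_over S' (fpreserve w p (the (S p)))" if "p \<in> set ps" for p
  proof -
    have "S' p = Some (the (S p))" using that ps by (auto simp: map_le_def dom_def)
    then show ?thesis by (simp add: fpreserve_def *)
  qed
  then show "fm_over S' (fgame w S ps)" by (simp add: fgame_def * fm_over_tree_atoms[of S', OF S])
qed

end

text \<open>The length of a list tells what it stands for.\<close>

definition position_code :: "nat \<Rightarrow> (nat \<times> nat) list \<Rightarrow> nat" where
  "position_code l ps = prod_encode (l, list_encode (map prod_encode ps))"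

lemma position_code_eq [simp]: "position_code l ps = position_code l' ps' \<longleftrightarrow> l = l' \<and> ps = ps'"
  by (auto simp: position_code_def list_encode_eq inj_map_eq_map[OF inj_prod_encode])

text \<open>Lengths up to 4 belong to the trees, 5 to the pairs in a position, 6 to its level, 7 to
  the domain, and larger ones, given by \<open>w\<close>, to the symbols.\<close>

definition game_lists :: "nat trees \<Rightarrow> nat \<Rightarrow> (nat \<Rightarrow> (nat \<times> nat) list \<Rightarrow> bool) \<Rightarrow> nat set \<Rightarrow>
    ('p \<Rightarrow> nat) \<Rightarrow> 'p signature \<Rightarrow> ('p \<Rightarrow> nat list \<Rightarrow> bool) \<Rightarrow> nat list set" where
  "game_lists T n pos D' w S J = tree_lists T \<union>
     {[position_code l ps, x, y, y, y] | l ps x y. l < n \<and> pos l ps \<and> (x, y) \<in> set ps} \<union>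
     {[position_code l ps, l, l, l, l, l] | l ps. l < n \<and> pos l ps} \<union>
     {replicate 7 x | x. x \<in> D'} \<union>
     {xs @ replicate (w p - length xs) z | p xs z. S p = Some (length xs) \<and> J p xs}"

section \<open>Models for the coded games\<close>

text \<open>Finitely many lists occupy a bounded part of the naturals, so any sufficiently large
  finite domain can carry their graph.\<close>

lemma finite_coding_bound:
  assumes "finite Q"
  shows "\<exists>k. \<forall>j\<ge>k. coding_closed {..<j} Q"
proof -
  let ?X = "\<Union>t\<in>Q. \<Union>i<length t. {cell t i, 2 * (t ! i) + 2}"
  have "finite ?X" using assms by blast
  then obtain k where k: "\<forall>x\<in>?X. x < k" using finite_nat_set_iff_bounded by blast
  have "coding_closed {..<j} Q" if "k \<le> j" for j
    unfolding coding_closed_def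
  proof (intro ballI allI impI)
    fix t i assume "t \<in> Q" "i < length t"
    then have "cell t i \<in> ?X" "2 * (t ! i) + 2 \<in> ?X" by blast+
    then have "cell t i < k" "2 * (t ! i) + 2 < k" using k by blast+
    then show "cell t i \<in> {..<j} \<and> 2 * (t ! i) + 2 \<in> {..<j}" using that by simp
  qed
  then show ?thesis by blast
qed

lemma finite_tree_lists_fact_trees: "finite (tree_lists (fact_trees b fs))"
proof (rule finite_subset)
  show "tree_lists (fact_trees b fs) \<subseteq> {xs. set xs \<subseteq> {..<b + length fs} \<and> length xs \<le> 4}"
    by (auto simp: tree_lists_def fact_trees_def)
  show "finite {xs. set xs \<subseteq> {..<b + length fs} \<and> length xs \<le> 4}"
    by (rule finite_lists_length_le) simp
qed

lemma length_tree_lists: "ys \<in> tree_lists T \<Longrightarrow> length ys \<le> 4"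
  by (auto simp: tree_lists_def)

section \<open>Reading a game back from its lists\<close>

context
  fixes T :: "nat trees" and n :: nat and pos :: "nat \<Rightarrow> (nat \<times> nat) list \<Rightarrow> bool" and D' :: "nat set"
    and w :: "'p \<Rightarrow> nat" and S :: "'p signature" and J :: "'p \<Rightarrow> nat list \<Rightarrow> bool" and Q :: "nat list set"
  assumes w: "inj_on w (dom S)" "\<forall>p k. S p = Some k \<longrightarrow> k < w p \<and> 7 < w p"
  defines "Q \<equiv> game_lists T n pos D' w S J"
begin

lemma game_lists_cases:
  assumes "ys \<in> Q"
  obtains "length ys \<le> 4" "ys \<in> tree_lists T"
  | l ps x y where "length ys = 5" "ys = [position_code l ps, x, y, y, y]" "l < n" "pos l ps" "(x, y) \<in> set ps"
  | l ps where "length ys = 6" "ys = [position_code l ps, l, l, l, l, l]" "l < n" "pos l ps"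
  | x where "length ys = 7" "ys = replicate 7 x" "x \<in> D'"
  | p xs z where "length ys = w p" "7 < length ys" "ys = xs @ replicate (w p - length xs) z"
      "S p = Some (length xs)" "J p xs"
proof -
  from assms consider "ys \<in> tree_lists T"
    | l ps x y where "ys = [position_code l ps, x, y, y, y]" "l < n" "pos l ps" "(x, y) \<in> set ps"
    | l ps where "ys = [position_code l ps, l, l, l, l, l]" "l < n" "pos l ps"
    | x where "ys = replicate 7 x" "x \<in> D'"
    | p xs z where "ys = xs @ replicate (w p - length xs) z" "S p = Some (length xs)" "J p xs"
    unfolding Q_def game_lists_def by blast
  then show thesis
  proof cases
    case 1
    then show ?thesis using length_tree_lists that(1) by blast
  next
    case 2
    then show ?thesis using that(2) by simp
  next
    case 3
    then show ?thesis using that(3) by simp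
  next
    case 4
    then show ?thesis using that(4) by simp
  next
    case (5 p xs z)
    have "length ys = w p" "7 < length ys" using w(2)[rule_format, OF 5(2)] 5(1) by simp_all
    then show ?thesis using that(5)[of p xs z] 5 by blast
  qed
qed

lemma closed_UNIV: "coding_closed UNIV Q"
  by (simp add: coding_closed_def)

lemma game_lists_trees: "trees_of UNIV (coding_graph Q) = T"
proof (rule trees_of_coding_graph[OF closed_UNIV])
  fix ys :: "nat list" assume len: "length ys \<le> 4"
  show "ys \<in> Q \<longleftrightarrow> ys \<in> tree_lists T"
  proof
    assume "ys \<in> Q"
    then show "ys \<in> tree_lists T" by (cases rule: game_lists_cases) (use len in auto)
  qed (simp add: Q_def game_lists_def)
qed

lemma game_lists_pos:
  "coded_pos UNIV (coding_graph Q) q x y \<longleftrightarrow>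
    (\<exists>l ps. q = position_code l ps \<and> l < n \<and> pos l ps \<and> (x, y) \<in> set ps)"
proof -
  have "[q, x, y, y, y] \<in> Q \<longleftrightarrow> (\<exists>l ps. q = position_code l ps \<and> l < n \<and> pos l ps \<and> (x, y) \<in> set ps)"
  proof
    assume "[q, x, y, y, y] \<in> Q"
    moreover define ys where "ys = [q, x, y, y, y]"
    ultimately have "ys \<in> Q" "length ys = 5" by simp_all
    from this(1) show "\<exists>l ps. q = position_code l ps \<and> l < n \<and> pos l ps \<and> (x, y) \<in> set ps"
    proof (cases rule: game_lists_cases)
      case (2 l ps x' y')
      then show ?thesis unfolding ys_def by (intro exI[of _ l] exI[of _ ps]) simp
    qed (use \<open>length ys = 5\<close> in linarith)+
  qed (auto simp: Q_def game_lists_def)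
  then show ?thesis by (simp add: coded_pos_def reads_coding_graph[OF closed_UNIV])
qed

lemma game_lists_level:
  "coded_level UNIV (coding_graph Q) q l \<longleftrightarrow> (\<exists>ps. q = position_code l ps \<and> l < n \<and> pos l ps)"
proof -
  have "[q, l, l, l, l, l] \<in> Q \<longleftrightarrow> (\<exists>ps. q = position_code l ps \<and> l < n \<and> pos l ps)"
  proof
    assume "[q, l, l, l, l, l] \<in> Q"
    moreover define ys where "ys = [q, l, l, l, l, l]"
    ultimately have "ys \<in> Q" "length ys = 6" by simp_all
    from this(1) show "\<exists>ps. q = position_code l ps \<and> l < n \<and> pos l ps"
    proof (cases rule: game_lists_cases)
      case (3 l' ps)
      then show ?thesis unfolding ys_def by (intro exI[of _ ps]) simp
    qed (use \<open>length ys = 6\<close> in linarith)+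
  qed (auto simp: Q_def game_lists_def)
  then show ?thesis by (simp add: coded_level_def reads_coding_graph[OF closed_UNIV])
qed

lemma game_lists_domain: "coded_domain UNIV (coding_graph Q) = D'"
proof -
  have "replicate 7 x \<in> Q \<longleftrightarrow> x \<in> D'" for x
  proof
    assume "replicate 7 x \<in> Q"
    moreover define ys where "ys = replicate 7 x"
    ultimately have "ys \<in> Q" "length ys = 7" by simp_all
    from this(1) show "x \<in> D'"
    proof (cases rule: game_lists_cases)
      case (4 y)
      have "x = hd ys" "y = hd ys" by (subst ys_def, simp) (subst 4(2), simp)
      then show ?thesis using 4(3) by simp
    qed (use \<open>length ys = 7\<close> in linarith)+
  qed (auto simp: Q_def game_lists_def)
  then show ?thesis by (simp add: coded_domain_def reads_coding_graph[OF closed_UNIV])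
qed

lemma game_lists_interp:
  assumes p: "S p = Some (length xs)"
  shows "coded_interp w UNIV (coding_graph Q) p xs \<longleftrightarrow> J p xs"
proof -
  have ne: "xs @ replicate (w p - length xs) z \<noteq> []" for z using w(2)[rule_format, OF p] by simp
  have len: "length (xs @ replicate (w p - length xs) z) = w p" for z using w(2)[rule_format, OF p] by simp
  have "xs @ replicate (w p - length xs) z \<in> Q \<longleftrightarrow> J p xs" for z
  proof
    assume "xs @ replicate (w p - length xs) z \<in> Q"
    moreover define ys where "ys = xs @ replicate (w p - length xs) z"
    ultimately have "ys \<in> Q" and len_ys: "length ys = w p" using len by simp_all
    from this(1) show "J p xs"
    proof (cases rule: game_lists_cases)
      case (5 p' xs' z')
      have "w p = w p'" using 5(1) len_ys by simp
      then have "p = p'" using w(1) p 5(4) by (auto simp: inj_on_def dom_def)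
      then have "length xs' = length xs" using 5(4) p by simp
      then show ?thesis using 5(3,5) \<open>p = p'\<close> unfolding ys_def by simp
    qed (use len_ys w(2)[rule_format, OF p] in linarith)+
  next
    assume "J p xs"
    then show "xs @ replicate (w p - length xs) z \<in> Q" using p unfolding Q_def game_lists_def by blast
  qed
  then show ?thesis by (simp add: coded_interp_def reads_coding_graph[OF closed_UNIV ne])
qed

end

text \<open>A position is put at level \<open>l\<close> if it is won with \<open>l\<close> moves to
  come. To move to a level \<open>l' < l\<close>, surplus moves are dropped until
  \<open>Suc l'\<close> remain, and one is used. The empty position can start at every level, since
  all levels are below \<open>n\<close>.\<close>

lemma concrete_game:
  fixes I :: "'p \<Rightarrow> nat list \<Rightarrow> bool" and D' :: "nat set"
  assumes w: "inj_on w (dom S')" "\<forall>p k. S' p = Some k \<longrightarrow> k < w p \<and> 7 < w p" and sub: "S \<subseteq>\<^sub>m S'"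
    and T: "\<And>l. node UNIV T l \<longleftrightarrow> l < n" "\<And>x y. lt T x y \<longleftrightarrow> x < y \<and> y < n"
    and ef: "ef_equiv S n 0 UNIV I e D' J f"
  defines "Q \<equiv> game_lists T n (ef_position S UNIV I e D' J f) D' w S' J"
  shows "coded_game S UNIV I D' (coded_interp w UNIV (coding_graph Q)) T
    (coded_pos UNIV (coding_graph Q)) (coded_level UNIV (coding_graph Q))"
proof -
  let ?pos = "ef_position S UNIV I e D' J f" and ?cp = "coded_pos UNIV (coding_graph Q)"
    and ?cl = "coded_level UNIV (coding_graph Q)"
  note pos = game_lists_pos[OF w, of T n ?pos D' J, folded Q_def]
  note level = game_lists_level[OF w, of T n ?pos D' J, folded Q_def]
  note interp = game_lists_interp[OF w, of _ _ T n ?pos D' J, folded Q_def]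
  have mono: "?pos l' ps" if "?pos l ps" "l' \<le> l" for l l' ps using ef_position_mono that by blast
  have iso: "partial_iso S I J (set ps)" if "?pos l ps" for l ps
    by (rule ef_position_partial_iso[OF that]) simp
  have pos_iff: "?cp (position_code l ps) x y \<longleftrightarrow> (x, y) \<in> set ps"
    if "l < n" "?pos l ps" for l ps x y using that by (auto simp: pos)
  show ?thesis unfolding coded_game_def
  proof (intro conjI ballI allI impI)
    fix l assume "node UNIV T l"
    then have "l < n" using T by simp
    moreover have "?pos n []" using ef by (simp add: ef_position_def)
    ultimately have "?pos l []" using mono by simp
    then show "\<exists>q\<in>UNIV. ?cl q l" using \<open>l < n\<close> by (auto simp: level)
  next
    fix q l l' x assume "?cl q l" "lt T l' l"
    then obtain ps where ps: "q = position_code l ps" "l < n" "?pos l ps" "l' < l" by (auto simp: level T)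
    have "?pos (Suc l') ps" using mono ps by simp
    then obtain y where y: "y \<in> D'" "?pos l' ((x, y) # ps)" using ef_position_forth[of S UNIV I e D' J f l' ps x] by auto
    have l': "l' < n" using ps by simp
    let ?q = "position_code l' ((x, y) # ps)"
    have "?cl ?q l'" using y l' by (simp add: level)
    moreover have "\<forall>u\<in>UNIV. \<forall>v\<in>UNIV. ?cp q u v \<longrightarrow> ?cp ?q u v"
      unfolding ps(1) pos_iff[OF ps(2,3)] pos_iff[OF l' y(2)] by simp
    moreover have "?cp ?q x y" unfolding pos_iff[OF l' y(2)] by simp
    ultimately show "\<exists>q'\<in>UNIV. ?cl q' l' \<and>
      (\<forall>u\<in>UNIV. \<forall>v\<in>UNIV. ?cp q u v \<longrightarrow> ?cp q' u v) \<and>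
      (\<exists>y\<in>UNIV. y \<in> D' \<and> ?cp q' x y)" using y(1) by blast
  next
    fix q l l' y assume "?cl q l" "lt T l' l" "y \<in> D'"
    then obtain ps where ps: "q = position_code l ps" "l < n" "?pos l ps" "l' < l" by (auto simp: level T)
    have "?pos (Suc l') ps" using mono ps by simp
    then obtain x where y: "?pos l' ((x, y) # ps)" using ef_position_back[of S UNIV I e D' J f l' ps y] \<open>y \<in> D'\<close> by auto
    have l': "l' < n" using ps by simp
    let ?q = "position_code l' ((x, y) # ps)"
    have "?cl ?q l'" using y l' by (simp add: level)
    moreover have "\<forall>u\<in>UNIV. \<forall>v\<in>UNIV. ?cp q u v \<longrightarrow> ?cp ?q u v"
      unfolding ps(1) pos_iff[OF ps(2,3)] pos_iff[OF l' y] by simp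
    moreover have "?cp ?q x y" unfolding pos_iff[OF l' y] by simp
    ultimately show "\<exists>q'\<in>UNIV. ?cl q' l' \<and>
      (\<forall>u\<in>UNIV. \<forall>v\<in>UNIV. ?cp q u v \<longrightarrow> ?cp q' u v) \<and>
      (\<exists>x\<in>UNIV. ?cp q' x y)" by blast
  next
    fix q l x y x' y' assume lev: "?cl q l"
      and p: "?cp q x y" "?cp q x' y'"
    obtain ps where ps: "q = position_code l ps" "l < n" "?pos l ps" using lev by (auto simp: level)
    have "(x, y) \<in> set ps" "(x', y') \<in> set ps" using p unfolding ps(1) pos_iff[OF ps(2,3)] by simp_all
    then show "x = x' \<longleftrightarrow> y = y'" using iso[OF ps(3)] unfolding partial_iso_def by simp
  next
    fix p q l xs ys assume "p \<in> dom S" and lev: "?cl q l"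
      and len: "length xs = the (S p)" "length ys = the (S p)"
      and nth: "\<forall>i<the (S p). ?cp q (xs ! i) (ys ! i)"
    obtain ps where ps: "q = position_code l ps" "l < n" "?pos l ps" using lev by (auto simp: level)
    have Sp: "S p = Some (length xs)" using \<open>p \<in> dom S\<close> len by auto
    have "list_all2 (\<lambda>x y. (x, y) \<in> set ps) xs ys"
      using nth len unfolding ps(1) pos_iff[OF ps(2,3)] by (simp add: list_all2_conv_all_nth)
    then have "I p xs \<longleftrightarrow> J p ys" using iso[OF ps(3)] Sp unfolding partial_iso_def by simp
    moreover have "S' p = Some (length ys)"
      using sub \<open>p \<in> dom S\<close> Sp len by (auto simp: map_le_def)
    ultimately show "I p xs \<longleftrightarrow> coded_interp w UNIV (coding_graph Q) p ys" using interp by simp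
  qed
qed

section \<open>The theorem\<close>

lemma fm_over_map_le: "S \<subseteq>\<^sub>m S' \<Longrightarrow> fm_over S \<phi> \<Longrightarrow> fm_over S' \<phi>"
  by (induction \<phi>) (auto simp: map_le_def dom_def)

lemma sentence_map_le: "S \<subseteq>\<^sub>m S' \<Longrightarrow> sentence S \<phi> \<Longrightarrow> sentence S' \<phi>"
  by (auto simp: sentence_def fm_over_map_le)

lemma entails_trans: "entails \<phi> \<psi> \<Longrightarrow> entails \<psi> \<chi> \<Longrightarrow> entails \<phi> \<chi>"
  by (simp add: entails_def)

text \<open>On the argument list of an edge, entry 1 is the first of the repeated arguments, so
  \<open>r\<close> is read as the graph itself.\<close>

definition expansion :: "'p signature \<Rightarrow> ('p \<Rightarrow> nat list \<Rightarrow> bool) \<Rightarrow> nat list set \<Rightarrow> 'p \<Rightarrow> nat list \<Rightarrow> bool" where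
  "expansion S I Q p xs = (if p \<in> dom S then I p xs else coding_graph Q (xs ! 0) (xs ! 1))"

lemma sat_expansion: "sentence S \<phi> \<Longrightarrow> sat D (expansion S I Q) e \<phi> \<longleftrightarrow> sat D I e \<phi>"
  by (rule sat_fm_over[of S]) (auto simp: sentence_def expansion_def)

lemma coded_game_expansion:
  "coded_game S D I D' J T pos lev \<Longrightarrow> coded_game S D (expansion S I Q) D' J T pos lev"
  unfolding coded_game_def by (simp add: expansion_def)

context coding
begin

lemma edges_expansion: "r \<notin> dom S \<Longrightarrow> edges (expansion S I Q) = coding_graph Q"
  using m by (intro ext) (simp add: edges_def expansion_def)

text \<open>
  Here the infinite models of one consequence of \<open>\<alpha>\<close> satisfy all of them, and the coded
  derivation alone forces a model to be infinite.
\<close>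

lemma weaker_sentence_if_infinite_models_good:
  assumes sig: "S \<subseteq>\<^sub>m S'" "finite (dom S')" "S' r = Some (Suc m)" "r \<notin> dom S" and \<alpha>: "sentence S' \<alpha>"
    and not_axiom: "\<And>\<sigma>. sentence S \<sigma> \<Longrightarrow> entails \<alpha> \<sigma> \<Longrightarrow> \<exists>A. sentence S A \<and> entails \<alpha> A \<and> \<not> entails \<sigma> A"
    and \<sigma>: "sentence S \<sigma>" "entails \<alpha> \<sigma>"
    and good: "\<And>(D :: nat set) I e A. range e \<subseteq> D \<Longrightarrow> infinite D \<Longrightarrow> sat D I e \<sigma> \<Longrightarrow> sentence S A \<Longrightarrow>
      entails \<alpha> A \<Longrightarrow> sat D I e A"
  shows "\<exists>\<gamma>. sentence S' \<gamma> \<and> (\<forall>A. sentence S A \<longrightarrow> entails \<alpha> A \<longrightarrow> entails \<gamma> A) \<and> \<not> {\<gamma>} \<turnstile> \<alpha>"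
proof -
  have finS: "finite (dom S)" using sig(1,2) by (meson finite_subset map_le_implies_dom_le)
  obtain \<gamma> where "self_refuting S' \<sigma> \<alpha> \<gamma>"
    using self_refuting_sentence[OF sig(3,2) sentence_map_le[OF sig(1) \<sigma>(1)] \<alpha>] by (elim exE) (rule that)
  note \<gamma>' = this[unfolded self_refuting_def]
  note \<gamma> = conjunct1[OF \<gamma>'] and sat_\<sigma> = conjunct1[OF conjunct2[OF \<gamma>'], rule_format]
    and inf = conjunct1[OF conjunct2[OF conjunct2[OF \<gamma>']], rule_format]
    and code = conjunct2[OF conjunct2[OF conjunct2[OF \<gamma>']], rule_format]
  have unprovable: "\<not> {\<gamma>} \<turnstile> \<alpha>"
  proof
    assume prov: "{\<gamma>} \<turnstile> \<alpha>"
    from code[OF prov] obtain b fs where sat_\<gamma>: "\<And>(D :: nat set) I e. range e \<subseteq> D \<Longrightarrow> {..<b + length fs} \<subseteq> D \<Longrightarrow>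
      trees_of D (edges I) = fact_trees b fs \<Longrightarrow> sat D I e \<sigma> \<Longrightarrow> sat D I e \<gamma>" by blast
    define Q where "Q = tree_lists (fact_trees b fs)"
    obtain k where k: "\<And>j. k \<le> j \<Longrightarrow> coding_closed {..<j} Q"
      using finite_coding_bound[OF finite_tree_lists_fact_trees[of b fs]] unfolding Q_def by blast
    \<comment> \<open>A domain of at least \<open>K\<close> elements has room for all cells and
      names and for the \<open>b + length fs\<close> nodes.\<close>
    define K where "K = max k (b + length fs)"
    obtain \<tau> where \<tau>: "sentence S \<tau>" "entails \<alpha> \<tau>"
      "\<And>(D :: nat set) I e. range e \<subseteq> D \<Longrightarrow> sat D I e \<tau> \<Longrightarrow>
        \<exists>(D' :: nat set) J f. range f \<subseteq> D' \<and> sat D' J f \<alpha> \<and> ef_equiv S (Suc K) 0 D I e D' J f"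
      using ef_type_sentence[OF finS, of \<alpha> "Suc K"] by blast
    \<comment> \<open>The size of a counterexample is controlled from both sides:
      \<open>\<sigma>\<close> makes it finite, and \<tau> makes it larger than \<open>K\<close>,
      since a smaller one would be isomorphic in the signature \<open>S\<close> to a model of
      \<open>\<alpha>\<close>.\<close>
    have "sentence S (And \<sigma> \<tau>)" using \<sigma>(1) \<tau>(1) by (simp add: sentence_def And_def)
    moreover have "entails \<alpha> (And \<sigma> \<tau>)" using \<sigma>(2) \<tau>(2) unfolding entails_def sat_connectives by blast
    ultimately obtain A where A: "sentence S A" "entails \<alpha> A" "\<not> entails (And \<sigma> \<tau>) A"
      using not_axiom by blast
    then obtain D :: "nat set" and I e where D: "range e \<subseteq> D" "sat D I e \<sigma>" "sat D I e \<tau>" "\<not> sat D I e A"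
      unfolding entails_def sat_connectives by blast
    have fin: "finite D" using good D A by blast
    have "D \<noteq> {}" using D(1) by auto
    have large: "K < card D"
    proof (rule ccontr)
      assume "\<not> K < card D"
      then have "card D \<le> K" by simp
      obtain D' :: "nat set" and J f where D': "range f \<subseteq> D'" "sat D' J f \<alpha>" "ef_equiv S (Suc K) 0 D I e D' J f"
        using \<tau>(3)[OF D(1,3)] by blast
      have "sat D' J f A" using A(2) D' unfolding entails_def by blast
      then show False
        using ef_equiv_small[OF fin \<open>card D \<le> K\<close> \<open>D \<noteq> {}\<close> D'(3) A(1)] D(4) by blast
    qed
    obtain h where "bij_betw h D {..<card D}"
      using ex_bij_betw_finite_nat[OF fin] by (auto simp: atLeast0LessThan)
    from transport[OF this, of S I] obtain J where
      "\<forall>\<phi> e f. sentence S \<phi> \<longrightarrow> (sat D I e \<phi> \<longleftrightarrow> sat {..<card D} J f \<phi>)" by (elim exE) (rule that)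
    note J = this[rule_format]
    let ?D = "{..<card D}" and ?I = "expansion S J Q" and ?e = "\<lambda>_::nat. 0::nat"
    have e: "range ?e \<subseteq> ?D" using large by auto
    have "trees_of ?D (edges ?I) = fact_trees b fs"
      unfolding edges_expansion[OF sig(4)]
      by (rule trees_of_coding_graph) (use k[of "card D"] large in \<open>simp_all add: K_def Q_def\<close>)
    moreover have "{..<b + length fs} \<subseteq> ?D" using large by (auto simp: K_def)
    moreover have "sat ?D ?I ?e \<sigma>" using J[OF \<sigma>(1), of e ?e] D(2) by (simp add: sat_expansion[OF \<sigma>(1)])
    ultimately have "sat ?D ?I ?e \<gamma>" by (intro sat_\<gamma>[OF e])
    then have "sat ?D ?I ?e \<alpha>" using soundness[OF prov e] by blast
    then have "sat ?D ?I ?e A" using A(2) e unfolding entails_def by blast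
    then have "sat ?D J ?e A" by (simp add: sat_expansion[OF A(1)])
    then show False using J[OF A(1), of e ?e] D(4) by simp
  qed
  moreover have "entails \<gamma> A" if A: "sentence S A" "entails \<alpha> A" for A
    unfolding entails_def
  proof (intro allI impI)
    fix D :: "nat set" and I e assume e: "range e \<subseteq> D" "sat D I e \<gamma>"
    then have "infinite D" using inf[OF e unprovable] by auto
    then show "sat D I e A" using good e sat_\<sigma> A by blast
  qed
  ultimately show ?thesis using \<gamma> by blast
qed

text \<open>
  Otherwise the sentence also asks for a coded model of \<open>\<alpha>\<close> and a back-and-forth game with it
  whose length is the length of the coded derivation.
\<close>

lemma weaker_sentence_if_infinite_models_bad:
  assumes sig: "S \<subseteq>\<^sub>m S'" "finite (dom S')" "S' r = Some (Suc m)" "r \<notin> dom S" and \<alpha>: "sentence S' \<alpha>"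
    and bad: "\<And>\<sigma>. sentence S \<sigma> \<Longrightarrow> entails \<alpha> \<sigma> \<Longrightarrow> \<exists>(D :: nat set) I e A. range e \<subseteq> D \<and> infinite D \<and>
      sat D I e \<sigma> \<and> sentence S A \<and> entails \<alpha> A \<and> \<not> sat D I e A"
  shows "\<exists>\<gamma>. sentence S' \<gamma> \<and> (\<forall>A. sentence S A \<longrightarrow> entails \<alpha> A \<longrightarrow> entails \<gamma> A) \<and> \<not> {\<gamma>} \<turnstile> \<alpha>"
proof -
  have finS: "finite (dom S)" using sig(1,2) by (meson finite_subset map_le_implies_dom_le)
  obtain ps where ps: "set ps = dom S" using finite_list[OF finS] by blast
  obtain idx :: "'p \<Rightarrow> nat" where idx: "inj_on idx (dom S')"
    using finite_imp_inj_to_nat_seg[OF sig(2)] by auto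
  have "finite ((\<lambda>p. the (S' p)) ` dom S')" using sig(2) by simp
  then obtain a where a: "\<forall>k\<in>(\<lambda>p. the (S' p)) ` dom S'. k < a" using finite_nat_set_iff_bounded by blast
  \<comment> \<open>The summand 8 avoids the lengths 1 to 7, \<open>a\<close> leaves room for every
    argument list, and \<open>idx\<close> separates the symbols.\<close>
  define w where "w p = 8 + a + idx p" for p
  have w: "inj_on w (dom S')" using idx by (simp add: inj_on_def w_def)
  have w': "\<forall>p k. S' p = Some k \<longrightarrow> k < w p \<and> 7 < w p"
  proof (intro allI impI)
    fix p k assume "S' p = Some k"
    then have "k \<in> (\<lambda>p. the (S' p)) ` dom S'" by force
    then have "k < a" using a by blast
    then show "k < w p \<and> 7 < w p" by (simp add: w_def)
  qed
  define \<chi> where "\<chi> = conjs [frel w \<alpha>, Ex (fdom 0), fgame w S ps]"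
  note over = fm_over_game[of S', OF sig(3) ps sig(1)]
  have \<chi>: "sentence S' \<chi>"
  proof -
    have "bounded 0 \<alpha>" using \<alpha> by (simp add: sentence_def bounded_0)
    then have "bounded 0 \<chi>" by (simp add: \<chi>_def bounded_frel bounded_fgame)
    moreover have "fm_over S' \<chi>" by (simp add: \<chi>_def over)
    ultimately show ?thesis unfolding sentence_def bounded_0 by blast
  qed
  obtain \<gamma> where "self_refuting S' \<chi> \<alpha> \<gamma>"
    using self_refuting_sentence[OF sig(3,2) \<chi> \<alpha>] by (elim exE) (rule that)
  note \<gamma>' = this[unfolded self_refuting_def]
  note \<gamma> = conjunct1[OF \<gamma>'] and sat_\<chi> = conjunct1[OF conjunct2[OF \<gamma>'], rule_format]
    and inf = conjunct1[OF conjunct2[OF conjunct2[OF \<gamma>']], rule_format]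
    and code = conjunct2[OF conjunct2[OF conjunct2[OF \<gamma>']], rule_format]
  have unprovable: "\<not> {\<gamma>} \<turnstile> \<alpha>"
  proof
    assume prov: "{\<gamma>} \<turnstile> \<alpha>"
    from code[OF prov] obtain b fs where fs: "\<forall>f\<in>set fs. tnat f < b" and sat_\<gamma>: "\<And>(D :: nat set) I e. range e \<subseteq> D \<Longrightarrow> {..<b + length fs} \<subseteq> D \<Longrightarrow>
      trees_of D (edges I) = fact_trees b fs \<Longrightarrow> sat D I e \<chi> \<Longrightarrow> sat D I e \<gamma>" by blast
    \<comment> \<open>The number of nodes of the coded derivation, hence the number of levels;
      equivalence for this many moves is all that the game requires.\<close>
    let ?n = "b + length fs" and ?T = "fact_trees b fs"
    obtain \<sigma> where \<sigma>: "sentence S \<sigma>" "entails \<alpha> \<sigma>"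
      "\<And>(D :: nat set) I e. range e \<subseteq> D \<Longrightarrow> sat D I e \<sigma> \<Longrightarrow>
        \<exists>(D' :: nat set) J f. range f \<subseteq> D' \<and> sat D' J f \<alpha> \<and> ef_equiv S ?n 0 D I e D' J f"
      using ef_type_sentence[OF finS, of \<alpha> ?n] by blast
    from bad[OF \<sigma>(1,2)] obtain D :: "nat set" and I0 e0 A where D: "range e0 \<subseteq> D" "infinite D" "sat D I0 e0 \<sigma>"
      and A: "sentence S A" "entails \<alpha> A" "\<not> sat D I0 e0 A" by blast
    \<comment> \<open>With all of the naturals as domain, every cell, name and position code is an
      element, and a coded model of any countable size fits.\<close>
    from transport[OF bij_betw_inv_into[OF bij_enumerate[OF D(2)]], of S I0] obtain I :: "'p \<Rightarrow> nat list \<Rightarrow> bool" where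
      "\<forall>\<phi> e f. sentence S \<phi> \<longrightarrow> (sat D I0 e \<phi> \<longleftrightarrow> sat UNIV I f \<phi>)" by (elim exE) (rule that)
    note I = this[rule_format]
    define e where "e = (\<lambda>_::nat. 0::nat)"
    have "sat UNIV I e \<sigma>" using I[OF \<sigma>(1), of e0 e] D(3) by simp
    then obtain D' :: "nat set" and J f where D': "range f \<subseteq> D'" "sat D' J f \<alpha>" and ef: "ef_equiv S ?n 0 UNIV I e D' J f"
      using \<sigma>(3)[of e UNIV I] by blast
    define Q where "Q = game_lists ?T ?n (ef_position S UNIV I e D' J f) D' w S' J"
    let ?I = "expansion S I Q"
    note edges = edges_expansion[OF sig(4), of I Q]
    note lists = game_lists_trees[OF w w', of ?T ?n "ef_position S UNIV I e D' J f" D' J, folded Q_def]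
      game_lists_domain[OF w w', of ?T ?n "ef_position S UNIV I e D' J f" D' J, folded Q_def]
      game_lists_interp[OF w w', of _ _ ?T ?n "ef_position S UNIV I e D' J f" D' J, folded Q_def]
    have "coded_game S UNIV I D' (coded_interp w UNIV (coding_graph Q)) ?T
        (coded_pos UNIV (coding_graph Q)) (coded_level UNIV (coding_graph Q))"
      unfolding Q_def
    proof (rule concrete_game[OF w w' sig(1) _ _ ef])
      show "node UNIV ?T l \<longleftrightarrow> l < ?n" for l by (rule node_fact_trees[OF subset_UNIV fs])
      show "lt ?T x y \<longleftrightarrow> x < y \<and> y < ?n" for x y by (simp add: fact_trees_def)
    qed
    then have "sat UNIV ?I e (fgame w S ps)"
      unfolding sat_fgame[OF ps subset_UNIV] edges lists(1,2) by (rule coded_game_expansion)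
    moreover have "sat UNIV ?I e (frel w \<alpha>)"
    proof -
      \<comment> \<open>The coded interpretation agrees with \<open>J\<close> on argument lists of
        the correct arity, which is enough for a formula over \<open>S'\<close>.\<close>
      have "sat D' (coded_interp w UNIV (coding_graph Q)) f \<alpha> \<longleftrightarrow> sat D' J f \<alpha>"
        by (rule sat_fm_over[of S']) (use \<alpha> lists(3) in \<open>auto simp: sentence_def\<close>)
      then show ?thesis
        unfolding sat_frel[OF subset_UNIV] edges lists(2)
        using D'(2) sat_sentence[OF \<alpha>] by blast
    qed
    moreover have "sat UNIV ?I e (Ex (fdom 0))"
      using D'(1) by (auto simp: sat_game_atoms edges lists(2))
    ultimately have "sat UNIV ?I e \<chi>" by (simp add: \<chi>_def)
    then have "sat UNIV ?I e \<gamma>"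
      by (intro sat_\<gamma>) (simp_all add: edges lists(1))
    then have "sat UNIV ?I e \<alpha>" using soundness[OF prov subset_UNIV] by blast
    then have "sat UNIV ?I e A" using A(2) unfolding entails_def by blast
    then have "sat UNIV I e A" by (simp add: sat_expansion[OF A(1)])
    then show False using I[OF A(1), of e0 e] A(3) by simp
  qed
  moreover have "entails \<gamma> A" if A: "sentence S A" "entails \<alpha> A" for A
    unfolding entails_def
  proof (intro allI impI)
    fix D :: "nat set" and I e assume e: "range e \<subseteq> D" "sat D I e \<gamma>"
    let ?D' = "coded_domain D (edges I)" and ?J = "coded_interp w D (edges I)"
    have \<chi>': "sat D I e (frel w \<alpha>)" "sat D I e (Ex (fdom 0))" "sat D I e (fgame w S ps)"
      using sat_\<chi>[OF e] by (simp_all add: \<chi>_def)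
    from \<chi>'(2) obtain d where d: "d \<in> ?D'" by (auto simp: sat_game_atoms)
    have "sat ?D' ?J (\<lambda>_. d) \<alpha>"
      using \<chi>'(1) sat_sentence[OF \<alpha>] unfolding sat_frel[OF e(1)] by blast
    moreover have "range (\<lambda>_::nat. d) \<subseteq> ?D'" using d by auto
    ultimately have "sat ?D' ?J (\<lambda>_. d) A" using A(2) unfolding entails_def by blast
    moreover obtain P k where "horn_model P k D (trees_of D (edges I))"
      "infinite {x\<in>D. node D (trees_of D (edges I)) x}" using inf[OF e unprovable] by blast
    moreover have "?D' \<subseteq> D" by (auto simp: coded_domain_def)
    ultimately show "sat D I e A"
      using coded_game_sat[OF \<chi>'(3)[unfolded sat_fgame[OF ps e(1)]], of P k A e "\<lambda>_. d"] A(1) by blast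
  qed
  ultimately show ?thesis using \<gamma> by blast
qed

end

theorem corollary4p2:
  fixes S \<Theta> :: "'p signature" and U :: "'p fm set"
  assumes "finite (dom S)" and "theory_over S U" and "\<not> finitely_axiomatizable S U"
    and "finite (dom \<Theta>)" and "dom S \<inter> dom \<Theta> = {}"
    and "\<exists>p n. \<Theta> p = Some n \<and> n \<ge> 2"
  shows "\<forall>\<alpha>. sentence (S ++ \<Theta>) \<alpha> \<and> conservative_extension S \<alpha> U \<longrightarrow>
    (\<exists>\<beta>. sentence (S ++ \<Theta>) \<beta> \<and> conservative_extension S \<beta> U \<and>
         {\<alpha>} \<turnstile> \<beta> \<and> \<not> {\<beta>} \<turnstile> \<alpha>)"
proof (intro allI impI)
  fix \<alpha> assume "sentence (S ++ \<Theta>) \<alpha> \<and> conservative_extension S \<alpha> U"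
  then have \<alpha>: "sentence (S ++ \<Theta>) \<alpha>" and cons: "conservative_extension S \<alpha> U" by auto
  obtain r n where r: "\<Theta> r = Some n" "n \<ge> 2" using assms(6) by blast
  interpret coding r "n - 1" by standard (use r in simp)
  have le: "S \<subseteq>\<^sub>m S ++ \<Theta>"
    unfolding map_le_def
  proof
    fix p assume "p \<in> dom S"
    then have "p \<notin> dom \<Theta>" using assms(5) by blast
    then show "S p = (S ++ \<Theta>) p" by (simp add: map_add_def domIff)
  qed
  have "finite (dom (S ++ \<Theta>))" using assms(1,4) by simp
  moreover have "(S ++ \<Theta>) r = Some (Suc (n - 1))" using r by (simp add: map_add_def)
  moreover have "r \<notin> dom S" using r(1) assms(5) by (metis domI disjoint_iff)
  ultimately have sig: "finite (dom (S ++ \<Theta>))" "(S ++ \<Theta>) r = Some (Suc (n - 1))" "r \<notin> dom S" .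
  have compl: "{\<phi>} \<turnstile> \<psi> \<longleftrightarrow> entails \<phi> \<psi>" if "sentence T \<phi>" "sentence T' \<psi>" for T T' and \<phi> \<psi> :: "'p fm"
    by (rule completeness) (use that in \<open>simp_all add: sentence_def\<close>)
  note cons' = cons[unfolded conservative_extension_def]
  \<comment> \<open>From here on \<open>\<alpha>\<close> replaces \<open>U\<close>: theorems of
    \<open>U\<close> are the consequences of \<open>\<alpha>\<close> in the signature
    \<open>S\<close>.\<close>
  have U: "U \<turnstile> A \<longleftrightarrow> entails \<alpha> A" if A: "sentence S A" for A
  proof -
    have "U \<turnstile> A \<longleftrightarrow> {\<alpha>} \<turnstile> A"
      by (rule iffI) (erule cons'[THEN conjunct1, rule_format, OF A], erule cons'[THEN conjunct2, rule_format, OF A])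
    then show ?thesis by (simp only: compl[OF \<alpha> A])
  qed
  \<comment> \<open>Otherwise the single sentence \<sigma> would axiomatize
    \<open>U\<close>.\<close>
  have not_axiom: "\<exists>A. sentence S A \<and> entails \<alpha> A \<and> \<not> entails \<sigma> A" if \<sigma>: "sentence S \<sigma>" "entails \<alpha> \<sigma>" for \<sigma>
  proof (rule ccontr)
    assume none: "\<not> ?thesis"
    have "{\<sigma>} \<turnstile> A \<longleftrightarrow> U \<turnstile> A" if A: "sentence S A" for A
    proof -
      have "entails \<sigma> A \<longleftrightarrow> entails \<alpha> A"
        using none A entails_trans[OF \<sigma>(2)] by blast
      then show ?thesis using compl[OF \<sigma>(1) A] U[OF A] by simp
    qed
    then show False using \<sigma>(1) assms(3) unfolding finitely_axiomatizable_def axiomatizes_def by blast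
  qed
  have "\<exists>\<gamma>. sentence (S ++ \<Theta>) \<gamma> \<and> (\<forall>A. sentence S A \<longrightarrow> entails \<alpha> A \<longrightarrow> entails \<gamma> A) \<and> \<not> {\<gamma>} \<turnstile> \<alpha>"
  proof (cases "\<exists>\<sigma>. sentence S \<sigma> \<and> entails \<alpha> \<sigma> \<and> (\<forall>(D :: nat set) I e A. range e \<subseteq> D \<longrightarrow> infinite D \<longrightarrow>
      sat D I e \<sigma> \<longrightarrow> sentence S A \<longrightarrow> entails \<alpha> A \<longrightarrow> sat D I e A)")
    case True
    then obtain \<sigma> where \<sigma>: "sentence S \<sigma>" "entails \<alpha> \<sigma>" and good: "\<And>(D :: nat set) I e A. range e \<subseteq> D \<Longrightarrow> infinite D \<Longrightarrow>
      sat D I e \<sigma> \<Longrightarrow> sentence S A \<Longrightarrow> entails \<alpha> A \<Longrightarrow> sat D I e A" by blast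
    show ?thesis
      by (rule weaker_sentence_if_infinite_models_good[OF le sig \<alpha> not_axiom \<sigma> good])
  next
    case False
    show ?thesis
      by (rule weaker_sentence_if_infinite_models_bad[OF le sig \<alpha>]) (use False in blast)
  qed
  then obtain \<gamma> where \<gamma>: "sentence (S ++ \<Theta>) \<gamma>" "\<And>A. sentence S A \<Longrightarrow> entails \<alpha> A \<Longrightarrow> entails \<gamma> A"
    "\<not> {\<gamma>} \<turnstile> \<alpha>" by blast
  let ?\<beta> = "Or \<alpha> \<gamma>"
  have \<beta>: "sentence (S ++ \<Theta>) ?\<beta>" using \<alpha> \<gamma>(1) by (simp add: sentence_def Or_def)
  have "entails ?\<beta> A \<longleftrightarrow> entails \<alpha> A" if A: "sentence S A" for A
  proof
    assume "entails ?\<beta> A"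
    moreover have "entails \<alpha> ?\<beta>" by (simp add: entails_def)
    ultimately show "entails \<alpha> A" by (rule entails_trans[rotated])
  next
    assume "entails \<alpha> A"
    then have "entails \<gamma> A" using \<gamma>(2) A by blast
    then show "entails ?\<beta> A" using \<open>entails \<alpha> A\<close> by (simp add: entails_def)
  qed
  then have "{?\<beta>} \<turnstile> A \<longleftrightarrow> U \<turnstile> A" if "sentence S A" for A
    using that by (simp add: compl[OF \<beta> that] U[OF that])
  then have "conservative_extension S ?\<beta> U"
    unfolding conservative_extension_def by (intro conjI allI impI) simp_all
  moreover have "{\<alpha>} \<turnstile> ?\<beta>" unfolding compl[OF \<alpha> \<beta>] entails_def by simp
  moreover have "entails \<gamma> ?\<beta>" by (simp add: entails_def)
  then have "\<not> {?\<beta>} \<turnstile> \<alpha>"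
    using \<gamma>(3) entails_trans unfolding compl[OF \<beta> \<alpha>] compl[OF \<gamma>(1) \<alpha>] by blast
  ultimately show "\<exists>\<beta>. sentence (S ++ \<Theta>) \<beta> \<and> conservative_extension S \<beta> U \<and> {\<alpha>} \<turnstile> \<beta> \<and> \<not> {\<beta>} \<turnstile> \<alpha>"
    using \<beta> by blast
qed

end
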